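(* Let $G$ be a graph. Then $q(G)\geq |G|-1$ if and only if $G$ is one of the following: (a) a path; (b) the disjoint union of a path and an isolated vertex; (c) a path with one leaf attached to an interior vertex (i.e., the tree obtained from a path by adding a new vertex adjacent to exactly one interior vertex of the path); (d) a path with an extra edge joining two vertices at distance $2$ in the path.
   Context: All matrices are real. For a (simple, undirected) graph $G$ with vertex set $\{1,\dots,n\}$, $\mathcal{S}(G)$ denotes the set of all real symmetric $n\times n$ matrices $A=(a_{ij})$ such that for $i\neq j$, $a_{ij}\neq 0$ if and only if $ij$ is an edge of $G$ (diagonal entries are unrestricted). $|G|$ is the number of vertices of $G$. For a symmetric matrix $A$, $q(A)$ is the number of distinct eigenvalues of $A$, and $q(G)=\min\{q(A): A\in\mathcal{S}(G)\}$. *)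

theory Defs
  imports
    "Graph_Theory.Pair_Digraph"
    "Graph_Theory.Vertex_Walk"
    "Jordan_Normal_Form.Spectral_Radius"
begin

text \<open>
  A simple undirected graph is a \<open>pair_graph\<close>, i.e. a finite loop-free digraph without parallel
  arcs whose arc relation is symmetric: an edge \<open>uv\<close> is the pair of arcs \<open>(u, v)\<close> and \<open>(v, u)\<close>.
  Since matrix indices start at 0, the vertex set of a graph on \<open>n\<close> vertices is
  \<open>{0..<n}\<close> instead of \<open>{1, \<dots>, n}\<close>.
\<close>

definition sym_matrices :: "nat pair_pre_digraph \<Rightarrow> real mat set" where
  "sym_matrices G = {A. A \<in> carrier_mat (card (pverts G)) (card (pverts G)) \<and> transpose_mat A = A \<and>
     (\<forall>i < card (pverts G). \<forall>j < card (pverts G). i \<noteq> j \<longrightarrow> (A $$ (i, j) \<noteq> 0 \<longleftrightarrow> (i, j) \<in> parcs G))}"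

definition q_mat :: "real mat \<Rightarrow> nat" where
  "q_mat A = card (spectrum A)"

definition q_graph :: "nat pair_pre_digraph \<Rightarrow> nat" where
  "q_graph G = (LEAST k. \<exists>A \<in> sym_matrices G. q_mat A = k)"

text \<open>The minimum defining \<open>q_graph\<close> is attained.\<close>

lemma sym_matrices_nonempty:
  assumes "pair_graph G"
  shows "sym_matrices G \<noteq> {}"
proof -
  interpret pair_graph G by fact
  let ?n = "card (pverts G)"
  let ?A = "mat ?n ?n (\<lambda>(i, j). if (i, j) \<in> parcs G then 1 else 0 :: real)"
  have "transpose_mat ?A = ?A"
    by (rule eq_matI) (auto dest: arcs_symmetric)
  then have "?A \<in> sym_matrices G"
    by (simp add: sym_matrices_def)
  then show ?thesis by blast
qed

lemma q_graph_attained: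
  assumes "pair_graph G"
  shows "\<exists>A \<in> sym_matrices G. q_mat A = q_graph G"
  unfolding q_graph_def
  by (rule LeastI_ex) (use sym_matrices_nonempty[OF assms] in blast)

lemma q_graph_le: "A \<in> sym_matrices G \<Longrightarrow> q_graph G \<le> q_mat A"
  unfolding q_graph_def by (rule Least_le) blast

text \<open>
  The path visiting the vertices of the list \<open>xs\<close> in this order; it is meant for nonempty
  lists \<open>xs\<close> without repetitions.
\<close>

definition path_graph :: "'a list \<Rightarrow> 'a pair_pre_digraph" where
  "path_graph xs = \<lparr> pverts = set xs, parcs = symcl (set (vwalk_arcs xs)) \<rparr>"

definition add_vertex :: "'a \<Rightarrow> 'a pair_pre_digraph \<Rightarrow> 'a pair_pre_digraph" where
  "add_vertex w H = \<lparr> pverts = insert w (pverts H), parcs = parcs H \<rparr>"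

definition add_edge :: "'a \<Rightarrow> 'a \<Rightarrow> 'a pair_pre_digraph \<Rightarrow> 'a pair_pre_digraph" where
  "add_edge u v H = \<lparr> pverts = pverts H, parcs = parcs H \<union> {(u, v), (v, u)} \<rparr>"

definition is_path :: "'a pair_pre_digraph \<Rightarrow> bool" where
  "is_path G \<longleftrightarrow> (\<exists>xs. xs \<noteq> [] \<and> distinct xs \<and> G = path_graph xs)"

definition is_path_with_isolated_vertex :: "'a pair_pre_digraph \<Rightarrow> bool" where
  "is_path_with_isolated_vertex G \<longleftrightarrow>
     (\<exists>xs w. xs \<noteq> [] \<and> distinct xs \<and> w \<notin> set xs \<and> G = add_vertex w (path_graph xs))"

text \<open>The interior vertices of a path are those that are neither its first nor its last one.\<close>

definition is_path_with_interior_leaf :: "'a pair_pre_digraph \<Rightarrow> bool" where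
  "is_path_with_interior_leaf G \<longleftrightarrow>
     (\<exists>xs w i. distinct xs \<and> w \<notin> set xs \<and> 0 < i \<and> i + 1 < length xs \<and>
        G = add_edge w (xs ! i) (add_vertex w (path_graph xs)))"

definition is_path_with_distance_two_edge :: "'a pair_pre_digraph \<Rightarrow> bool" where
  "is_path_with_distance_two_edge G \<longleftrightarrow>
     (\<exists>xs i. distinct xs \<and> i + 2 < length xs \<and>
        G = add_edge (xs ! i) (xs ! (i + 2)) (path_graph xs))"

end

theory Submission
  imports Defs "HOL-Computational_Algebra.Fundamental_Theorem_Algebra"
begin

text \<open>
  The listed graphs are those that consist of a path on \<open>n - 1\<close> vertices and a vertex adjacent to at
  most two of them, which are then consecutive. The path is the only shortest walk between its ends,
  so \<open>I, A, \<dots>, A\<^sup>n\<^sup>-\<^sup>2\<close> are linearly independent, and the symmetric matrix \<open>A\<close> has at least \<open>n - 1\<close>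
  distinct eigenvalues.

  For any other graph we exhibit a matrix with an eigenvalue of multiplicity three or with two
  eigenvalues of multiplicity two. If \<open>G\<close> is the union of two graphs sharing one vertex, neither of
  which is a path, then both carry matrices of nullity two, and the sum of these has nullity three.
  This and constructions around a cut vertex settle all graphs but those with a long cycle or with a
  vertex \<open>u\<close> having three neighbours in one component of \<open>G - u\<close>. There, a weighted Laplacian of the
  component with vertex masses has two explicit eigenvectors orthogonal to the row of \<open>u\<close>, and after
  scaling this row one diagonal entry at \<open>u\<close> doubles both eigenvalues.
\<close>

section \<open>Eigenspaces of symmetric operators on functions\<close>

text \<open>At most n - 2 distinct eigenvalues means that the multiplicities exceed one by at least
  two in total, so a triple eigenvalue or two double ones must be built. Deleting a vertex
  \<open>u\<close> costs one dimension per eigenspace, which settles graphs with many branches but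
  leaves too little on a cycle. There the diagonal entry \<open>d\<close> at \<open>u\<close> wins a
  dimension back: if the row \<open>c\<close> of \<open>u\<close> is orthogonal to an eigenvector
  \<open>z\<close> for \<open>l\<close> of the rest, and (A - l) g = c, then \<open>z\<close> and
  (1, -g) are both eigenvectors for \<open>l\<close> as soon as d = l + c.g. For the eigenvalues 0
  and 1 this asks for c.g0 = 1 + c.g1. Scaling \<open>c\<close> scales both products by the same
  square, so only c.g1 < c.g0 has to be arranged. A second eigenvector that changes sign along edges
  achieves this. If \<open>u\<close> has only two neighbours, orthogonality fixes \<open>c\<close>
  up to scale and forces the ratio \<rho> of the two eigenvectors to agree at both, so \<rho> cannot
  be injective; this is why long cycles need an explicit \<rho>.\<close>

definition dot :: "'a set \<Rightarrow> ('a \<Rightarrow> real) \<Rightarrow> ('a \<Rightarrow> real) \<Rightarrow> real" where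
  "dot X f g = (\<Sum>x\<in>X. f x * g x)"

text \<open>Matrices and vectors are functions on the whole vertex type that are read on
  \<open>X\<close> only. A principal submatrix is then the same function read on a smaller set, so
  blocks are cut out and glued without reindexing.\<close>

definition mv :: "'a set \<Rightarrow> ('a \<Rightarrow> 'a \<Rightarrow> real) \<Rightarrow> ('a \<Rightarrow> real) \<Rightarrow> 'a \<Rightarrow> real" where
  "mv X a f x = (\<Sum>y\<in>X. a x y * f y)"

definition eigf :: "'a set \<Rightarrow> ('a \<Rightarrow> 'a \<Rightarrow> real) \<Rightarrow> real \<Rightarrow> ('a \<Rightarrow> real) \<Rightarrow> bool" where
  "eigf X a l f \<longleftrightarrow> (\<forall>x\<in>X. mv X a f x = l * f x)"

definition nonzero_on :: "'a set \<Rightarrow> ('a \<Rightarrow> real) \<Rightarrow> bool" where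
  "nonzero_on X f \<longleftrightarrow> (\<exists>x\<in>X. f x \<noteq> 0)"

definition sym_on :: "'a set \<Rightarrow> ('a \<Rightarrow> 'a \<Rightarrow> real) \<Rightarrow> bool" where
  "sym_on X a \<longleftrightarrow> (\<forall>x\<in>X. \<forall>y\<in>X. a x y = a y x)"

text \<open>
  \<open>eigdim_gt X a l k\<close> states that the eigenspace of \<open>a\<close> for \<open>l\<close> has dimension greater than \<open>k\<close>:
  it meets the common kernel of any \<open>k\<close> linear functionals.
\<close>

definition eigdim_gt :: "'a set \<Rightarrow> ('a \<Rightarrow> 'a \<Rightarrow> real) \<Rightarrow> real \<Rightarrow> nat \<Rightarrow> bool" where
  "eigdim_gt X a l k \<longleftrightarrow> (\<forall>c :: nat \<Rightarrow> 'a \<Rightarrow> real. \<exists>f. eigf X a l f \<and> nonzero_on X f \<and> (\<forall>i<k. dot X (c i) f = 0))"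

definition eigs :: "'a set \<Rightarrow> ('a \<Rightarrow> 'a \<Rightarrow> real) \<Rightarrow> real set" where
  "eigs X a = {l. \<exists>f. eigf X a l f \<and> nonzero_on X f}"

text \<open>Gaussian elimination on the set of equations: if some \<open>b y0 x0\<close> is nonzero,
  equation \<open>y0\<close> is solved for the value at \<open>x0\<close>, which removes one
  equation and one unknown.\<close>

lemma homogeneous_system:
  fixes b :: "'b \<Rightarrow> 'a \<Rightarrow> real"
  assumes "finite Y" "finite X" "card Y < card X"
  shows "\<exists>f. (\<exists>x\<in>X. f x \<noteq> 0) \<and> (\<forall>y\<in>Y. (\<Sum>x\<in>X. b y x * f x) = 0)"
  using assms
proof (induction Y arbitrary: X b rule: finite_induct)
  case empty
  then have "X \<noteq> {}" by auto
  then show ?case by (intro exI[of _ "\<lambda>_. 1"]) auto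
next
  case (insert y0 Y)
  show ?case
  proof (cases "\<forall>x\<in>X. b y0 x = 0")
    case True
    have "card Y < card X" using insert by simp
    from insert.IH[OF insert.prems(1) this, of b] obtain f
      where "\<exists>x\<in>X. f x \<noteq> 0" "\<forall>y\<in>Y. (\<Sum>x\<in>X. b y x * f x) = 0" by blast
    with True show ?thesis by (intro exI[of _ f]) auto
  next
    case False
    then obtain x0 where x0: "x0 \<in> X" "b y0 x0 \<noteq> 0" by blast
    \<comment> \<open>Row \<open>y\<close> after \<open>x0\<close> has been eliminated by means of
      row \<open>y0\<close>.\<close>
    let ?b = "\<lambda>y x. b y x - b y x0 / b y0 x0 * b y0 x"
    have "card Y < card (X - {x0})" using insert x0 by simp
    from insert.IH[OF _ this, of ?b] insert.prems(1) obtain f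
      where f: "\<exists>x\<in>X - {x0}. f x \<noteq> 0" "\<forall>y\<in>Y. (\<Sum>x\<in>X - {x0}. ?b y x * f x) = 0" by auto
    define s where "s = (\<Sum>x\<in>X - {x0}. b y0 x * f x)"
    define g where "g = f(x0 := - s / b y0 x0)"
    have split: "(\<Sum>x\<in>X. b y x * g x) = b y x0 * (- s / b y0 x0) + (\<Sum>x\<in>X - {x0}. b y x * f x)" for y
    proof -
      have "(\<Sum>x\<in>X. b y x * g x) = b y x0 * g x0 + (\<Sum>x\<in>X - {x0}. b y x * g x)"
        using insert.prems(1) x0(1) by (simp add: sum.remove)
      also have "(\<Sum>x\<in>X - {x0}. b y x * g x) = (\<Sum>x\<in>X - {x0}. b y x * f x)"
        by (rule sum.cong) (auto simp: g_def)
      finally show ?thesis by (simp add: g_def)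
    qed
    have "(\<Sum>x\<in>X. b y x * g x) = 0" if "y \<in> Y" for y
    proof -
      have "0 = (\<Sum>x\<in>X - {x0}. ?b y x * f x)" using f(2) that by simp
      also have "\<dots> = (\<Sum>x\<in>X - {x0}. b y x * f x - b y x0 / b y0 x0 * (b y0 x * f x))"
        by (rule sum.cong) (auto simp: algebra_simps)
      also have "\<dots> = (\<Sum>x\<in>X - {x0}. b y x * f x) - b y x0 / b y0 x0 * s"
        by (simp only: sum_subtractf s_def sum_distrib_left)
      finally show ?thesis using split[of y] by simp
    qed
    moreover have "(\<Sum>x\<in>X. b y0 x * g x) = 0"
      using split[of y0] x0(2) by (simp add: s_def)
    moreover have "\<exists>x\<in>X. g x \<noteq> 0" using f(1) by (auto simp: g_def)
    ultimately show ?thesis by (intro exI[of _ g]) auto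
  qed
qed

lemma dot_commute: "dot X f g = dot X g f"
  by (simp add: dot_def mult.commute)

lemma dot_add: "dot X f (\<lambda>x. g x + h x) = dot X f g + dot X f h"
  by (simp add: dot_def algebra_simps sum.distrib)

lemma dot_scale: "dot X f (\<lambda>x. c * g x) = c * dot X f g"
  by (simp add: dot_def sum_distrib_left algebra_simps)

lemma dot_scale_left: "dot X (\<lambda>x. c * g x) f = c * dot X g f"
  by (simp add: dot_def sum_distrib_left algebra_simps)

lemma dot_minus: "dot X f (\<lambda>x. - g x) = - dot X f g"
  using dot_scale[of X f "-1" g] by simp

lemma dot_sum: "dot X f (\<lambda>x. \<Sum>i\<in>I. h i x) = (\<Sum>i\<in>I. dot X f (h i))"
  unfolding dot_def by (subst sum.swap) (simp add: sum_distrib_left)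

lemma dot_cong: "(\<And>x. x \<in> X \<Longrightarrow> f x = f' x) \<Longrightarrow> (\<And>x. x \<in> X \<Longrightarrow> g x = g' x) \<Longrightarrow> dot X f g = dot X f' g'"
  by (simp add: dot_def)

lemma dot_zero: "dot X f (\<lambda>_. 0) = 0" "dot X (\<lambda>_. 0) f = 0"
  by (simp_all add: dot_def)

lemma dot_self_nonneg: "dot X f f \<ge> 0"
  by (simp add: dot_def sum_nonneg)

lemma dot_self_eq_0: "finite X \<Longrightarrow> dot X f f = 0 \<longleftrightarrow> (\<forall>x\<in>X. f x = 0)"
  by (simp add: dot_def sum_nonneg_eq_0_iff)

lemma dot_self_pos: "finite X \<Longrightarrow> nonzero_on X f \<Longrightarrow> dot X f f > 0"
  using dot_self_nonneg[of X f] dot_self_eq_0[of X f] by (auto simp: nonzero_on_def less_le)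

lemma dot_union: "finite X \<Longrightarrow> finite Y \<Longrightarrow> X \<inter> Y = {} \<Longrightarrow> dot (X \<union> Y) f g = dot X f g + dot Y f g"
  by (simp add: dot_def sum.union_disjoint)

lemma dot_supp: "finite X \<Longrightarrow> Y \<subseteq> X \<Longrightarrow> (\<And>x. x \<in> X - Y \<Longrightarrow> f x = 0 \<or> g x = 0) \<Longrightarrow> dot X f g = dot Y f g"
  unfolding dot_def by (rule sum.mono_neutral_right) auto

lemma dot_delta: "finite X \<Longrightarrow> u \<in> X \<Longrightarrow> dot X (\<lambda>x. if x = u then 1 else 0) f = f u"
  unfolding dot_def by (subst sum.remove[of _ u]) (auto intro!: sum.neutral)

lemma mv_eq_dot: "mv X a f x = dot X (a x) f"
  by (simp add: mv_def dot_def)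

lemma mv_add: "mv X a (\<lambda>x. g x + h x) x = mv X a g x + mv X a h x"
  by (simp add: mv_eq_dot dot_add)

lemma mv_scale: "mv X a (\<lambda>x. c * g x) x = c * mv X a g x"
  by (simp add: mv_eq_dot dot_scale)

lemma mv_sum: "mv X a (\<lambda>x. \<Sum>i\<in>I. h i x) x = (\<Sum>i\<in>I. mv X a (h i) x)"
  by (simp add: mv_eq_dot dot_sum)

lemma mv_cong: "(\<And>y. y \<in> X \<Longrightarrow> a x y = b x y) \<Longrightarrow> (\<And>y. y \<in> X \<Longrightarrow> f y = g y) \<Longrightarrow> mv X a f x = mv X b g x"
  by (simp add: mv_def)

lemma mv_supp: "finite X \<Longrightarrow> Y \<subseteq> X \<Longrightarrow> (\<And>y. y \<in> X - Y \<Longrightarrow> a x y = 0 \<or> f y = 0) \<Longrightarrow> mv X a f x = mv Y a f x"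
  unfolding mv_eq_dot by (rule dot_supp)

lemma dot_mv_swap: "finite X \<Longrightarrow> sym_on X a \<Longrightarrow> dot X f (mv X a g) = dot X (mv X a f) g"
  unfolding dot_def mv_def sum_distrib_left sum_distrib_right
  by (subst sum.swap) (auto simp: sym_on_def algebra_simps intro!: sum.cong)

lemma eigf_add: "eigf X a l f \<Longrightarrow> eigf X a l g \<Longrightarrow> eigf X a l (\<lambda>x. f x + g x)"
  by (simp add: eigf_def mv_add algebra_simps)

lemma eigf_scale: "eigf X a l f \<Longrightarrow> eigf X a l (\<lambda>x. c * f x)"
  by (simp add: eigf_def mv_scale)

lemma eigf_sum: "(\<And>i. i \<in> I \<Longrightarrow> eigf X a l (h i)) \<Longrightarrow> eigf X a l (\<lambda>x. \<Sum>i\<in>I. h i x)"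
  by (simp add: eigf_def mv_sum sum_distrib_left)

lemma eigf_cong:
  "(\<And>x y. x \<in> X \<Longrightarrow> y \<in> X \<Longrightarrow> a x y = b x y) \<Longrightarrow> (\<And>x. x \<in> X \<Longrightarrow> f x = g x) \<Longrightarrow> eigf X a l f \<longleftrightarrow> eigf X b l g"
  by (simp add: eigf_def mv_def)

lemma eigdim_gt_cong:
  assumes "\<And>x y. x \<in> X \<Longrightarrow> y \<in> X \<Longrightarrow> a x y = b x y"
  shows "eigdim_gt X a l k \<longleftrightarrow> eigdim_gt X b l k"
  unfolding eigdim_gt_def using eigf_cong[of X a b] assms by metis

lemma eigs_cong:
  assumes "\<And>x y. x \<in> X \<Longrightarrow> y \<in> X \<Longrightarrow> a x y = b x y"
  shows "eigs X a = eigs X b"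
  unfolding eigs_def using eigf_cong[of X a b] assms by metis

lemma eigdim_gt_0: "eigdim_gt X a l 0 \<longleftrightarrow> l \<in> eigs X a"
  by (auto simp: eigdim_gt_def eigs_def)

text \<open>The right-hand side is adjoined as one more column \<open>- c\<close>, indexed by
  \<open>None\<close>. There are then more unknowns than equations, and injectivity excludes a
  nontrivial solution that vanishes at \<open>None\<close>; dividing by this entry gives
  \<open>g\<close>.\<close>

lemma injective_imp_surjective:
  fixes b :: "'a \<Rightarrow> 'a \<Rightarrow> real"
  assumes X: "finite X" and inj: "\<And>f. (\<And>x. x \<in> X \<Longrightarrow> mv X b f x = 0) \<Longrightarrow> \<not> nonzero_on X f"
  shows "\<exists>g. \<forall>x\<in>X. mv X b g x = c x"
proof -
  let ?Z = "insert None (Some ` X)"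
  define B where "B = (\<lambda>x z. case z of None \<Rightarrow> - c x | Some y \<Rightarrow> b x y)"
  have "card X < card ?Z" using X by (simp add: card_image)
  from homogeneous_system[OF X _ this, of B] X obtain h
    where h: "\<exists>z\<in>?Z. h z \<noteq> 0" "\<forall>y\<in>X. (\<Sum>z\<in>?Z. B y z * h z) = 0" by auto
  have eq: "mv X b (\<lambda>x. h (Some x)) y = h None * c y" if "y \<in> X" for y
  proof -
    have "(\<Sum>z\<in>?Z. B y z * h z) = - c y * h None + (\<Sum>x\<in>X. b y x * h (Some x))"
      using X by (simp add: B_def sum.reindex)
    then show ?thesis using h(2) that by (simp add: mv_def)
  qed
  have "h None \<noteq> 0"
  proof
    assume 0: "h None = 0"
    then have "\<not> nonzero_on X (\<lambda>x. h (Some x))" using inj[of "\<lambda>x. h (Some x)"] eq by simp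
    with h(1) 0 show False by (auto simp: nonzero_on_def)
  qed
  then have "mv X b (\<lambda>x. 1 / h None * h (Some x)) y = c y" if "y \<in> X" for y
    using eq[OF that] by (subst mv_scale) simp
  then show ?thesis by blast
qed

lemma eigf_orthogonal:
  assumes "finite X" "sym_on X a" "eigf X a l f" "eigf X a m g" "l \<noteq> m"
  shows "dot X f g = 0"
proof -
  have "m * dot X f g = dot X f (mv X a g)"
    using assms(4) by (simp add: eigf_def dot_def sum_distrib_left algebra_simps)
  also have "\<dots> = dot X (mv X a f) g" by (rule dot_mv_swap[OF assms(1,2)])
  also have "\<dots> = l * dot X f g"
    using assms(3) by (simp add: eigf_def dot_def sum_distrib_left algebra_simps)
  finally show ?thesis using assms(5) by simp
qed

lemma orthogonal_combination:
  assumes "finite X" "finite I" "j \<in> I" "\<And>i j. i \<in> I \<Longrightarrow> j \<in> I \<Longrightarrow> i \<noteq> j \<Longrightarrow> dot X (F i) (F j) = 0"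
  shows "dot X (F j) (\<lambda>x. \<Sum>i\<in>I. \<alpha> i * F i x) = \<alpha> j * dot X (F j) (F j)"
proof -
  have "dot X (F j) (\<lambda>x. \<Sum>i\<in>I. \<alpha> i * F i x) = (\<Sum>i\<in>I. \<alpha> i * dot X (F j) (F i))"
    by (simp add: dot_sum dot_scale)
  also have "\<dots> = \<alpha> j * dot X (F j) (F j)"
    using assms(2,3) assms(4)[OF assms(3)]
    by (subst sum.remove[of _ j]) (auto intro!: sum.neutral, metis)
  finally show ?thesis .
qed

text \<open>With more vectors than coordinates some nontrivial combination would vanish, and pairing
  it with a member of nonzero coefficient contradicts orthogonality.\<close>

lemma card_orthogonal_family:
  assumes "finite X" "finite I" "\<And>i. i \<in> I \<Longrightarrow> nonzero_on X (F i)"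
    and orth: "\<And>i j. i \<in> I \<Longrightarrow> j \<in> I \<Longrightarrow> i \<noteq> j \<Longrightarrow> dot X (F i) (F j) = 0"
  shows "card I \<le> card X"
proof (rule ccontr)
  assume "\<not> card I \<le> card X"
  then have "card X < card I" by simp
  from homogeneous_system[OF assms(1,2) this, of "\<lambda>x i. F i x"] obtain \<alpha> j
    where j: "j \<in> I" "\<alpha> j \<noteq> 0" and 0: "\<And>x. x \<in> X \<Longrightarrow> (\<Sum>i\<in>I. F i x * \<alpha> i) = 0" by blast
  have "0 = dot X (F j) (\<lambda>x. \<Sum>i\<in>I. \<alpha> i * F i x)"
    using 0 by (simp add: dot_def mult.commute)
  also have "\<dots> = \<alpha> j * dot X (F j) (F j)"
    by (rule orthogonal_combination) (use assms j in auto)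
  finally show False using dot_self_pos[OF assms(1) assms(3)[OF j(1)]] j(2) by simp
qed

text \<open>Forwards this is the Gram-Schmidt process: the vectors found so far serve as the
  functionals \<open>c\<close>. Backwards, \<open>k + 1\<close> coefficients are chosen subject to
  the \<open>k\<close> conditions.\<close>

lemma eigdim_gt_iff_orthogonal_family:
  assumes X: "finite X"
  shows "eigdim_gt X a l k \<longleftrightarrow> (\<exists>F :: nat \<Rightarrow> 'a \<Rightarrow> real. (\<forall>i\<le>k. eigf X a l (F i) \<and> nonzero_on X (F i)) \<and>
     (\<forall>i\<le>k. \<forall>j\<le>k. i \<noteq> j \<longrightarrow> dot X (F i) (F j) = 0))" (is "?L \<longleftrightarrow> ?R")
proof
  assume L: ?L
  have "\<exists>F :: nat \<Rightarrow> 'a \<Rightarrow> real. (\<forall>i\<le>m. eigf X a l (F i) \<and> nonzero_on X (F i)) \<and>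
     (\<forall>i\<le>m. \<forall>j\<le>m. i \<noteq> j \<longrightarrow> dot X (F i) (F j) = 0)" if "m \<le> k" for m
    using that
  proof (induction m)
    case 0
    from L obtain f where "eigf X a l f \<and> nonzero_on X f" unfolding eigdim_gt_def by blast
    then show ?case by (intro exI[of _ "\<lambda>_. f"]) auto
  next
    case (Suc m)
    then obtain F :: "nat \<Rightarrow> 'a \<Rightarrow> real" where F: "\<And>i. i \<le> m \<Longrightarrow> eigf X a l (F i) \<and> nonzero_on X (F i)"
      "\<And>i j. i \<le> m \<Longrightarrow> j \<le> m \<Longrightarrow> i \<noteq> j \<Longrightarrow> dot X (F i) (F j) = 0" by (metis Suc_leD)
    from L obtain g where g: "eigf X a l g" "nonzero_on X g" "\<And>i. i < k \<Longrightarrow> dot X (F i) g = 0"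
      unfolding eigdim_gt_def by blast
    show ?case
      using F g Suc.prems
      by (intro exI[of _ "F(Suc m := g)"]) (auto simp: le_Suc_eq dot_commute[of X g])
  qed
  then show ?R by blast
next
  assume ?R
  then obtain F :: "nat \<Rightarrow> 'a \<Rightarrow> real" where F: "\<And>i. i \<le> k \<Longrightarrow> eigf X a l (F i)"
    "\<And>i. i \<le> k \<Longrightarrow> nonzero_on X (F i)"
    "\<And>i j. i \<le> k \<Longrightarrow> j \<le> k \<Longrightarrow> i \<noteq> j \<Longrightarrow> dot X (F i) (F j) = 0" by blast
  show ?L unfolding eigdim_gt_def
  proof
    fix c :: "nat \<Rightarrow> 'a \<Rightarrow> real"
    have "card {..<k} < card {..k}" by simp
    from homogeneous_system[OF _ _ this, of "\<lambda>j i. dot X (c j) (F i)"] obtain \<alpha> j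
      where j: "j \<le> k" "\<alpha> j \<noteq> 0" and 0: "\<And>i. i < k \<Longrightarrow> (\<Sum>n\<le>k. dot X (c i) (F n) * \<alpha> n) = 0"
      by auto
    let ?f = "\<lambda>x. \<Sum>i\<le>k. \<alpha> i * F i x"
    have "eigf X a l ?f" by (intro eigf_sum eigf_scale F(1)) simp
    moreover have "dot X (c i) ?f = 0" if "i < k" for i
      using 0[OF that] by (simp add: dot_sum dot_scale mult.commute)
    moreover have "dot X (F j) ?f = \<alpha> j * dot X (F j) (F j)"
      by (rule orthogonal_combination) (use X F j in auto)
    then have "dot X (F j) ?f \<noteq> 0"
      using dot_self_pos[OF X F(2)[OF j(1)]] j(2) by simp
    then have "nonzero_on X ?f"
      by (fastforce simp: nonzero_on_def dot_def intro: ccontr sum.neutral)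
    ultimately show "\<exists>f. eigf X a l f \<and> nonzero_on X f \<and> (\<forall>i<k. dot X (c i) f = 0)" by blast
  qed
qed

text \<open>Eigenvectors of different eigenvalues are orthogonal, so the orthogonal families of the
  single eigenvalues form one family together. The eigenvalue \<open>l\<close> supplies
  \<open>k l + 1\<close> vectors.\<close>

lemma sum_multiplicities_le:
  assumes X: "finite X" and a: "sym_on X a" and "finite L" "\<And>l. l \<in> L \<Longrightarrow> eigdim_gt X a l (k l)"
  shows "(\<Sum>l\<in>L. k l + 1) \<le> card X"
proof -
  have "\<exists>F :: nat \<Rightarrow> 'a \<Rightarrow> real. (\<forall>i\<le>k l. eigf X a l (F i) \<and> nonzero_on X (F i)) \<and>
     (\<forall>i\<le>k l. \<forall>j\<le>k l. i \<noteq> j \<longrightarrow> dot X (F i) (F j) = 0)" if "l \<in> L" for l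
    using assms(4)[OF that] eigdim_gt_iff_orthogonal_family[OF X] by blast
  then obtain F :: "real \<Rightarrow> nat \<Rightarrow> 'a \<Rightarrow> real"
    where F: "\<And>l i. l \<in> L \<Longrightarrow> i \<le> k l \<Longrightarrow> eigf X a l (F l i) \<and> nonzero_on X (F l i)"
      "\<And>l i j. l \<in> L \<Longrightarrow> i \<le> k l \<Longrightarrow> j \<le> k l \<Longrightarrow> i \<noteq> j \<Longrightarrow> dot X (F l i) (F l j) = 0" by metis
  have "card (SIGMA l:L. {..k l}) \<le> card X"
  proof (rule card_orthogonal_family[where F = "\<lambda>(l, i). F l i"])
    fix p q assume pq: "p \<in> (SIGMA l:L. {..k l})" "q \<in> (SIGMA l:L. {..k l})" "p \<noteq> q"
    obtain l i m j where [simp]: "p = (l, i)" "q = (m, j)" by fastforce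
    show "dot X (case p of (l, i) \<Rightarrow> F l i) (case q of (l, i) \<Rightarrow> F l i) = 0"
      using pq F eigf_orthogonal[OF X a, of l "F l i" m "F m j"] by (cases "l = m") auto
  qed (use X F assms in auto)
  then show ?thesis using assms(3) by simp
qed

lemma finite_eigs:
  assumes X: "finite X" and a: "sym_on X a"
  shows "finite (eigs X a)"
proof (rule ccontr)
  assume "infinite (eigs X a)"
  then obtain L where L: "L \<subseteq> eigs X a" "finite L" "card L = Suc (card X)"
    using infinite_arbitrarily_large by metis
  have "eigdim_gt X a l 0" if "l \<in> L" for l using that L(1) by (auto simp: eigdim_gt_0)
  from sum_multiplicities_le[OF X a L(2), of "\<lambda>_. 0", OF this] L show False by simp
qed

text \<open>Each eigenvalue takes one dimension and \<open>l\<close> takes two more.\<close>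

lemma card_eigs_triple:
  assumes X: "finite X" and a: "sym_on X a" and "eigdim_gt X a l 2"
  shows "card (eigs X a) + 2 \<le> card X"
proof -
  note fin = finite_eigs[OF X a]
  have l: "l \<in> eigs X a" using assms(3) by (auto simp: eigdim_gt_def eigs_def)
  have "(\<Sum>t\<in>eigs X a. (if t = l then 2 else 0) + 1) \<le> card X"
    by (rule sum_multiplicities_le[OF X a fin]) (use assms(3) eigdim_gt_0 in auto)
  also have "(\<Sum>t\<in>eigs X a. (if t = l then 2 else 0) + 1) = card (eigs X a) + 2"
    using fin l by (simp only: sum.distrib sum.delta' sum.delta) simp
  finally show ?thesis .
qed

lemma card_eigs_two_doubles:
  assumes X: "finite X" and a: "sym_on X a" and g: "eigdim_gt X a l 1" "eigdim_gt X a m 1" "l \<noteq> m"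
  shows "card (eigs X a) + 2 \<le> card X"
proof -
  note fin = finite_eigs[OF X a]
  have l: "l \<in> eigs X a" "m \<in> eigs X a" using g(1,2) by (auto simp: eigdim_gt_def eigs_def)
  have "(\<Sum>t\<in>eigs X a. ((if t = l then 1 else 0) + (if t = m then 1 else 0)) + 1) \<le> card X"
    by (rule sum_multiplicities_le[OF X a fin]) (use g eigdim_gt_0 in auto)
  also have "(\<Sum>t\<in>eigs X a. ((if t = l then 1 else 0) + (if t = m then 1 else 0)) + 1) = card (eigs X a) + 2"
    using fin l by (simp only: sum.distrib sum.delta' sum.delta) simp
  finally show ?thesis .
qed

section \<open>A lower bound on the number of eigenvalues\<close>

text \<open>The vector p(a) f by Horner's scheme. It is a function on the whole type and
  \<open>mv\<close> reads it on \<open>X\<close> only, so the rules below hold at every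
  point.\<close>

definition poly_act :: "'a set \<Rightarrow> ('a \<Rightarrow> 'a \<Rightarrow> real) \<Rightarrow> real poly \<Rightarrow> ('a \<Rightarrow> real) \<Rightarrow> 'a \<Rightarrow> real" where
  "poly_act X a p f = fold_coeffs (\<lambda>c g x. c * f x + mv X a g x) p (\<lambda>_. 0)"

lemma poly_act_0 [simp]: "poly_act X a 0 f = (\<lambda>_. 0)"
  by (simp add: poly_act_def)

lemma poly_act_pCons: "poly_act X a (pCons c p) f = (\<lambda>x. c * f x + mv X a (poly_act X a p f) x)"
  by (cases "p = 0 \<and> c = 0") (auto simp: poly_act_def mv_def fun_eq_iff)

lemma poly_act_add: "poly_act X a (p + q) f x = poly_act X a p f x + poly_act X a q f x"
proof (induction p q arbitrary: x rule: poly_induct2)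
  case (pCons c p d q)
  have "poly_act X a (p + q) f = (\<lambda>x. poly_act X a p f x + poly_act X a q f x)"
    using pCons by blast
  then show ?case by (simp add: poly_act_pCons mv_add algebra_simps)
qed simp

lemma poly_act_smult: "poly_act X a (Polynomial.smult c p) f x = c * poly_act X a p f x"
proof (induction p arbitrary: x)
  case (pCons d p)
  have "poly_act X a (Polynomial.smult c p) f = (\<lambda>x. c * poly_act X a p f x)"
    using pCons by blast
  then show ?case by (simp add: poly_act_pCons mv_scale algebra_simps)
qed simp

lemma poly_act_sum: "finite I \<Longrightarrow> poly_act X a (\<Sum>i\<in>I. p i) f x = (\<Sum>i\<in>I. poly_act X a (p i) f x)"
  by (induction I rule: finite_induct) (simp_all add: poly_act_add)

lemma poly_act_mult: "poly_act X a (p * q) f x = poly_act X a p (poly_act X a q f) x"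
proof (induction p arbitrary: x)
  case (pCons c p)
  have "poly_act X a (p * q) f = poly_act X a p (poly_act X a q f)"
    using pCons by blast
  then show ?case by (simp add: poly_act_pCons poly_act_add poly_act_smult mult_pCons_left)
qed simp

lemma poly_act_linear: "poly_act X a [:- l, 1:] f x = mv X a f x - l * f x"
proof -
  have "poly_act X a [:1:] f = f" by (simp add: poly_act_pCons mv_def fun_eq_iff)
  then show ?thesis by (simp add: poly_act_pCons[of X a "- l"])
qed

text \<open>The powers of \<open>a\<close> from 0 to \<open>card X\<close>, applied to
  \<open>v\<close>, are one vector more than the dimension; a linear relation between them is the
  polynomial.\<close>

lemma annihilating_poly_exists:
  assumes X: "finite X"
  shows "\<exists>p. p \<noteq> 0 \<and> (\<forall>x\<in>X. poly_act X a p v x = 0)"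
proof -
  have "card X < card {..card X}" by simp
  from homogeneous_system[OF X _ this, of "\<lambda>x i. poly_act X a (monom 1 i) v x"] obtain \<alpha> j
    where j: "j \<le> card X" "\<alpha> j \<noteq> 0"
      and 0: "\<And>x. x \<in> X \<Longrightarrow> (\<Sum>i\<le>card X. poly_act X a (monom 1 i) v x * \<alpha> i) = 0" by auto
  let ?p = "\<Sum>i\<le>card X. Polynomial.smult (\<alpha> i) (monom 1 i)"
  have "coeff ?p j = \<alpha> j" using j by (simp add: coeff_sum if_distrib sum.delta cong: if_cong)
  then have "?p \<noteq> 0" using j by auto
  moreover have "poly_act X a ?p v x = 0" if "x \<in> X" for x
    using 0[OF that] by (simp only: poly_act_sum finite_atMost poly_act_smult) (simp add: mult.commute)
  ultimately show ?thesis by blast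
qed

lemma degree_less_2:
  fixes r :: "'b::zero poly"
  assumes "degree r < 2"
  shows "\<exists>c d. r = [:c, d:]"
proof (cases r)
  case (pCons c s)
  then have "degree s = 0" using assms by (cases "s = 0") auto
  then obtain d where "s = [:d:]" by (rule degree_eq_zeroE)
  with pCons show ?thesis by blast
qed

text \<open>The quadratic \<open>t\<close> is (x - z)(x - conj z). The remainder modulo
  \<open>t\<close> is real, has degree below two and vanishes at the nonreal number
  \<open>z\<close>, so it is zero.\<close>

lemma nonreal_root_quadratic_dvd:
  fixes q :: "real poly"
  assumes z: "poly (map_poly complex_of_real q) z = 0" "Im z \<noteq> 0"
  shows "[:(Re z)\<^sup>2 + (Im z)\<^sup>2, - 2 * Re z, 1:] dvd q"
proof -
  define t where "t = [:(Re z)\<^sup>2 + (Im z)\<^sup>2, - 2 * Re z, 1:]"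
  have t: "poly (map_poly complex_of_real t) z = 0"
    by (auto simp: t_def complex_eq_iff power2_eq_square algebra_simps)
  have "degree (q mod t) < 2"
    using degree_mod_less[of t q] by (auto simp: t_def)
  then obtain c d where r: "q mod t = [:c, d:]"
    using degree_less_2 by blast
  interpret cr: map_poly_comm_ring_hom complex_of_real ..
  have "map_poly complex_of_real q = map_poly complex_of_real (q div t * t + q mod t)"
    by simp
  also have "\<dots> = map_poly complex_of_real (q div t) * map_poly complex_of_real t + map_poly complex_of_real (q mod t)"
    by (simp only: cr.hom_add cr.hom_mult)
  finally have "poly (map_poly complex_of_real (q mod t)) z = 0"
    using z(1) t by (metis add_0 mult_zero_right poly_add poly_mult)
  moreover have "map_poly complex_of_real [:c, d:] = [:complex_of_real c, complex_of_real d:]"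
    by (rule poly_eqI) (simp add: coeff_map_poly coeff_pCons split: nat.split)
  ultimately have "d * Im z = 0" "c + d * Re z = 0"
    by (auto simp: r complex_eq_iff algebra_simps)
  then have "q mod t = 0" using z(2) by (simp add: r)
  then show ?thesis by (simp add: t_def dvd_eq_mod_eq_0)
qed

text \<open>
  The minimal polynomial of a vector under a symmetric operator is a product of distinct real
  linear factors, so its degree is a lower bound on the number of eigenvalues.
\<close>

lemma card_eigs_ge:
  assumes X: "finite X" and a: "sym_on X a"
    and deg: "\<And>p. p \<noteq> 0 \<Longrightarrow> (\<And>x. x \<in> X \<Longrightarrow> poly_act X a p v x = 0) \<Longrightarrow> k \<le> degree p"
  shows "k \<le> card (eigs X a)"
proof -
  define P where "P = (\<lambda>p. p \<noteq> 0 \<and> (\<forall>x\<in>X. poly_act X a p v x = 0))"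
  \<comment> \<open>An annihilating polynomial of least degree is the minimal polynomial of
    \<open>v\<close> up to a scalar.\<close>
  obtain p where p: "P p" and min: "\<And>q. P q \<Longrightarrow> degree p \<le> degree q"
    using annihilating_poly_exists[OF X, of a v] ex_has_least_nat[of P _ degree] by (metis P_def)
  have nz: "nonzero_on X (poly_act X a s v)" if "p = t * s" "degree t > 0" for t s
  proof (rule ccontr)
    assume "\<not> nonzero_on X (poly_act X a s v)"
    moreover have "s \<noteq> 0" "t \<noteq> 0" using p that by (auto simp: P_def)
    ultimately have "P s" by (simp add: P_def nonzero_on_def)
    from min[OF this] that \<open>s \<noteq> 0\<close> \<open>t \<noteq> 0\<close> show False by (simp add: degree_mult_eq)
  qed
  have p0: "poly_act X a t (poly_act X a s v) x = 0" if "p = t * s" "x \<in> X" for t s x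
    using p that by (simp add: P_def poly_act_mult[symmetric])
  \<comment> \<open>If p = (x - l)^2 s, then h = (a - l) s(a) v is killed by a - l. By symmetry h.h
    equals the product of (a - l) h with s(a) v, which is 0, whereas minimality of \<open>p\<close>
    makes \<open>h\<close> nonzero.\<close>
  have no_double: False if "[:- l, 1:] * [:- l, 1:] dvd p" for l
  proof -
    from that obtain s where s: "p = [:- l, 1:] * ([:- l, 1:] * s)" by (metis dvdE mult.assoc)
    define g where "g = poly_act X a s v"
    define h where "h = poly_act X a ([:- l, 1:] * s) v"
    have h: "h = (\<lambda>x. mv X a g x - l * g x)"
      by (simp only: h_def g_def fun_eq_iff poly_act_mult poly_act_linear simp_thms)
    have h0: "mv X a h x = l * h x" if "x \<in> X" for x
      using p0[OF s that] by (simp add: poly_act_linear h_def del: mult_pCons_left)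
    have "dot X h h = dot X h (mv X a g) - l * dot X h g"
      by (subst (2) h) (simp add: dot_def sum_subtractf sum_distrib_left algebra_simps)
    also have "\<dots> = dot X (mv X a h) g - l * dot X h g"
      by (simp add: dot_mv_swap[OF X a])
    also have "\<dots> = 0"
      using h0 by (simp add: dot_def sum_distrib_left algebra_simps)
    finally have "\<not> nonzero_on X h" using dot_self_pos[OF X, of h] by auto
    moreover have "nonzero_on X h" unfolding h_def by (rule nz[OF s]) simp
    ultimately show False by simp
  qed
  \<comment> \<open>With h = (a - \<alpha>) g one has (a - \<alpha>) h = -\<beta>^2 g, and symmetry
    gives h.h = -\<beta>^2 g.g, which is negative.\<close>
  have no_quadratic: False if "[:\<alpha>\<^sup>2 + \<beta>\<^sup>2, - 2 * \<alpha>, 1:] dvd p" "\<beta> \<noteq> 0" for \<alpha> \<beta>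
  proof -
    from that obtain s where s: "p = [:\<alpha>\<^sup>2 + \<beta>\<^sup>2, - 2 * \<alpha>, 1:] * s" by (metis dvdE)
    define g where "g = poly_act X a s v"
    define h where "h = (\<lambda>x. mv X a g x - \<alpha> * g x)"
    have "[:\<alpha>\<^sup>2 + \<beta>\<^sup>2, - 2 * \<alpha>, 1:] = [:- \<alpha>, 1:] * [:- \<alpha>, 1:] + [:\<beta>\<^sup>2:]"
      by (simp add: power2_eq_square)
    then have eq: "mv X a h x - \<alpha> * h x + \<beta>\<^sup>2 * g x = 0" if "x \<in> X" for x
    proof -
      have "poly_act X a [:- \<alpha>, 1:] g = h" by (simp add: fun_eq_iff h_def poly_act_linear)
      then have "poly_act X a ([:- \<alpha>, 1:] * [:- \<alpha>, 1:] + [:\<beta>\<^sup>2:]) g x = mv X a h x - \<alpha> * h x + \<beta>\<^sup>2 * g x"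
        by (simp only: poly_act_add poly_act_mult) (simp add: poly_act_linear poly_act_pCons mv_def)
      with p0[OF s that] show ?thesis
        using \<open>[:\<alpha>\<^sup>2 + \<beta>\<^sup>2, - 2 * \<alpha>, 1:] = [:- \<alpha>, 1:] * [:- \<alpha>, 1:] + [:\<beta>\<^sup>2:]\<close> by (simp only: g_def)
    qed
    have "dot X h h = dot X h (mv X a g) - \<alpha> * dot X h g"
      by (subst (2) h_def) (simp add: dot_def sum_subtractf sum_distrib_left algebra_simps)
    also have "\<dots> = dot X (mv X a h) g - \<alpha> * dot X h g"
      by (simp add: dot_mv_swap[OF X a])
    also have "\<dots> = (\<Sum>x\<in>X. (mv X a h x - \<alpha> * h x) * g x)"
      by (simp add: dot_def sum_subtractf sum_distrib_left algebra_simps)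
    also have "\<dots> = (\<Sum>x\<in>X. - \<beta>\<^sup>2 * (g x * g x))"
    proof (rule sum.cong)
      fix x assume "x \<in> X"
      then have "mv X a h x - \<alpha> * h x = - \<beta>\<^sup>2 * g x" using eq[of x] by simp
      then show "(mv X a h x - \<alpha> * h x) * g x = - \<beta>\<^sup>2 * (g x * g x)" by simp
    qed simp
    also have "\<dots> = - \<beta>\<^sup>2 * dot X g g"
      by (simp add: dot_def sum_distrib_left sum_negf)
    finally have "dot X h h + \<beta>\<^sup>2 * dot X g g = 0" by simp
    moreover have "dot X g g > 0"
      by (rule dot_self_pos[OF X]) (unfold g_def, rule nz[OF s], simp)
    ultimately show False
      using dot_self_nonneg[of X h] that(2)
      by (metis add_nonneg_pos less_irrefl mult_pos_pos zero_less_power2)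
  qed
  \<comment> \<open>Linear factors are split off one at a time: a nonconstant divisor of
    \<open>p\<close> has a complex root, which is real by \<open>no_quadratic\<close> and simple by
    \<open>no_double\<close>.\<close>
  have roots: "degree q \<le> card {l. poly q l = 0}" if "q dvd p" for q
    using that
  proof (induction "degree q" arbitrary: q)
    case 0
    then show ?case by simp
  next
    case (Suc n)
    interpret cr: map_poly_comm_ring_hom complex_of_real ..
    have "q \<noteq> 0" using Suc.hyps(2) by auto
    have "degree (map_poly complex_of_real q) = degree q"
      by (simp add: degree_map_poly)
    then have "\<not> constant (poly (map_poly complex_of_real q))"
      using Suc.hyps(2) by (simp add: constant_degree)
    from fundamental_theorem_of_algebra[OF this] obtain z
      where z: "poly (map_poly complex_of_real q) z = 0" by blast
    have "Im z = 0"
      using nonreal_root_quadratic_dvd[OF z] no_quadratic Suc.prems by (metis dvd_trans)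
    then have "z = complex_of_real (Re z)" by (simp add: complex_eq_iff)
    with z have "poly q (Re z) = 0"
      by (metis of_real_eq_0_iff of_real_hom.poly_map_poly)
    then obtain r where r: "q = [:- Re z, 1:] * r" by (metis poly_eq_0_iff_dvd dvdE)
    then have "r \<noteq> 0" using \<open>q \<noteq> 0\<close> by auto
    have "n = degree r" using Suc.hyps(2) \<open>r \<noteq> 0\<close> unfolding r by (subst (asm) degree_mult_eq) auto
    moreover have "r dvd p" using Suc.prems unfolding r by (metis dvd_mult_right)
    ultimately have IH: "degree r \<le> card {l. poly r l = 0}" using Suc.hyps(1) by blast
    have "poly r (Re z) \<noteq> 0"
    proof
      assume "poly r (Re z) = 0"
      then obtain s where "r = [:- Re z, 1:] * s" by (metis poly_eq_0_iff_dvd dvdE)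
      then have "[:- Re z, 1:] * [:- Re z, 1:] dvd q" unfolding r by (metis dvd_triv_left mult.assoc)
      with no_double Suc.prems show False by (metis dvd_trans)
    qed
    moreover have "{l. poly q l = 0} = insert (Re z) {l. poly r l = 0}" unfolding r by auto
    ultimately have "card {l. poly q l = 0} = Suc (card {l. poly r l = 0})"
      using poly_roots_finite[OF \<open>r \<noteq> 0\<close>] by simp
    then show ?case using IH Suc.hyps(2) \<open>n = degree r\<close> by simp
  qed
  \<comment> \<open>For a root \<open>l\<close> the cofactor of x - l maps \<open>v\<close> to an
    eigenvector, nonzero by minimality.\<close>
  have "{l. poly p l = 0} \<subseteq> eigs X a"
  proof
    fix l assume "l \<in> {l. poly p l = 0}"
    then obtain s where s: "p = [:- l, 1:] * s" by (metis poly_eq_0_iff_dvd dvdE mem_Collect_eq)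
    have "eigf X a l (poly_act X a s v)"
      using p0[OF s] by (simp add: eigf_def poly_act_linear)
    moreover have "nonzero_on X (poly_act X a s v)" by (rule nz[OF s]) simp
    ultimately show "l \<in> eigs X a" by (auto simp: eigs_def)
  qed
  then have "card {l. poly p l = 0} \<le> card (eigs X a)"
    by (intro card_mono finite_eigs X a)
  then show ?thesis using roots[of p] deg[of p] p by (auto simp: P_def)
qed

text \<open>The relation \<open>E\<close> stays fixed while \<open>X\<close> varies, so matrices of
  all induced subgraphs refer to the same graph.\<close>

definition realizes :: "('a \<Rightarrow> 'a \<Rightarrow> bool) \<Rightarrow> 'a set \<Rightarrow> ('a \<Rightarrow> 'a \<Rightarrow> real) \<Rightarrow> bool" where
  "realizes E X a \<longleftrightarrow> sym_on X a \<and> (\<forall>x\<in>X. \<forall>y\<in>X. x \<noteq> y \<longrightarrow> (a x y \<noteq> 0 \<longleftrightarrow> E x y))"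

text \<open>
  The levels \<open>\<delta>\<close> bound the distance from \<open>u 0\<close> from below, and \<open>u\<close> is the only way to climb them
  up to level \<open>m\<close>. Hence \<open>q a\<close> maps the indicator of \<open>u 0\<close> to a vector that does not vanish
  at \<open>u (degree q)\<close>, for each polynomial \<open>q\<close> of degree at most \<open>m\<close>.
\<close>

lemma card_eigs_unique_shortest_path:
  fixes \<delta> :: "'a \<Rightarrow> nat" and u :: "nat \<Rightarrow> 'a"
  assumes X: "finite X" and a: "realizes E X a"
    and u: "\<And>j. j \<le> m \<Longrightarrow> u j \<in> X" "\<And>j. j \<le> m \<Longrightarrow> \<delta> (u j) = j"
    and start: "\<And>j. j < m \<Longrightarrow> E (u (Suc j)) (u j)"
    and lip: "\<And>x y. x \<in> X \<Longrightarrow> y \<in> X \<Longrightarrow> x \<noteq> y \<Longrightarrow> E x y \<Longrightarrow> \<delta> x \<le> \<delta> y + 1"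
    and unique: "\<And>j y. j < m \<Longrightarrow> y \<in> X \<Longrightarrow> E (u (Suc j)) y \<Longrightarrow> \<delta> y = j \<Longrightarrow> y = u j"
  shows "m + 1 \<le> card (eigs X a)"
proof (rule card_eigs_ge[OF X])
  show "sym_on X a" using a by (simp add: realizes_def)
next
  define v where "v = (\<lambda>x. if x = u 0 then 1 else 0 :: real)"
  have v0: "v x = 0" if "\<delta> x > 0" for x
    using that u(2)[of 0] by (auto simp: v_def)
  \<comment> \<open>Each application of \<open>a\<close> climbs at most one level, so a polynomial
    reaches no level above its degree.\<close>
  have far: "poly_act X a p v x = 0" if "x \<in> X" "\<delta> x > degree p" for p x
    using that
  proof (induction p arbitrary: x)
    case (pCons c p)
    have "a x y * poly_act X a p v y = 0" if "y \<in> X" for y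
    proof (cases "p = 0 \<or> a x y = 0")
      case False
      then have "degree p + 1 < \<delta> x" using pCons.prems by simp
      moreover have "\<delta> x \<le> \<delta> y + 1"
        using False a pCons.prems(1) that lip by (cases "x = y") (auto simp: realizes_def)
      ultimately have "poly_act X a p v y = 0" using pCons.IH[OF that] by simp
      then show ?thesis by simp
    qed auto
    then show ?case using v0[of x] pCons.prems by (simp add: poly_act_pCons mv_def)
  qed simp
  have lead: "poly_act X a p v (u (degree p)) \<noteq> 0" if "p \<noteq> 0" "degree p \<le> m" for p
    using that
  proof (induction p)
    case (pCons c p)
    show ?case
    proof (cases "p = 0")
      case True
      with pCons.prems show ?thesis by (simp add: poly_act_pCons mv_def v_def)
    next
      case False
      define d where "d = degree p"
      have d: "degree (pCons c p) = Suc d" "Suc d \<le> m" using False pCons.prems by (simp_all add: d_def)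
      have inX: "u (Suc d) \<in> X" "u d \<in> X" using u(1) d by auto
      \<comment> \<open>In the row of \<open>u (Suc d)\<close> only the column \<open>u d\<close>
        survives: the other columns with a nonzero entry lie above level \<open>d\<close>, where the
        vector vanishes by \<open>far\<close>.\<close>
      have "a (u (Suc d)) y * poly_act X a p v y = 0" if "y \<in> X" "y \<noteq> u d" for y
      proof (cases "y = u (Suc d) \<or> a (u (Suc d)) y = 0")
        case True
        then show ?thesis using far[of "u (Suc d)" p] inX u(2)[OF d(2)] by (auto simp: d_def)
      next
        case no: False
        then have E: "E (u (Suc d)) y" using a that inX by (auto simp: realizes_def)
        then have "Suc d \<le> \<delta> y + 1" using lip[of "u (Suc d)" y] no inX that u(2)[OF d(2)] by auto
        moreover have "\<delta> y \<noteq> d" using unique[of d y] E that d by auto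
        ultimately have "poly_act X a p v y = 0" using far[of y p] that by (simp add: d_def)
        then show ?thesis by simp
      qed
      then have "mv X a (poly_act X a p v) (u (Suc d)) = a (u (Suc d)) (u d) * poly_act X a p v (u d)"
        unfolding mv_def using inX X by (subst sum.remove[of _ "u d"]) (simp_all add: sum.neutral)
      moreover have "poly_act X a p v (u d) \<noteq> 0" using pCons.IH False d by (simp add: d_def)
      moreover have "a (u (Suc d)) (u d) \<noteq> 0"
      proof -
        have "u (Suc d) \<noteq> u d" using u(2)[of d] u(2)[of "Suc d"] d(2) by force
        then show ?thesis using a inX start[of d] d(2) by (auto simp: realizes_def)
      qed
      moreover have "v (u (Suc d)) = 0" using v0 u(2)[OF d(2)] by simp
      ultimately show ?thesis using False by (simp add: d_def poly_act_pCons)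
    qed
  qed simp
  show "m + 1 \<le> degree p" if "p \<noteq> 0" "\<And>x. x \<in> X \<Longrightarrow> poly_act X a p v x = 0" for p
    using lead[of p] that u(1) by (cases "degree p \<le> m") auto
qed

text \<open>A nonzero vector that is not an eigenvector is annihilated by no nonzero polynomial of
  degree at most one, and \<open>card_eigs_ge\<close> turns degree two into two eigenvalues.\<close>

lemma two_eigenvalues:
  assumes X: "finite X" and a: "sym_on X a" and v: "nonzero_on X v"
    and non: "\<And>c. \<exists>x\<in>X. mv X a v x \<noteq> c * v x"
  obtains l m where "l \<in> eigs X a" "m \<in> eigs X a" "l \<noteq> m"
proof -
  have "2 \<le> card (eigs X a)"
  proof (rule card_eigs_ge[OF X a])
    fix p :: "real poly"
    assume p: "p \<noteq> 0" "\<And>x. x \<in> X \<Longrightarrow> poly_act X a p v x = 0"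
    show "2 \<le> degree p"
    proof (rule ccontr)
      assume "\<not> 2 \<le> degree p"
      then obtain c d where r: "p = [:c, d:]"
        using degree_less_2[of p] by auto
      have "poly_act X a [:d:] v = (\<lambda>x. d * v x)" by (simp add: poly_act_pCons mv_def fun_eq_iff)
      then have eq: "c * v x + d * mv X a v x = 0" if "x \<in> X" for x
        using p(2)[OF that] by (simp add: r poly_act_pCons[of _ _ c] mv_scale)
      show False
      proof (cases "d = 0")
        case True
        then show False using eq v p(1) by (auto simp: nonzero_on_def r)
      next
        case False
        then have "mv X a v x = (- c / d) * v x" if "x \<in> X" for x
          using eq[OF that] by (simp add: field_simps eq_neg_iff_add_eq_0)
        then show False using non by blast
      qed
    qed
  qed
  then obtain l where "l \<in> eigs X a" by fastforce
  moreover have "\<exists>m\<in>eigs X a. m \<noteq> l"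
  proof (rule ccontr)
    assume "\<not> ?thesis"
    then have "eigs X a \<subseteq> {l}" by auto
    then have "card (eigs X a) \<le> 1" using card_mono[of "{l}"] by simp
    with \<open>2 \<le> card (eigs X a)\<close> show False by simp
  qed
  ultimately show ?thesis using that by blast
qed

section \<open>Assembling matrices from blocks\<close>

definition agree :: "'a set \<Rightarrow> ('a \<Rightarrow> 'a \<Rightarrow> real) \<Rightarrow> ('a \<Rightarrow> 'a \<Rightarrow> real) \<Rightarrow> bool" where
  "agree X a b \<longleftrightarrow> (\<forall>x\<in>X. \<forall>y\<in>X. a x y = b x y)"

text \<open>The matrix c a + d I. For nonzero \<open>c\<close> it keeps the graph and moves
  eigenvalues to prescribed places.\<close>

definition affine :: "real \<Rightarrow> real \<Rightarrow> ('a \<Rightarrow> 'a \<Rightarrow> real) \<Rightarrow> 'a \<Rightarrow> 'a \<Rightarrow> real" where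
  "affine c d a x y = c * a x y + (if x = y then d else 0)"

text \<open>In the bordered matrix, \<open>c\<close> is bound to the adjacency of \<open>u\<close>,
  while the corner \<open>d\<close> is free and is spent on creating an eigenvector.\<close>

definition border :: "'a \<Rightarrow> ('a \<Rightarrow> real) \<Rightarrow> real \<Rightarrow> ('a \<Rightarrow> 'a \<Rightarrow> real) \<Rightarrow> 'a \<Rightarrow> 'a \<Rightarrow> real" where
  "border u c d a x y = (if x = u then if y = u then d else c y else if y = u then c x else a x y)"

text \<open>On finite \<open>X\<close> this says that \<open>l\<close> is no eigenvalue. It is
  phrased as solvability because bordering by a row \<open>c\<close> asks for a solution of (a - l)
  g = c.\<close>

definition solvable :: "'a set \<Rightarrow> ('a \<Rightarrow> 'a \<Rightarrow> real) \<Rightarrow> real \<Rightarrow> bool" where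
  "solvable X a l \<longleftrightarrow> (\<forall>c. \<exists>g. \<forall>x\<in>X. mv X a g x - l * g x = c x)"

lemma mv_affine: "finite X \<Longrightarrow> x \<in> X \<Longrightarrow> mv X (affine c d a) f x = c * mv X a f x + d * f x"
  by (simp add: mv_def affine_def algebra_simps sum.distrib sum_distrib_left if_distrib[of "\<lambda>t. _ * t"] sum.delta cong: if_cong)

lemma eigf_affine: "finite X \<Longrightarrow> eigf X a l f \<Longrightarrow> eigf X (affine c d a) (c * l + d) f"
  by (simp add: eigf_def mv_affine algebra_simps)

lemma eigs_affine: "finite X \<Longrightarrow> l \<in> eigs X a \<Longrightarrow> c * l + d \<in> eigs X (affine c d a)"
  unfolding eigs_def using eigf_affine by blast

lemma eigdim_gt_affine: "finite X \<Longrightarrow> eigdim_gt X a l k \<Longrightarrow> eigdim_gt X (affine c d a) (c * l + d) k"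
  unfolding eigdim_gt_def using eigf_affine by metis

lemma solvable_affine:
  assumes "finite X" "solvable X a l" "c \<noteq> 0"
  shows "solvable X (affine c d a) (c * l + d)"
  unfolding solvable_def
proof
  fix r :: "'a \<Rightarrow> real"
  obtain g where "\<forall>x\<in>X. mv X a g x - l * g x = r x / c"
    using assms(2)[unfolded solvable_def, rule_format, of "\<lambda>x. r x / c"] by blast
  then have "\<forall>x\<in>X. mv X (affine c d a) g x - (c * l + d) * g x = r x"
    using assms(1,3) by (simp add: mv_affine field_simps)
  then show "\<exists>g. \<forall>x\<in>X. mv X (affine c d a) g x - (c * l + d) * g x = r x" by blast
qed

lemma solvable_iff_injective:
  assumes "finite X" "\<And>f. nonzero_on X f \<Longrightarrow> \<not> eigf X a l f"
  shows "solvable X a l"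
  unfolding solvable_def
proof
  fix c :: "'a \<Rightarrow> real"
  have "\<not> nonzero_on X f" if "\<And>x. x \<in> X \<Longrightarrow> mv X (affine 1 (- l) a) f x = 0" for f
    using that assms by (auto simp: mv_affine eigf_def)
  from injective_imp_surjective[OF assms(1) this, where c = c]
  obtain g where "\<forall>x\<in>X. mv X (affine 1 (- l) a) g x = c x" by blast
  then show "\<exists>g. \<forall>x\<in>X. mv X a g x - l * g x = c x"
    using assms(1) by (auto simp: mv_affine)
qed

lemma eigs_agree: "agree X a b \<Longrightarrow> eigs X a = eigs X b"
  by (rule eigs_cong) (auto simp: agree_def)

lemma eigdim_gt_agree: "agree X a b \<Longrightarrow> eigdim_gt X a l k = eigdim_gt X b l k"
  by (rule eigdim_gt_cong) (auto simp: agree_def)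

lemma mv_agree: "agree X a b \<Longrightarrow> x \<in> X \<Longrightarrow> mv X a f x = mv X b f x"
  by (rule mv_cong) (auto simp: agree_def)

lemma solvable_agree: "agree X a b \<Longrightarrow> solvable X a l = solvable X b l"
  by (simp add: solvable_def mv_agree)

lemma agree_border: "u \<notin> W \<Longrightarrow> agree W (border u c d a) a"
  by (auto simp: agree_def border_def)

text \<open>Orthogonal families of the two blocks extend by zero. They have \<open>i + 1\<close> and
  \<open>j + 1\<close> members, together one more than \<open>i + j + 1\<close>.\<close>

lemma eigdim_gt_add:
  assumes fin: "finite X" "finite Y" and disj: "X \<inter> Y = {}"
    and zero: "\<And>x y. x \<in> X \<Longrightarrow> y \<in> Y \<Longrightarrow> a x y = 0 \<and> a y x = 0"
    and eigdim_gt: "eigdim_gt X a l i" "eigdim_gt Y a l j"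
  shows "eigdim_gt (X \<union> Y) a l (i + j + 1)"
proof -
  obtain F :: "nat \<Rightarrow> 'a \<Rightarrow> real" where F: "\<And>n. n \<le> i \<Longrightarrow> eigf X a l (F n) \<and> nonzero_on X (F n)"
    "\<And>n k. n \<le> i \<Longrightarrow> k \<le> i \<Longrightarrow> n \<noteq> k \<Longrightarrow> dot X (F n) (F k) = 0"
    using eigdim_gt(1) eigdim_gt_iff_orthogonal_family[OF fin(1)] by metis
  obtain G :: "nat \<Rightarrow> 'a \<Rightarrow> real" where G: "\<And>n. n \<le> j \<Longrightarrow> eigf Y a l (G n) \<and> nonzero_on Y (G n)"
    "\<And>n k. n \<le> j \<Longrightarrow> k \<le> j \<Longrightarrow> n \<noteq> k \<Longrightarrow> dot Y (G n) (G k) = 0"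
    using eigdim_gt(2) eigdim_gt_iff_orthogonal_family[OF fin(2)] by metis
  define H where "H n x = (if n \<le> i then if x \<in> X then F n x else 0
     else if x \<in> Y then G (n - Suc i) x else 0)" for n x
  have fXY: "finite (X \<union> Y)" using fin by simp
  have HX: "dot X (H n) (H k) = (if n \<le> i \<and> k \<le> i then dot X (F n) (F k) else 0)" for n k
    using disj by (auto simp: dot_def H_def intro!: sum.cong sum.neutral)
  have HY: "dot Y (H n) (H k) = (if n > i \<and> k > i then dot Y (G (n - Suc i)) (G (k - Suc i)) else 0)" for n k
    using disj by (auto simp: dot_def H_def intro!: sum.cong sum.neutral)
  have "eigf (X \<union> Y) a l (H n) \<and> nonzero_on (X \<union> Y) (H n)" if n: "n \<le> i + j + 1" for n
  proof (cases "n \<le> i")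
    case True
    have "mv (X \<union> Y) a (H n) x = mv X a (F n) x" for x
    proof -
      have "mv (X \<union> Y) a (H n) x = mv X a (H n) x"
        by (rule mv_supp) (use fXY True disj in \<open>auto simp: H_def\<close>)
      then show ?thesis using True by (simp add: H_def mv_def)
    qed
    moreover have "mv X a (F n) y = 0" if "y \<in> Y" for y
      using zero that by (simp add: mv_def)
    moreover have "H n y = 0" if "y \<in> Y" for y using True disj that by (auto simp: H_def)
    ultimately show ?thesis using F(1)[OF True] True
      by (auto simp: eigf_def nonzero_on_def H_def)
  next
    case False
    have "mv (X \<union> Y) a (H n) x = mv Y a (G (n - Suc i)) x" for x
    proof -
      have "mv (X \<union> Y) a (H n) x = mv Y a (H n) x"
        by (rule mv_supp) (use fXY False disj in \<open>auto simp: H_def\<close>)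
      then show ?thesis using False by (simp add: H_def mv_def)
    qed
    moreover have "mv Y a (G (n - Suc i)) x = 0" if "x \<in> X" for x
      using zero that by (simp add: mv_def)
    moreover have "H n x = 0" if "x \<in> X" for x using False disj that by (auto simp: H_def)
    moreover have "n - Suc i \<le> j" using n False by simp
    ultimately show ?thesis using G(1)[of "n - Suc i"] False
      by (auto simp: eigf_def nonzero_on_def H_def)
  qed
  moreover have "dot (X \<union> Y) (H n) (H k) = 0" if "n \<le> i + j + 1" "k \<le> i + j + 1" "n \<noteq> k" for n k
    using that F(2)[of n k] G(2)[of "n - Suc i" "k - Suc i"]
    by (auto simp: dot_union fin disj HX HY)
  ultimately show ?thesis unfolding eigdim_gt_iff_orthogonal_family[OF fXY] by blast
qed

text \<open>Eigenvectors on \<open>W\<close> that are orthogonal to the row of \<open>u\<close>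
  extend by zero, and the orthogonality costs one dimension.\<close>

lemma eigdim_gt_insert:
  assumes W: "finite W" "u \<notin> W" and eigdim_gt: "eigdim_gt W a l (Suc k)"
  shows "eigdim_gt (insert u W) a l k"
  unfolding eigdim_gt_def
proof
  fix c :: "nat \<Rightarrow> 'a \<Rightarrow> real"
  obtain f where f: "eigf W a l f" "nonzero_on W f" "\<And>i. i < Suc k \<Longrightarrow> dot W ((c(k := a u)) i) f = 0"
    using eigdim_gt unfolding eigdim_gt_def by metis
  let ?f = "\<lambda>x. if x = u then 0 else f x"
  have eq: "dot (insert u W) g ?f = dot W g f" for g
  proof -
    have "dot (insert u W) g ?f = dot W g ?f" using W by (intro dot_supp) auto
    also have "\<dots> = dot W g f" using W by (intro dot_cong) auto
    finally show ?thesis .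
  qed
  have "eigf (insert u W) a l ?f"
    using f(1) f(3)[of k] W by (auto simp: eigf_def mv_eq_dot eq)
  moreover have "nonzero_on (insert u W) ?f" using f(2) W by (auto simp: nonzero_on_def)
  moreover have "dot (insert u W) (c i) ?f = 0" if "i < k" for i
    using f(3)[of i] that by (simp add: eq)
  ultimately show "\<exists>f. eigf (insert u W) a l f \<and> nonzero_on (insert u W) f \<and> (\<forall>i<k. dot (insert u W) (c i) f = 0)"
    by blast
qed

text \<open>For the vector (1, -g), the rows of \<open>W\<close> are the equations for
  \<open>g\<close>, and the row of \<open>u\<close> reads d - c.g = l.\<close>

lemma eigf_border:
  assumes W: "finite W" "u \<notin> W" and g: "\<And>x. x \<in> W \<Longrightarrow> mv W a g x - l * g x = c x"
    and d: "d = l + dot W c g"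
  shows "eigf (insert u W) (border u c d a) l (\<lambda>x. if x = u then 1 else - g x)"
proof -
  have eq: "mv (insert u W) (border u c d a) (\<lambda>x. if x = u then 1 else - g x) x
    = border u c d a x u + dot W (border u c d a x) (\<lambda>y. - g y)" for x
    using W by (auto simp: mv_eq_dot dot_def intro!: sum.cong)
  have "dot W (border u c d a u) (\<lambda>y. - g y) = - dot W c g"
    unfolding dot_minus[symmetric] by (rule dot_cong) (use W in \<open>auto simp: border_def\<close>)
  moreover have "dot W (border u c d a x) (\<lambda>y. - g y) = - mv W a g x" if "x \<in> W" for x
    unfolding dot_minus[symmetric] mv_eq_dot by (rule dot_cong) (use W that in \<open>auto simp: border_def\<close>)
  ultimately have "mv (insert u W) (border u c d a) (\<lambda>x. if x = u then 1 else - g x) x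
    = l * (if x = u then 1 else - g x)" if "x \<in> insert u W" for x
    using that W(2) d g[of x] unfolding eq by (cases "x = u") (auto simp: border_def algebra_simps)
  then show ?thesis by (simp add: eigf_def)
qed

lemma eigs_border:
  assumes "finite W" "u \<notin> W" "\<And>x. x \<in> W \<Longrightarrow> mv W a g x - l * g x = c x" "d = l + dot W c g"
  shows "l \<in> eigs (insert u W) (border u c d a)"
  using eigf_border[OF assms] unfolding eigs_def nonzero_on_def by force

text \<open>The eigenvector \<open>z\<close> of the block extends by zero because it is orthogonal
  to \<open>c\<close>. The second eigenvector (1, -g) is independent of it, having a nonzero entry
  at \<open>u\<close>.\<close>

lemma eigdim_gt_border:
  assumes W: "finite W" "u \<notin> W" and g: "\<And>x. x \<in> W \<Longrightarrow> mv W a g x - l * g x = c x"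
    and d: "d = l + dot W c g"
    and z: "eigf W a l z" "nonzero_on W z" "dot W c z = 0"
  shows "eigdim_gt (insert u W) (border u c d a) l 1"
  unfolding eigdim_gt_def
proof
  fix e :: "nat \<Rightarrow> 'a \<Rightarrow> real"
  let ?V = "insert u W" and ?a = "border u c d a"
  define h where "h = (\<lambda>x. if x = u then 1 else - g x)"
  define y where "y = (\<lambda>x. if x = u then 0 else z x)"
  have h: "eigf ?V ?a l h" unfolding h_def by (rule eigf_border[OF W g d])
  have "mv ?V ?a y x = dot W (?a x) z" for x
  proof -
    have "mv ?V ?a y x = dot W (?a x) y"
      unfolding mv_eq_dot using W by (intro dot_supp) (auto simp: y_def)
    also have "\<dots> = dot W (?a x) z" using W by (intro dot_cong) (auto simp: y_def)
    finally show ?thesis .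
  qed
  moreover have "dot W (?a u) z = 0"
    using z(3) W by (subst dot_cong[of W "?a u" c z z]) (auto simp: border_def)
  moreover have "dot W (?a x) z = mv W a z x" if "x \<in> W" for x
    unfolding mv_eq_dot by (rule dot_cong) (use that W in \<open>auto simp: border_def\<close>)
  ultimately have y: "eigf ?V ?a l y"
    using z(1) W by (auto simp: eigf_def y_def)
  have ny: "nonzero_on ?V y" using z(2) W by (auto simp: nonzero_on_def y_def)
  show "\<exists>f. eigf ?V ?a l f \<and> nonzero_on ?V f \<and> (\<forall>i<1. dot ?V (e i) f = 0)"
  proof (cases "dot ?V (e 0) y = 0")
    case True
    with y ny show ?thesis by auto
  next
    case False
    \<comment> \<open>This multiple of \<open>y\<close> makes the functional \<open>e 0\<close>
      vanish, and the entry 1 of \<open>h\<close> at \<open>u\<close> keeps the sum nonzero.\<close>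
    let ?t = "- dot ?V (e 0) h / dot ?V (e 0) y"
    have "eigf ?V ?a l (\<lambda>x. h x + ?t * y x)" by (intro eigf_add eigf_scale h y)
    moreover have "nonzero_on ?V (\<lambda>x. h x + ?t * y x)" by (auto simp: nonzero_on_def h_def y_def)
    moreover have "dot ?V (e 0) (\<lambda>x. h x + ?t * y x) = 0"
      using False by (simp only: dot_add dot_scale) simp
    ultimately show ?thesis by auto
  qed
qed

lemma exists_eigenvalue:
  assumes "finite X" "X \<noteq> {}" "sym_on X a"
  shows "eigs X a \<noteq> {}"
proof -
  have "1 \<le> card (eigs X a)"
  proof (rule card_eigs_ge[OF assms(1,3)])
    fix p :: "real poly"
    assume p: "p \<noteq> 0" "\<And>x. x \<in> X \<Longrightarrow> poly_act X a p (\<lambda>_. 1) x = 0"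
    show "1 \<le> degree p"
    proof (rule ccontr)
      assume "\<not> 1 \<le> degree p"
      then obtain c where "p = [:c:]" by (metis degree_eq_zeroE not_one_le_zero le_zero_eq nat_le_linear not_less_eq_eq One_nat_def)
      with p assms(2) show False by (auto simp: poly_act_pCons mv_def)
    qed
  qed
  then show ?thesis by auto
qed

section \<open>Realisations of a graph on subsets of its vertices\<close>

locale sym_rel =
  fixes E :: "'a \<Rightarrow> 'a \<Rightarrow> bool"
  assumes E_sym: "E x y \<Longrightarrow> E y x"
begin

definition sep :: "'a set \<Rightarrow> 'a set \<Rightarrow> bool" where
  "sep X Y \<longleftrightarrow> X \<inter> Y = {} \<and> (\<forall>x\<in>X. \<forall>y\<in>Y. \<not> E x y)"

text \<open>By \<open>card_eigs_triple\<close> and \<open>card_eigs_two_doubles\<close>, such sets have \<open>q \<le> |V| - 2\<close>.\<close>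

definition deficient :: "'a set \<Rightarrow> bool" where
  "deficient V \<longleftrightarrow> (\<exists>a. realizes E V a \<and>
     ((\<exists>l. eigdim_gt V a l 2) \<or> (\<exists>l m. l \<noteq> m \<and> eigdim_gt V a l 1 \<and> eigdim_gt V a m 1)))"

text \<open>The common eigenvalue is normalised to 0 because kernels of two parts that share a
  vertex can be glued, see \<open>deficient_one_sum\<close>.\<close>

definition doubly_singular :: "'a set \<Rightarrow> bool" where
  "doubly_singular V \<longleftrightarrow> (\<exists>a. realizes E V a \<and> eigdim_gt V a 0 1)"

lemma sep_sym: "sep X Y \<Longrightarrow> sep Y X"
  using E_sym unfolding sep_def by blast

lemma sep_Un: "sep (X \<union> Y) Z \<longleftrightarrow> sep X Z \<and> sep Y Z"
  by (auto simp: sep_def)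

lemma sep_mono: "sep X Y \<Longrightarrow> X' \<subseteq> X \<Longrightarrow> Y' \<subseteq> Y \<Longrightarrow> sep X' Y'"
  unfolding sep_def by blast

lemma realizes_affine: "realizes E X a \<Longrightarrow> c \<noteq> 0 \<Longrightarrow> realizes E X (affine c d a)"
  by (auto simp: realizes_def affine_def sym_on_def)

lemma realizes_border:
  assumes "realizes E W a" "u \<notin> W" "\<And>x. x \<in> W \<Longrightarrow> c x \<noteq> 0 \<longleftrightarrow> E u x"
  shows "realizes E (insert u W) (border u c d a)"
  using assms E_sym by (auto simp: realizes_def border_def sym_on_def)

lemma realizes_extend:
  assumes "realizes E X a" "X \<subseteq> V"
  obtains b where "realizes E V b" "agree X b a"
proof
  \<comment> \<open>Entries outside the block are free up to being nonzero on edges, so the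
    adjacency matrix is the default there.\<close>
  let ?b = "\<lambda>x y. if x \<in> X \<and> y \<in> X then a x y else of_bool (E x y)"
  show "realizes E V ?b" using assms E_sym by (auto simp: realizes_def sym_on_def)
  show "agree X ?b a" by (simp add: agree_def)
qed

lemma realizes_glue:
  assumes "realizes E X a" "realizes E Y b" "X \<inter> Y = {}"
  obtains c where "realizes E (X \<union> Y) c" "agree X c a" "agree Y c b"
proof
  let ?c = "\<lambda>x y. if x \<in> X \<and> y \<in> X then a x y else if x \<in> Y \<and> y \<in> Y then b x y else of_bool (E x y)"
  show "realizes E (X \<union> Y) ?c" using assms E_sym by (auto simp: realizes_def sym_on_def)
  show "agree X ?c a" "agree Y ?c b" using assms(3) by (auto simp: agree_def)
qed

lemma realizes_sep:
  assumes "realizes E V a" "X \<subseteq> V" "Y \<subseteq> V" "sep X Y" "x \<in> X" "y \<in> Y"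
  shows "a x y = 0 \<and> a y x = 0"
  using assms E_sym by (fastforce simp: realizes_def sep_def)

lemma eigdim_gt_join:
  assumes "finite V" "realizes E V c" "X \<subseteq> V" "Y \<subseteq> V" "sep X Y" "eigdim_gt X c l i" "eigdim_gt Y c l j"
  shows "eigdim_gt (X \<union> Y) c l (i + j + 1)"
  using assms realizes_sep[OF assms(2-5)]
  by (intro eigdim_gt_add) (auto simp: sep_def intro: finite_subset)

lemma eigdim_gt_1_join:
  assumes "finite V" "realizes E V c" "X \<subseteq> V" "Y \<subseteq> V" "sep X Y" "l \<in> eigs X c" "l \<in> eigs Y c"
  shows "eigdim_gt (X \<union> Y) c l 1"
  using eigdim_gt_join[OF assms(1-5), of l 0 0] assms(6,7) by (simp add: eigdim_gt_0)

lemma eigdim_gt_2_join: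
  assumes "finite V" "realizes E V c" "X \<subseteq> V" "Y \<subseteq> V" "Z \<subseteq> V" "sep X Y" "sep X Z" "sep Y Z"
    "l \<in> eigs X c" "l \<in> eigs Y c" "l \<in> eigs Z c"
  shows "eigdim_gt (X \<union> Y \<union> Z) c l 2"
proof -
  have "eigdim_gt (X \<union> Y) c l 1" by (rule eigdim_gt_1_join) (use assms in auto)
  then show ?thesis using eigdim_gt_join[OF assms(1,2), of "X \<union> Y" Z l 1 0] assms
    by (simp add: sep_Un eigdim_gt_0 numeral_2_eq_2)
qed

text \<open>Half the identity plus small off-diagonal entries: \<open>b\<close> is positive definite
  and b - 1 is negative definite. So neither 0 nor 1 is an eigenvalue, and the signs of the
  quadratic forms at both values are known.\<close>

lemma near_scalar:
  assumes X: "finite X"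
  obtains b where "realizes E X b"
    "\<And>f. nonzero_on X f \<Longrightarrow> 0 < dot X f (mv X b f) \<and> dot X f (mv X b f) < dot X f f"
proof
  let ?n = "real (card X)"
  \<comment> \<open>With \<epsilon> times \<open>card X\<close> at most 1/4, the off-diagonal part
    \<open>r\<close> stays below half of f.f in absolute value.\<close>
  define \<epsilon> where "\<epsilon> = 1 / (4 * (?n + 1))"
  define b where "b = (\<lambda>x y. if x = y then 1 / 2 else \<epsilon> * of_bool (E x y))"
  have \<epsilon>: "\<epsilon> > 0" "\<epsilon> * ?n \<le> 1 / 4" by (auto simp: \<epsilon>_def field_simps)
  show "realizes E X b" using \<epsilon> E_sym by (auto simp: realizes_def sym_on_def b_def)
  fix f assume nz: "nonzero_on X f"
  define r where "r = (\<Sum>x\<in>X. \<Sum>y\<in>X. (if x = y then 0 else \<epsilon> * of_bool (E x y)) * f x * f y)"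
  have "dot X f (mv X b f) = (\<Sum>x\<in>X. \<Sum>y\<in>X. (if x = y then 1/2 * f x * f x else 0) + (if x = y then 0 else \<epsilon> * of_bool (E x y)) * f x * f y)"
    unfolding dot_def mv_def sum_distrib_left by (intro sum.cong) (auto simp: b_def)
  also have "\<dots> = 1 / 2 * dot X f f + r"
    using X by (simp add: sum.distrib r_def dot_def sum_distrib_left mult.assoc)
  finally have eq: "dot X f (mv X b f) = 1 / 2 * dot X f f + r" .
  have "\<bar>r\<bar> \<le> (\<Sum>x\<in>X. \<Sum>y\<in>X. \<bar>(if x = y then 0 else \<epsilon> * of_bool (E x y)) * f x * f y\<bar>)"
    unfolding r_def by (intro order_trans[OF sum_abs] sum_mono sum_abs)
  also have "\<dots> \<le> (\<Sum>x\<in>X. \<Sum>y\<in>X. \<epsilon> / 2 * (f x * f x) + \<epsilon> / 2 * (f y * f y))"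
  proof (intro sum_mono)
    fix x y
    have "2 * (\<bar>f x\<bar> * \<bar>f y\<bar>) \<le> \<bar>f x\<bar> * \<bar>f x\<bar> + \<bar>f y\<bar> * \<bar>f y\<bar>"
      using sum_squares_bound[of "\<bar>f x\<bar>" "\<bar>f y\<bar>"] by (simp add: power2_eq_square)
    then have "\<epsilon> * (\<bar>f x\<bar> * \<bar>f y\<bar>) \<le> \<epsilon> * ((f x * f x + f y * f y) / 2)"
      using \<epsilon>(1) by (intro mult_left_mono) auto
    moreover have "\<bar>(if x = y then 0 else \<epsilon> * of_bool (E x y)) * f x * f y\<bar> \<le> \<epsilon> * (\<bar>f x\<bar> * \<bar>f y\<bar>)"
      using \<epsilon>(1) by (auto simp: abs_mult)
    ultimately show "\<bar>(if x = y then 0 else \<epsilon> * of_bool (E x y)) * f x * f y\<bar>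
      \<le> \<epsilon> / 2 * (f x * f x) + \<epsilon> / 2 * (f y * f y)" by (simp add: algebra_simps)
  qed
  also have "\<dots> = \<epsilon> * ?n * dot X f f"
  proof -
    have "(\<Sum>x\<in>X. \<Sum>y\<in>X. \<epsilon> / 2 * (f x * f x) + \<epsilon> / 2 * (f y * f y))
      = (\<Sum>x\<in>X. ?n * (\<epsilon> / 2 * (f x * f x))) + ?n * (\<Sum>y\<in>X. \<epsilon> / 2 * (f y * f y))"
      by (simp only: sum.distrib sum_constant)
    also have "\<dots> = ?n * (\<epsilon> / 2 * dot X f f) + ?n * (\<epsilon> / 2 * dot X f f)"
      by (simp only: dot_def sum_distrib_left)
    finally show ?thesis by (simp add: algebra_simps)
  qed
  also have "\<dots> \<le> 1 / 4 * dot X f f"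
    using \<epsilon>(2) dot_self_nonneg by (rule mult_right_mono)
  finally show "0 < dot X f (mv X b f) \<and> dot X f (mv X b f) < dot X f f"
    using dot_self_pos[OF X nz] unfolding eq by linarith
qed

text \<open>A positive definite matrix has a positive eigenvalue; scaling it to 1 keeps 0 outside
  the spectrum. In this way all branches at a vertex obtain a common eigenvalue.\<close>

lemma eigenvalue_one_solvable_zero:
  assumes X: "finite X" "X \<noteq> {}"
  obtains b where "realizes E X b" "1 \<in> eigs X b" "solvable X b 0"
proof -
  obtain b where b: "realizes E X b" "\<And>f. nonzero_on X f \<Longrightarrow> 0 < dot X f (mv X b f)"
    using near_scalar[OF X(1)] by metis
  have pos: "l \<noteq> 0" if "l \<in> eigs X b" for l
  proof
    assume "l = 0"
    with that obtain f where f: "eigf X b 0 f" "nonzero_on X f" by (auto simp: eigs_def)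
    then have "dot X f (mv X b f) = 0" by (simp add: dot_def eigf_def)
    with b(2)[OF f(2)] show False by simp
  qed
  obtain l where l: "l \<in> eigs X b"
    using exists_eigenvalue[OF X, of b] b(1) by (auto simp: realizes_def)
  have "solvable X b 0"
    by (rule solvable_iff_injective[OF X(1)]) (use pos in \<open>auto simp: eigs_def\<close>)
  with l pos show ?thesis
    using that[of "affine (1 / l) 0 b"] realizes_affine[OF b(1), of "1 / l" 0]
      eigs_affine[OF X(1) l, of "1 / l" 0] solvable_affine[OF X(1), of b 0 "1 / l" 0] by simp
qed

text \<open>It is enough to find two different eigenvalues, as an affine map moves them to 0 and
  1.\<close>

lemma eigenvalues_zero_one:
  assumes X: "finite X" "2 \<le> card X"
  obtains b where "realizes E X b" "0 \<in> eigs X b" "1 \<in> eigs X b"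
proof -
  obtain x0 where x0: "x0 \<in> X" using X by fastforce
  obtain x1 where x1: "x1 \<in> X" "x1 \<noteq> x0"
  proof (rule ccontr)
    assume "\<not> thesis"
    then have "X \<subseteq> {x0}" using that by blast
    then have "card X \<le> 1" using card_mono[of "{x0}"] by simp
    with X show False by simp
  qed
  define r where "r x = (\<Sum>y\<in>X - {x}. of_bool (E x y) :: real)" for x
  \<comment> \<open>The diagonal is chosen such that \<open>a\<close> maps the constant 1 to the
    indicator of \<open>x0\<close>. Because of the second vertex \<open>x1\<close> the constant is
    then no eigenvector, even if \<open>X\<close> has no edges.\<close>
  define a where "a = (\<lambda>x y. if x = y then of_bool (x = x0) - r x else of_bool (E x y))"
  have a: "realizes E X a" using E_sym by (auto simp: realizes_def sym_on_def a_def)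
  have one: "mv X a (\<lambda>_. 1) x = of_bool (x = x0)" if "x \<in> X" for x
  proof -
    have "mv X a (\<lambda>_. 1) x = a x x + (\<Sum>y\<in>X - {x}. a x y)"
      using that X(1) by (simp add: mv_def sum.remove)
    also have "(\<Sum>y\<in>X - {x}. a x y) = r x"
      unfolding r_def by (rule sum.cong) (auto simp: a_def)
    finally show ?thesis by (simp add: a_def)
  qed
  obtain l m where lm: "l \<in> eigs X a" "m \<in> eigs X a" "l \<noteq> m"
  proof (rule two_eigenvalues[OF X(1)])
    show "sym_on X a" using a by (simp add: realizes_def)
    show "nonzero_on X (\<lambda>_. 1)" using x0 by (auto simp: nonzero_on_def)
    show "\<exists>x\<in>X. mv X a (\<lambda>_. 1) x \<noteq> c * 1" for c
      using one[OF x0] one[OF x1(1)] x0 x1 by (cases "c = 1") (force, force)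
  qed
  let ?b = "affine (1 / (m - l)) (- l / (m - l)) a"
  have "m / (m - l) - l / (m - l) = 1"
    using lm(3) by (metis diff_divide_distrib divide_self right_minus_eq)
  then have "1 / (m - l) * m + - l / (m - l) = 1" by simp
  then have "1 \<in> eigs X ?b" using eigs_affine[OF X(1) lm(2)] by metis
  moreover have "0 \<in> eigs X ?b" using eigs_affine[OF X(1) lm(1), of "1 / (m - l)" "- l / (m - l)"] by simp
  moreover have "realizes E X ?b" using a lm(3) by (intro realizes_affine) auto
  ultimately show ?thesis using that by blast
qed

end

section \<open>Graphs with cut vertices\<close>

text \<open>The rank-one term vanishes on vectors orthogonal to \<open>v\<close>, a condition that
  costs one dimension.\<close>

lemma eigdim_gt_rank_one_update:
  assumes "eigdim_gt X a l (Suc k)"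
  shows "eigdim_gt X (\<lambda>x y. a x y + v x * v y) l k"
  unfolding eigdim_gt_def
proof
  fix c :: "nat \<Rightarrow> 'a \<Rightarrow> real"
  from assms[unfolded eigdim_gt_def, rule_format, of "c(k := v)"] obtain f
    where f: "eigf X a l f" "nonzero_on X f" "\<forall>i<Suc k. dot X ((c(k := v)) i) f = 0" by blast
  have "mv X (\<lambda>x y. a x y + v x * v y) f x = mv X a f x + v x * dot X v f" for x
    by (simp add: mv_def dot_def algebra_simps sum.distrib sum_distrib_left)
  moreover have "dot X v f = 0" using f(3)[rule_format, of k] by simp
  moreover have "dot X (c i) f = 0" if "i < k" for i using f(3)[rule_format, of i] that by simp
  ultimately show "\<exists>f. eigf X (\<lambda>x y. a x y + v x * v y) l f \<and> nonzero_on X f \<and> (\<forall>i<k. dot X (c i) f = 0)"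
    using f(1,2) by (auto simp: eigf_def intro!: exI[of _ f])
qed

lemma eigdim_gt_2I:
  assumes "finite X" "eigf X a l f" "eigf X a l g" "eigf X a l h"
    "nonzero_on X f" "nonzero_on X g" "nonzero_on X h"
    "dot X f g = 0" "dot X f h = 0" "dot X g h = 0"
  shows "eigdim_gt X a l 2"
proof -
  define F where "F = (\<lambda>i::nat. if i = 0 then f else if i = 1 then g else h)"
  have "(\<forall>i\<le>2. eigf X a l (F i) \<and> nonzero_on X (F i)) \<and>
    (\<forall>i\<le>2. \<forall>j\<le>2. i \<noteq> j \<longrightarrow> dot X (F i) (F j) = 0)"
    using assms by (auto simp: F_def dot_commute le_Suc_eq numeral_2_eq_2)
  then show ?thesis unfolding eigdim_gt_iff_orthogonal_family[OF assms(1)] by blast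
qed

context sym_rel
begin

lemma realizes_parts:
  assumes "realizes E X1 a1" "realizes E X2 a2" "realizes E X3 a3" "realizes E X4 a4"
    and disj: "X1 \<inter> X2 = {}" "(X1 \<union> X2) \<inter> X3 = {}" "(X1 \<union> X2 \<union> X3) \<inter> X4 = {}"
    and V: "X1 \<union> X2 \<union> X3 \<union> X4 \<subseteq> V"
  obtains a where "realizes E V a" "agree X1 a a1" "agree X2 a a2" "agree X3 a a3" "agree X4 a a4"
proof -
  obtain b where b: "realizes E (X1 \<union> X2) b" "agree X1 b a1" "agree X2 b a2"
    using realizes_glue[OF assms(1,2) disj(1)] .
  obtain c where c: "realizes E (X1 \<union> X2 \<union> X3) c" "agree (X1 \<union> X2) c b" "agree X3 c a3"
    using realizes_glue[OF b(1) assms(3) disj(2)] .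
  obtain d where d: "realizes E (X1 \<union> X2 \<union> X3 \<union> X4) d" "agree (X1 \<union> X2 \<union> X3) d c" "agree X4 d a4"
    using realizes_glue[OF c(1) assms(4) disj(3)] .
  obtain a where a: "realizes E V a" "agree (X1 \<union> X2 \<union> X3 \<union> X4) a d"
    using realizes_extend[OF d(1) V] .
  show ?thesis
    by (rule that[OF a(1)]) (use a(2) b c d in \<open>auto simp: agree_def\<close>)
qed

lemma realizes_empty: "realizes E {} a"
  by (simp add: realizes_def sym_on_def)

lemma realizes_three:
  assumes "realizes E X1 a1" "realizes E X2 a2" "realizes E X3 a3"
    and "X1 \<inter> X2 = {}" "(X1 \<union> X2) \<inter> X3 = {}" "X1 \<union> X2 \<union> X3 \<subseteq> V"
  obtains a where "realizes E V a" "agree X1 a a1" "agree X2 a a2" "agree X3 a a3"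
proof -
  have empty: "realizes E {} (\<lambda>_ _. 0)" by (rule realizes_empty)
  show ?thesis
    by (rule realizes_parts[OF assms(1-3) empty assms(4,5), where V = V]) (use assms(6) that in auto)
qed

lemma realizes_two:
  assumes "realizes E X1 a1" "realizes E X2 a2" "X1 \<inter> X2 = {}" "X1 \<union> X2 \<subseteq> V"
  obtains a where "realizes E V a" "agree X1 a a1" "agree X2 a a2"
proof -
  have empty: "realizes E {} (\<lambda>_ _. 0)" by (rule realizes_empty)
  show ?thesis
    by (rule realizes_three[OF assms(1,2) empty assms(3), where V = V]) (use assms(4) that in auto)
qed

section \<open>Common eigenvalues of the branches at a vertex\<close>

lemma deficientI_triple: "realizes E V a \<Longrightarrow> eigdim_gt V a l 2 \<Longrightarrow> deficient V"
  unfolding deficient_def by blast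

lemma deficientI_doubles: "realizes E V a \<Longrightarrow> l \<noteq> m \<Longrightarrow> eigdim_gt V a l 1 \<Longrightarrow> eigdim_gt V a m 1 \<Longrightarrow> deficient V"
  unfolding deficient_def by blast

lemma doubly_singularI:
  assumes "finite V" "realizes E V a" "eigdim_gt V a l 1"
  shows "doubly_singular V"
  using eigdim_gt_affine[OF assms(1,3), of 1 "- l"] realizes_affine[OF assms(2), of 1 "- l"]
  unfolding doubly_singular_def by auto

lemma solvable_join:
  assumes V: "finite V" "realizes E V c" "X \<subseteq> V" "Y \<subseteq> V" "sep X Y" "solvable X c l" "solvable Y c l"
  shows "solvable (X \<union> Y) c l"
  unfolding solvable_def
proof
  fix r :: "'a \<Rightarrow> real"
  obtain g h where g: "\<forall>x\<in>X. mv X c g x - l * g x = r x" and h: "\<forall>x\<in>Y. mv Y c h x - l * h x = r x"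
    using V(6,7) unfolding solvable_def by blast
  let ?f = "\<lambda>x. if x \<in> X then g x else h x"
  have fin: "finite (X \<union> Y)" using V by (auto intro: finite_subset)
  note zero = realizes_sep[OF V(2-5)]
  have disj: "X \<inter> Y = {}" using V(5) by (simp add: sep_def)
  have "mv (X \<union> Y) c ?f x = mv X c g x" if "x \<in> X" for x
  proof -
    have "mv (X \<union> Y) c ?f x = mv X c ?f x"
      by (rule mv_supp[OF fin]) (use that zero in auto)
    then show ?thesis by (simp add: mv_def)
  qed
  moreover have "mv (X \<union> Y) c ?f x = mv Y c h x" if "x \<in> Y" for x
  proof -
    have "mv (X \<union> Y) c ?f x = mv Y c ?f x"
      by (rule mv_supp[OF fin]) (use that zero in auto)
    also have "\<dots> = mv Y c h x" by (rule mv_cong) (use disj in auto)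
    finally show ?thesis .
  qed
  ultimately show "\<exists>g. \<forall>x\<in>X \<union> Y. mv (X \<union> Y) c g x - l * g x = r x"
    using g h disj by (intro exI[of _ ?f]) auto
qed

text \<open>Any value \<open>l\<close> at which the block can be solved becomes an eigenvalue for
  one choice of the corner entry. Without \<open>u\<close> the block keeps its own
  eigenvalues.\<close>

lemma border_eigenvalue:
  assumes "finite W" "u \<notin> W" "realizes E W b" "solvable W b l"
  obtains a where "realizes E (insert u W) a" "agree W a b" "l \<in> eigs (insert u W) a"
proof -
  let ?c = "\<lambda>x. of_bool (E u x) :: real"
  obtain g where g: "\<And>x. x \<in> W \<Longrightarrow> mv W b g x - l * g x = ?c x"
    using assms(4)[unfolded solvable_def, rule_format, of ?c] by blast
  show ?thesis
    using that[OF realizes_border[OF assms(3,2), of ?c] agree_border[OF assms(2)]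
        eigs_border[OF assms(1,2) g refl]] by simp
qed

text \<open>Four branches share the eigenvalue 1, and \<open>u\<close> removes one of the four
  dimensions. The part \<open>X4\<close> may collect several branches.\<close>

lemma deficient_four_branches:
  assumes V: "finite V" "V = insert u (X1 \<union> X2 \<union> X3 \<union> X4)" "u \<notin> X1 \<union> X2 \<union> X3 \<union> X4"
    and ne: "X1 \<noteq> {}" "X2 \<noteq> {}" "X3 \<noteq> {}" "X4 \<noteq> {}"
    and sep: "sep X1 X2" "sep X1 X3" "sep X2 X3" "sep (X1 \<union> X2 \<union> X3) X4"
  shows "deficient V"
proof -
  have fin: "finite X1" "finite X2" "finite X3" "finite X4" using V by auto
  obtain b1 where b1: "realizes E X1 b1" "1 \<in> eigs X1 b1"
    using eigenvalue_one_solvable_zero[OF fin(1) ne(1)] .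
  obtain b2 where b2: "realizes E X2 b2" "1 \<in> eigs X2 b2"
    using eigenvalue_one_solvable_zero[OF fin(2) ne(2)] .
  obtain b3 where b3: "realizes E X3 b3" "1 \<in> eigs X3 b3"
    using eigenvalue_one_solvable_zero[OF fin(3) ne(3)] .
  obtain b4 where b4: "realizes E X4 b4" "1 \<in> eigs X4 b4"
    using eigenvalue_one_solvable_zero[OF fin(4) ne(4)] .
  obtain a where a: "realizes E V a" "agree X1 a b1" "agree X2 a b2" "agree X3 a b3" "agree X4 a b4"
    by (rule realizes_parts[OF b1(1) b2(1) b3(1) b4(1), where V = V]) (use sep V in \<open>auto simp: sep_def\<close>)
  have "eigdim_gt (X1 \<union> X2 \<union> X3) a 1 2"
    by (rule eigdim_gt_2_join[OF V(1) a(1)]) (use sep V a b1 b2 b3 in \<open>auto simp: eigs_agree\<close>)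
  then have "eigdim_gt (X1 \<union> X2 \<union> X3 \<union> X4) a 1 (2 + 0 + 1)"
    by (intro eigdim_gt_join[OF V(1) a(1)]) (use sep V a b4 in \<open>auto simp: eigdim_gt_0 eigs_agree\<close>)
  then have "eigdim_gt V a 1 2"
    unfolding V(2) using V fin by (intro eigdim_gt_insert) (auto simp: numeral_3_eq_3 numeral_2_eq_2)
  with a(1) show ?thesis by (rule deficientI_triple)
qed

text \<open>Branches with at least two vertices have room for both eigenvalues 0 and 1. Each occurs
  three times without \<open>u\<close>, hence twice with it.\<close>

lemma deficient_three_big_branches:
  assumes V: "finite V" "V = insert u (X \<union> Y \<union> Z)" "u \<notin> X \<union> Y \<union> Z"
    and card: "2 \<le> card X" "2 \<le> card Y" "2 \<le> card Z"
    and sep: "sep X Y" "sep X Z" "sep Y Z"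
  shows "deficient V"
proof -
  have fin: "finite X" "finite Y" "finite Z" using V by auto
  obtain b1 where b1: "realizes E X b1" "0 \<in> eigs X b1" "1 \<in> eigs X b1"
    using eigenvalues_zero_one[OF fin(1) card(1)] .
  obtain b2 where b2: "realizes E Y b2" "0 \<in> eigs Y b2" "1 \<in> eigs Y b2"
    using eigenvalues_zero_one[OF fin(2) card(2)] .
  obtain b3 where b3: "realizes E Z b3" "0 \<in> eigs Z b3" "1 \<in> eigs Z b3"
    using eigenvalues_zero_one[OF fin(3) card(3)] .
  obtain a where a: "realizes E V a" "agree X a b1" "agree Y a b2" "agree Z a b3"
    by (rule realizes_three[OF b1(1) b2(1) b3(1), where V = V]) (use sep V in \<open>auto simp: sep_def\<close>)
  have "eigdim_gt V a l 1" if "l = 0 \<or> l = 1" for l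
  proof -
    have "eigdim_gt (X \<union> Y \<union> Z) a l 2"
      by (rule eigdim_gt_2_join[OF V(1) a(1)]) (use sep V a b1 b2 b3 that in \<open>auto simp: eigs_agree\<close>)
    then show ?thesis
      unfolding V(2) using V fin by (intro eigdim_gt_insert) (auto simp: numeral_2_eq_2)
  qed
  with a(1) show ?thesis by (intro deficientI_doubles[of V a 0 1]) auto
qed

text \<open>Three branches share an eigenvalue, and \<open>u\<close> removes one of the three
  dimensions.\<close>

lemma doubly_singular_three_branches:
  assumes V: "finite V" "V = insert u (X \<union> Y \<union> Z)" "u \<notin> X \<union> Y \<union> Z"
    and ne: "X \<noteq> {}" "Y \<noteq> {}" "Z \<noteq> {}"
    and sep: "sep X Y" "sep X Z" "sep Y Z"
  shows "doubly_singular V"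
proof -
  have fin: "finite X" "finite Y" "finite Z" using V by auto
  obtain b1 where b1: "realizes E X b1" "1 \<in> eigs X b1"
    using eigenvalue_one_solvable_zero[OF fin(1) ne(1)] .
  obtain b2 where b2: "realizes E Y b2" "1 \<in> eigs Y b2"
    using eigenvalue_one_solvable_zero[OF fin(2) ne(2)] .
  obtain b3 where b3: "realizes E Z b3" "1 \<in> eigs Z b3"
    using eigenvalue_one_solvable_zero[OF fin(3) ne(3)] .
  obtain a where a: "realizes E V a" "agree X a b1" "agree Y a b2" "agree Z a b3"
    by (rule realizes_three[OF b1(1) b2(1) b3(1), where V = V]) (use sep V in \<open>auto simp: sep_def\<close>)
  have "eigdim_gt (X \<union> Y \<union> Z) a 1 2"
    by (rule eigdim_gt_2_join[OF V(1) a(1)]) (use sep V a b1 b2 b3 in \<open>auto simp: eigs_agree\<close>)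
  then have "eigdim_gt V a 1 1"
    unfolding V(2) using V fin by (intro eigdim_gt_insert) (auto simp: numeral_2_eq_2)
  with V(1) a(1) show ?thesis by (rule doubly_singularI)
qed

lemma doubly_singular_disconnected:
  assumes V: "finite V" "V = X \<union> Y" "X \<noteq> {}" "Y \<noteq> {}" "sep X Y"
  shows "doubly_singular V"
proof -
  have fin: "finite X" "finite Y" using V by auto
  obtain b1 where b1: "realizes E X b1" "1 \<in> eigs X b1"
    using eigenvalue_one_solvable_zero[OF fin(1) V(3)] .
  obtain b2 where b2: "realizes E Y b2" "1 \<in> eigs Y b2"
    using eigenvalue_one_solvable_zero[OF fin(2) V(4)] .
  obtain a where a: "realizes E V a" "agree X a b1" "agree Y a b2"
    by (rule realizes_two[OF b1(1) b2(1), where V = V]) (use V in \<open>auto simp: sep_def\<close>)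
  have "eigdim_gt (X \<union> Y) a 1 1"
    by (rule eigdim_gt_1_join[OF V(1) a(1)]) (use V a b1 b2 in \<open>auto simp: eigs_agree\<close>)
  then show ?thesis using V(1,2) a(1) by (intro doubly_singularI[of V a 1]) auto
qed

lemma deficient_disconnected:
  assumes V: "finite V" "V = X \<union> Y" "2 \<le> card X" "2 \<le> card Y" "sep X Y"
  shows "deficient V"
proof -
  have fin: "finite X" "finite Y" using V by auto
  obtain b1 where b1: "realizes E X b1" "0 \<in> eigs X b1" "1 \<in> eigs X b1"
    using eigenvalues_zero_one[OF fin(1) V(3)] .
  obtain b2 where b2: "realizes E Y b2" "0 \<in> eigs Y b2" "1 \<in> eigs Y b2"
    using eigenvalues_zero_one[OF fin(2) V(4)] .
  obtain a where a: "realizes E V a" "agree X a b1" "agree Y a b2"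
    by (rule realizes_two[OF b1(1) b2(1), where V = V]) (use V in \<open>auto simp: sep_def\<close>)
  have "eigdim_gt (X \<union> Y) a l 1" if "l = 0 \<or> l = 1" for l
    by (rule eigdim_gt_1_join[OF V(1) a(1)]) (use V a b1 b2 that in \<open>auto simp: eigs_agree\<close>)
  then show ?thesis using V(2) a(1) by (intro deficientI_doubles[of V a 0 1]) auto
qed

text \<open>The vertex \<open>w\<close> with diagonal entry 0 adds a third kernel vector to the two
  on \<open>Y\<close>.\<close>

lemma deficient_isolated_vertex:
  assumes V: "finite V" "V = insert w Y" "sep {w} Y" "doubly_singular Y"
  shows "deficient V"
proof -
  obtain b where b: "realizes E Y b" "eigdim_gt Y b 0 1" using V(4) by (auto simp: doubly_singular_def)
  have z: "realizes E {w} (\<lambda>_ _. 0)" by (auto simp: realizes_def sym_on_def)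
  obtain a where a: "realizes E V a" "agree {w} a (\<lambda>_ _. 0)" "agree Y a b"
    by (rule realizes_two[OF z b(1), where V = V]) (use V in \<open>auto simp: sep_def\<close>)
  have "0 \<in> eigs {w} a"
    using a(2) by (auto simp: eigs_def eigf_def nonzero_on_def mv_def agree_def intro!: exI[of _ "\<lambda>_. 1"])
  then have "eigdim_gt ({w} \<union> Y) a 0 (0 + 1 + 1)"
    by (intro eigdim_gt_join[OF V(1) a(1)]) (use V a b in \<open>auto simp: eigdim_gt_0 eigdim_gt_agree\<close>)
  then show ?thesis using V(2) a(1) by (intro deficientI_triple[of V a 0]) (auto simp: numeral_2_eq_2)
qed

text \<open>Without \<open>u\<close> there remain \<open>A1\<close>, \<open>A2\<close> and the side
  of \<open>v\<close>; without \<open>v\<close> there remain \<open>B1\<close>, \<open>B2\<close>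
  and the side of \<open>u\<close>. A single matrix makes 1 a common eigenvalue of the first three
  and 0 one of the last three, and each loses one of three dimensions. The diagonal entries at
  \<open>u\<close> and \<open>v\<close> are free to serve both demands.\<close>

lemma deficient_adjacent_branchings:
  assumes V: "finite V" "V = insert u (A1 \<union> A2) \<union> insert v (B1 \<union> B2)"
    and ne: "A1 \<noteq> {}" "A2 \<noteq> {}" "B1 \<noteq> {}" "B2 \<noteq> {}"
    and sep: "sep A1 A2" "sep B1 B2" "sep (A1 \<union> A2) (insert v (B1 \<union> B2))" "sep (B1 \<union> B2) (insert u (A1 \<union> A2))"
    and uv: "u \<noteq> v" "u \<notin> A1 \<union> A2" "v \<notin> B1 \<union> B2"
  shows "deficient V"
proof -
  let ?U = "insert u (A1 \<union> A2)" and ?W = "insert v (B1 \<union> B2)"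
  have fin: "finite A1" "finite A2" "finite B1" "finite B2" using V by auto
  obtain a1 where a1: "realizes E A1 a1" "1 \<in> eigs A1 a1" "solvable A1 a1 0"
    using eigenvalue_one_solvable_zero[OF fin(1) ne(1)] .
  obtain a2 where a2: "realizes E A2 a2" "1 \<in> eigs A2 a2" "solvable A2 a2 0"
    using eigenvalue_one_solvable_zero[OF fin(2) ne(2)] .
  obtain b1 where b1: "realizes E B1 b1" "1 \<in> eigs B1 b1" "solvable B1 b1 0"
    using eigenvalue_one_solvable_zero[OF fin(3) ne(3)] .
  obtain b2 where b2: "realizes E B2 b2" "1 \<in> eigs B2 b2" "solvable B2 b2 0"
    using eigenvalue_one_solvable_zero[OF fin(4) ne(4)] .
  obtain a where a: "realizes E (A1 \<union> A2) a" "agree A1 a a1" "agree A2 a a2"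
    by (rule realizes_glue[OF a1(1) a2(1)]) (use sep in \<open>auto simp: sep_def\<close>)
  obtain b where b: "realizes E (B1 \<union> B2) b" "agree B1 b b1" "agree B2 b b2"
    by (rule realizes_glue[OF b1(1) b2(1)]) (use sep in \<open>auto simp: sep_def\<close>)
  \<comment> \<open>The branches at \<open>u\<close> have eigenvalue 1 but not 0, so the entry at
    \<open>u\<close> can create the eigenvalue 0 of the whole side.\<close>
  have "solvable (A1 \<union> A2) a 0"
    by (rule solvable_join[OF _ a(1)]) (use fin sep a a1 a2 in \<open>auto simp: solvable_agree\<close>)
  then obtain c where c: "realizes E ?U c" "agree (A1 \<union> A2) c a" "0 \<in> eigs ?U c"
    using border_eigenvalue[OF _ uv(2) a(1)] fin by blast
  have sb: "solvable (B1 \<union> B2) b 0"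
    by (rule solvable_join[OF _ b(1)]) (use fin sep b b1 b2 in \<open>auto simp: solvable_agree\<close>)
  \<comment> \<open>The map 1 - x exchanges the roles of the eigenvalues 0 and 1 on the side of
    \<open>v\<close>.\<close>
  let ?b = "affine (- 1) 1 b"
  have "solvable (B1 \<union> B2) ?b 1"
    using solvable_affine[OF _ sb, of "- 1" 1] fin by simp
  then obtain d where d: "realizes E ?W d" "agree (B1 \<union> B2) d ?b" "1 \<in> eigs ?W d"
    using border_eigenvalue[OF _ uv(3) realizes_affine[OF b(1)], of "- 1" 1] fin by auto
  obtain m where m: "realizes E V m" "agree ?U m c" "agree ?W m d"
    by (rule realizes_two[OF c(1) d(1), where V = V])
      (use V uv sep in \<open>auto simp: sep_def\<close>)
  have m1: "1 \<in> eigs A1 m" "1 \<in> eigs A2 m"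
    using m(2) c(2) a a1(2) a2(2) eigs_agree[of A1 m a1] eigs_agree[of A2 m a2]
    by (auto simp: agree_def)
  have "0 \<in> eigs B1 ?b" "0 \<in> eigs B2 ?b"
    using eigs_affine[of B1 1 b "- 1" 1] eigs_affine[of B2 1 b "- 1" 1] fin b b1(2) b2(2)
    by (auto simp: eigs_agree)
  then have m0: "0 \<in> eigs B1 m" "0 \<in> eigs B2 m"
    using m(3) d(2) eigs_agree[of B1 m ?b] eigs_agree[of B2 m ?b]
    by (auto simp: agree_def)
  have mU: "0 \<in> eigs ?U m" and mW: "1 \<in> eigs ?W m"
    using eigs_agree[OF m(2)] eigs_agree[OF m(3)] c(3) d(3) by auto
  have "eigdim_gt (A1 \<union> A2 \<union> ?W) m 1 2"
    by (rule eigdim_gt_2_join[OF V(1) m(1)]) (use V sep m1 mW in \<open>auto simp: sep_Un\<close>)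
  then have "eigdim_gt (insert u (A1 \<union> A2 \<union> ?W)) m 1 1"
    by (intro eigdim_gt_insert) (use fin sep uv in \<open>auto simp: sep_def numeral_2_eq_2\<close>)
  moreover have "insert u (A1 \<union> A2 \<union> ?W) = V" using V(2) by auto
  moreover have "eigdim_gt (B1 \<union> B2 \<union> ?U) m 0 2"
    by (rule eigdim_gt_2_join[OF V(1) m(1)]) (use V sep m0 mU in \<open>auto simp: sep_Un\<close>)
  then have "eigdim_gt (insert v (B1 \<union> B2 \<union> ?U)) m 0 1"
    by (intro eigdim_gt_insert) (use fin sep uv in \<open>auto simp: sep_def numeral_2_eq_2\<close>)
  moreover have "insert v (B1 \<union> B2 \<union> ?U) = V" using V(2) by auto
  ultimately show ?thesis using m(1) by (intro deficientI_doubles[of V m 0 1]) auto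
qed

text \<open>
  The triangle \<open>x y z\<close> contributes a matrix of rank one, which destroys only one dimension of the
  eigenspaces that the three parts share.
\<close>

lemma deficient_triangle_big_parts:
  assumes V: "finite V" "V = X \<union> Y \<union> Z" "X \<inter> Y = {}" "(X \<union> Y) \<inter> Z = {}"
    and card: "2 \<le> card X" "2 \<le> card Y" "2 \<le> card Z"
    and xyz: "x \<in> X" "y \<in> Y" "z \<in> Z"
    and XY: "\<And>p q. p \<in> X \<Longrightarrow> q \<in> Y \<Longrightarrow> E p q \<longleftrightarrow> p = x \<and> q = y"
    and XZ: "\<And>p q. p \<in> X \<Longrightarrow> q \<in> Z \<Longrightarrow> E p q \<longleftrightarrow> p = x \<and> q = z"
    and YZ: "\<And>p q. p \<in> Y \<Longrightarrow> q \<in> Z \<Longrightarrow> E p q \<longleftrightarrow> p = y \<and> q = z"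
  shows "deficient V"
proof -
  have fin: "finite X" "finite Y" "finite Z" using V by auto
  obtain b1 where b1: "realizes E X b1" "0 \<in> eigs X b1" "1 \<in> eigs X b1"
    using eigenvalues_zero_one[OF fin(1) card(1)] .
  obtain b2 where b2: "realizes E Y b2" "0 \<in> eigs Y b2" "1 \<in> eigs Y b2"
    using eigenvalues_zero_one[OF fin(2) card(2)] .
  obtain b3 where b3: "realizes E Z b3" "0 \<in> eigs Z b3" "1 \<in> eigs Z b3"
    using eigenvalues_zero_one[OF fin(3) card(3)] .
  define D where "D p q = (if p \<in> X \<and> q \<in> X then b1 p q else if p \<in> Y \<and> q \<in> Y then b2 p q
    else if p \<in> Z \<and> q \<in> Z then b3 p q else 0)" for p q
  define v where "v p = (if p = x \<or> p = y \<or> p = z then 1 else 0 :: real)" for p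
  have agree: "agree X D b1" "agree Y D b2" "agree Z D b3"
    using V(3,4) by (auto simp: agree_def D_def)
  have vX: "v p = of_bool (p = x)" if "p \<in> X" for p using that xyz V(3,4) by (auto simp: v_def)
  have vY: "v p = of_bool (p = y)" if "p \<in> Y" for p using that xyz V(3,4) by (auto simp: v_def)
  have vZ: "v p = of_bool (p = z)" if "p \<in> Z" for p using that xyz V(3,4) by (auto simp: v_def)
  have D0: "D p q = 0 \<and> D q p = 0" if "p \<in> X \<and> q \<in> Y \<or> p \<in> X \<union> Y \<and> q \<in> Z" for p q
    using that V(3,4) by (auto simp: D_def)
  \<comment> \<open>Inside each part \<open>v\<close> has a single nonzero entry, so the rank-one
    term changes one diagonal entry there; between different parts it produces exactly the edges of
    the triangle.\<close>
  have entry: "D p q + v p * v q = D q p + v q * v p \<and> (p \<noteq> q \<longrightarrow> (D p q + v p * v q \<noteq> 0 \<longleftrightarrow> E p q))"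
    if pq: "p \<in> V" "q \<in> V" for p q
  proof -
    consider "p \<in> X" "q \<in> X" | "p \<in> Y" "q \<in> Y" | "p \<in> Z" "q \<in> Z"
      | "p \<in> X" "q \<in> Y" | "p \<in> Y" "q \<in> X" | "p \<in> X" "q \<in> Z" | "p \<in> Z" "q \<in> X"
      | "p \<in> Y" "q \<in> Z" | "p \<in> Z" "q \<in> Y"
      using pq V(2) by blast
    then show ?thesis
    proof cases
      case pq: 1
      then have "D p q = b1 p q" "D q p = b1 p q" "p \<noteq> q \<Longrightarrow> b1 p q \<noteq> 0 \<longleftrightarrow> E p q"
        using agree(1) b1(1) by (simp_all add: agree_def realizes_def sym_on_def)
      moreover have "v p = 0 \<or> v q = 0" if "p \<noteq> q" using that vX vY vZ pq by auto
      ultimately show ?thesis by (cases "p = q") auto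
    next
      case pq: 2
      then have "D p q = b2 p q" "D q p = b2 p q" "p \<noteq> q \<Longrightarrow> b2 p q \<noteq> 0 \<longleftrightarrow> E p q"
        using agree(2) b2(1) by (simp_all add: agree_def realizes_def sym_on_def)
      moreover have "v p = 0 \<or> v q = 0" if "p \<noteq> q" using that vX vY vZ pq by auto
      ultimately show ?thesis by (cases "p = q") auto
    next
      case pq: 3
      then have "D p q = b3 p q" "D q p = b3 p q" "p \<noteq> q \<Longrightarrow> b3 p q \<noteq> 0 \<longleftrightarrow> E p q"
        using agree(3) b3(1) by (simp_all add: agree_def realizes_def sym_on_def)
      moreover have "v p = 0 \<or> v q = 0" if "p \<noteq> q" using that vX vY vZ pq by auto
      ultimately show ?thesis by (cases "p = q") auto
    next
      case 4 then show ?thesis using D0[of p q] XY[of p q] by (simp add: vX vY)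
    next
      case pq: 5
      then have "E p q \<longleftrightarrow> q = x \<and> p = y" using XY[of q p] E_sym by blast
      then show ?thesis using pq D0[of q p] by (simp add: vX vY conj_commute)
    next
      case 6 then show ?thesis using D0[of p q] XZ[of p q] by (simp add: vX vZ)
    next
      case pq: 7
      then have "E p q \<longleftrightarrow> q = x \<and> p = z" using XZ[of q p] E_sym by blast
      then show ?thesis using pq D0[of q p] by (simp add: vX vZ conj_commute)
    next
      case 8 then show ?thesis using D0[of p q] YZ[of p q] by (simp add: vY vZ)
    next
      case pq: 9
      then have "E p q \<longleftrightarrow> q = y \<and> p = z" using YZ[of q p] E_sym by blast
      then show ?thesis using pq D0[of q p] by (simp add: vY vZ conj_commute)
    qed
  qed
  then have real: "realizes E V (\<lambda>p q. D p q + v p * v q)"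
    by (auto simp: realizes_def sym_on_def)
  have "eigdim_gt V (\<lambda>p q. D p q + v p * v q) l 1" if "l = 0 \<or> l = 1" for l
  proof -
    have l: "eigdim_gt X D l 0" "eigdim_gt Y D l 0" "eigdim_gt Z D l 0"
      using that b1 b2 b3 eigs_agree[OF agree(1)] eigs_agree[OF agree(2)] eigs_agree[OF agree(3)]
      by (auto simp: eigdim_gt_0)
    have "eigdim_gt (X \<union> Y) D l (0 + 0 + 1)"
      by (rule eigdim_gt_add) (use fin V(3) D0 l in auto)
    then have "eigdim_gt (X \<union> Y \<union> Z) D l (1 + 0 + 1)"
      by (intro eigdim_gt_add) (use fin V(4) D0 l in auto)
    then show ?thesis unfolding V(2) by (intro eigdim_gt_rank_one_update) simp
  qed
  with real show ?thesis by (intro deficientI_doubles[of V _ 0 1]) auto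
qed

text \<open>A kernel of dimension two contains a nonzero vector that vanishes at \<open>v\<close>;
  the vector \<open>h\<close> completes it orthogonally and may be nonzero at
  \<open>v\<close>.\<close>

lemma kernel_basis:
  assumes "finite X" "v \<in> X" "eigdim_gt X a 0 1"
  obtains g h where "eigf X a 0 g" "nonzero_on X g" "g v = 0" "eigf X a 0 h" "nonzero_on X h" "dot X g h = 0"
proof -
  obtain g where g: "eigf X a 0 g" "nonzero_on X g" "dot X (\<lambda>x. if x = v then 1 else 0) g = 0"
    using assms(3)[unfolded eigdim_gt_def, rule_format, of "\<lambda>_ x. if x = v then 1 else 0"] by auto
  obtain h where h: "eigf X a 0 h" "nonzero_on X h" "dot X g h = 0"
    using assms(3)[unfolded eigdim_gt_def, rule_format, of "\<lambda>_. g"] by auto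
  show ?thesis using that[of g h] g h dot_delta[OF assms(1,2), of g] by simp
qed

text \<open>The two matrices overlap only in the diagonal entry at \<open>v\<close>, where they are
  added. Kernel vectors of the parts that agree at \<open>v\<close> glue to a kernel vector of the
  sum, and this single condition leaves dimension 2 + 2 - 1.\<close>

lemma deficient_one_sum:
  assumes V: "finite V" "V = V1 \<union> V2" "V1 \<inter> V2 = {v}"
    and no: "\<And>x y. x \<in> V1 - {v} \<Longrightarrow> y \<in> V2 - {v} \<Longrightarrow> \<not> E x y"
    and doubly_singular: "doubly_singular V1" "doubly_singular V2"
  shows "deficient V"
proof -
  have fin: "finite V1" "finite V2" and v: "v \<in> V1" "v \<in> V2" using V by auto
  obtain a1 where a1: "realizes E V1 a1" "eigdim_gt V1 a1 0 1" using doubly_singular(1) by (auto simp: doubly_singular_def)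
  obtain a2 where a2: "realizes E V2 a2" "eigdim_gt V2 a2 0 1" using doubly_singular(2) by (auto simp: doubly_singular_def)
  define A where "A p q = (if p \<in> V1 \<and> q \<in> V1 then a1 p q else 0) + (if p \<in> V2 \<and> q \<in> V2 then a2 p q else 0)" for p q
  have no': "\<not> E x y" if "y \<in> V1 - {v}" "x \<in> V2 - {v}" for x y
    using no[OF that] E_sym by blast
  have real: "realizes E V A"
    unfolding realizes_def sym_on_def
  proof (intro conjI ballI impI)
    fix x y assume xy: "x \<in> V" "y \<in> V"
    show "A x y = A y x"
      using a1(1) a2(1) by (auto simp: A_def realizes_def sym_on_def)
    assume ne: "x \<noteq> y"
    have "\<not> (x \<in> V1 \<inter> V2 \<and> y \<in> V1 \<inter> V2)" using ne V(3) by auto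
    then consider "x \<in> V1" "y \<in> V1" "\<not> (x \<in> V2 \<and> y \<in> V2)" | "x \<in> V2" "y \<in> V2" "\<not> (x \<in> V1 \<and> y \<in> V1)"
      | "x \<in> V1" "y \<in> V2" "x \<notin> V2" "y \<notin> V1" | "y \<in> V1" "x \<in> V2" "y \<notin> V2" "x \<notin> V1"
      using xy V(2) by blast
    then show "A x y \<noteq> 0 \<longleftrightarrow> E x y"
    proof cases
      case 1 then show ?thesis using a1(1) ne by (auto simp: A_def realizes_def)
    next
      case 2 then show ?thesis using a2(1) ne by (auto simp: A_def realizes_def)
    next
      case 3 then show ?thesis using no[of x y] v by (auto simp: A_def)
    next
      case 4 then show ?thesis using no'[of y x] v by (auto simp: A_def)
    qed
  qed
  have mvA: "mv V A f p = (if p \<in> V1 then mv V1 a1 f p else 0) + (if p \<in> V2 then mv V2 a2 f p else 0)" for f p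
  proof -
    have "mv V A f p = mv V (\<lambda>p q. if p \<in> V1 \<and> q \<in> V1 then a1 p q else 0) f p
      + mv V (\<lambda>p q. if p \<in> V2 \<and> q \<in> V2 then a2 p q else 0) f p"
      by (simp add: mv_def A_def algebra_simps sum.distrib)
    also have "mv V (\<lambda>p q. if p \<in> V1 \<and> q \<in> V1 then a1 p q else 0) f p
      = mv V1 (\<lambda>p q. if p \<in> V1 \<and> q \<in> V1 then a1 p q else 0) f p"
      using V by (intro mv_supp) auto
    also have "\<dots> = (if p \<in> V1 then mv V1 a1 f p else 0)" by (simp add: mv_def)
    also have "mv V (\<lambda>p q. if p \<in> V2 \<and> q \<in> V2 then a2 p q else 0) f p
      = mv V2 (\<lambda>p q. if p \<in> V2 \<and> q \<in> V2 then a2 p q else 0) f p"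
      using V by (intro mv_supp) auto
    also have "\<dots> = (if p \<in> V2 then mv V2 a2 f p else 0)" by (simp add: mv_def)
    finally show ?thesis .
  qed
  have eigA: "eigf V A 0 f" if "eigf V1 a1 0 f" "eigf V2 a2 0 f" for f
    using that by (auto simp: eigf_def mvA)
  obtain g1 h1 where 1: "eigf V1 a1 0 g1" "nonzero_on V1 g1" "g1 v = 0" "eigf V1 a1 0 h1" "nonzero_on V1 h1" "dot V1 g1 h1 = 0"
    using kernel_basis[OF fin(1) v(1) a1(2)] .
  obtain g2 h2 where 2: "eigf V2 a2 0 g2" "nonzero_on V2 g2" "g2 v = 0" "eigf V2 a2 0 h2" "nonzero_on V2 h2" "dot V2 g2 h2 = 0"
    using kernel_basis[OF fin(2) v(2) a2(2)] .
  define ext where "ext X f x = (if x \<in> X then f x else 0 :: real)" for X :: "'a set" and f x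
  have zero: "eigf X a 0 f" if "\<And>x. x \<in> X \<Longrightarrow> f x = 0" for X and a :: "'a \<Rightarrow> 'a \<Rightarrow> real" and f
    using that by (simp add: eigf_def mv_def)
  have common: "x = v" if "x \<in> V1" "x \<in> V2" for x using that V(3) by blast
  have ext1: "eigf V1 a1 0 (ext V1 f) \<and> eigf V2 a2 0 (ext V1 f)" if "eigf V1 a1 0 f" "f v = 0" for f
    using that eigf_cong[of V1 a1 a1 "ext V1 f" f] by (auto simp: ext_def intro!: zero dest: common)
  have ext2: "eigf V1 a1 0 (ext V2 f) \<and> eigf V2 a2 0 (ext V2 f)" if "eigf V2 a2 0 f" "f v = 0" for f
    using that eigf_cong[of V2 a2 a2 "ext V2 f" f] by (auto simp: ext_def intro!: zero dest: common)
  \<comment> \<open>The vectors \<open>g1\<close> and \<open>g2\<close> vanish at \<open>v\<close>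
    and extend by zero. The third vector is \<open>h1\<close> or \<open>h2\<close> if one of them
    vanishes at \<open>v\<close>; otherwise both are scaled to 1 at \<open>v\<close> and
    glued.\<close>
  have "\<exists>H. eigf V1 a1 0 H \<and> eigf V2 a2 0 H \<and> nonzero_on V H \<and> dot V1 g1 H = 0 \<and> dot V2 g2 H = 0"
  proof -
    consider "h1 v = 0" | "h2 v = 0" | "h1 v \<noteq> 0" "h2 v \<noteq> 0" by blast
    then show ?thesis
    proof cases
      case c: 1
      have "dot V1 g1 (ext V1 h1) = 0" using 1(6) by (simp add: dot_def ext_def)
      moreover have "dot V2 g2 (ext V1 h1) = 0"
        unfolding dot_def by (rule sum.neutral) (use V(3) c in \<open>auto simp: ext_def\<close>)
      moreover have "nonzero_on V (ext V1 h1)" using 1(5) V(2) by (auto simp: nonzero_on_def ext_def)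
      ultimately show ?thesis using ext1[OF 1(4) c] by blast
    next
      case c: 2
      have "dot V2 g2 (ext V2 h2) = 0" using 2(6) by (simp add: dot_def ext_def)
      moreover have "dot V1 g1 (ext V2 h2) = 0"
        unfolding dot_def by (rule sum.neutral) (use V(3) c in \<open>auto simp: ext_def\<close>)
      moreover have "nonzero_on V (ext V2 h2)" using 2(5) V(2) by (auto simp: nonzero_on_def ext_def)
      ultimately show ?thesis using ext2[OF 2(4) c] by blast
    next
      case c: 3
      define H where "H x = (if x \<in> V1 then 1 / h1 v * h1 x else 1 / h2 v * h2 x)" for x
      have H1: "H x = 1 / h1 v * h1 x" if "x \<in> V1" for x using that by (simp add: H_def)
      have H2: "H x = 1 / h2 v * h2 x" if "x \<in> V2" for x using that V(3) c by (cases "x = v") (auto simp: H_def)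
      have "eigf V1 a1 0 H" using eigf_scale[OF 1(4), of "1 / h1 v"] eigf_cong[of V1 a1 a1 H] H1 by metis
      moreover have "eigf V2 a2 0 H" using eigf_scale[OF 2(4), of "1 / h2 v"] eigf_cong[of V2 a2 a2 H] H2 by metis
      moreover have "dot V1 g1 H = 0"
        using 1(6) dot_scale[of V1 g1 "1 / h1 v" h1] by (subst dot_cong[OF refl H1]) auto
      moreover have "dot V2 g2 H = 0"
        using 2(6) dot_scale[of V2 g2 "1 / h2 v" h2] by (subst dot_cong[OF refl H2]) auto
      moreover have "nonzero_on V H" using H1[OF v(1)] c v(1) V(2) unfolding nonzero_on_def by (intro bexI[of _ v]) auto
      ultimately show ?thesis by blast
    qed
  qed
  then obtain H where H: "eigf V1 a1 0 H" "eigf V2 a2 0 H" "nonzero_on V H" "dot V1 g1 H = 0" "dot V2 g2 H = 0"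
    by blast
  have "eigdim_gt V A 0 2"
  proof (rule eigdim_gt_2I[OF V(1)])
    show "eigf V A 0 (ext V1 g1)" using ext1[OF 1(1,3)] eigA by blast
    show "eigf V A 0 (ext V2 g2)" using ext2[OF 2(1,3)] eigA by blast
    show "eigf V A 0 H" using H(1,2) eigA by blast
    show "nonzero_on V (ext V1 g1)" using 1(2) V(2) by (auto simp: nonzero_on_def ext_def)
    show "nonzero_on V (ext V2 g2)" using 2(2) V(2) by (auto simp: nonzero_on_def ext_def)
    show "nonzero_on V H" by fact
    show "dot V (ext V1 g1) (ext V2 g2) = 0"
      unfolding dot_def by (rule sum.neutral) (use V(3) 1(3) in \<open>auto simp: ext_def\<close>)
    have "dot V (ext V1 g1) H = dot V1 (ext V1 g1) H" using V by (intro dot_supp) (auto simp: ext_def)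
    also have "\<dots> = dot V1 g1 H" by (simp add: dot_def ext_def)
    finally show "dot V (ext V1 g1) H = 0" using H(4) by simp
    have "dot V (ext V2 g2) H = dot V2 (ext V2 g2) H" using V by (intro dot_supp) (auto simp: ext_def)
    also have "\<dots> = dot V2 g2 H" by (simp add: dot_def ext_def)
    finally show "dot V (ext V2 g2) H = 0" using H(5) by simp
  qed
  with real show ?thesis by (rule deficientI_triple)
qed

end

section \<open>Laplacians and vertices with several neighbours in a branch\<close>

definition wlap :: "'a set \<Rightarrow> ('a \<Rightarrow> 'a \<Rightarrow> real) \<Rightarrow> ('a \<Rightarrow> real) \<Rightarrow> 'a \<Rightarrow> real" where
  "wlap K w s x = (\<Sum>y\<in>K. w x y * (s x - s y))"

definition energy :: "'a set \<Rightarrow> ('a \<Rightarrow> 'a \<Rightarrow> real) \<Rightarrow> ('a \<Rightarrow> real) \<Rightarrow> real" where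
  "energy K w s = (\<Sum>x\<in>K. \<Sum>y\<in>K. w x y * (s x - s y)\<^sup>2)"

lemma dot_wlap:
  assumes "sym_on K w"
  shows "dot K s (wlap K w s) = energy K w s / 2"
proof -
  have "dot K s (wlap K w s) = (\<Sum>x\<in>K. \<Sum>y\<in>K. w x y * (s x - s y) * s x)" (is "_ = ?A")
    by (simp add: dot_def wlap_def sum_distrib_left algebra_simps)
  moreover have "?A = (\<Sum>x\<in>K. \<Sum>y\<in>K. w x y * (s y - s x) * s y)"
    by (subst sum.swap) (use assms in \<open>auto simp: sym_on_def intro!: sum.cong\<close>)
  ultimately have "2 * dot K s (wlap K w s)
    = (\<Sum>x\<in>K. \<Sum>y\<in>K. w x y * (s x - s y) * s x + w x y * (s y - s x) * s y)"
    by (simp add: sum.distrib)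
  also have "\<dots> = energy K w s"
    unfolding energy_def by (intro sum.cong refl) (simp add: power2_eq_square algebra_simps)
  finally show ?thesis by simp
qed

lemma sum_wlap:
  assumes "sym_on K w"
  shows "(\<Sum>x\<in>K. wlap K w s x) = 0"
proof -
  have "(\<Sum>x\<in>K. wlap K w s x) = (\<Sum>x\<in>K. \<Sum>y\<in>K. w x y * (s y - s x))"
    unfolding wlap_def by (subst sum.swap) (use assms in \<open>auto simp: sym_on_def intro!: sum.cong\<close>)
  also have "\<dots> = - (\<Sum>x\<in>K. wlap K w s x)"
    by (simp add: wlap_def sum_negf[symmetric] algebra_simps)
  finally show ?thesis by simp
qed

text \<open>If the energy is positive except on constants, adding the all-ones matrix makes the
  Laplacian injective, hence surjective; summing up the equations shows that the solution for a
  \<open>c\<close> of sum zero has sum zero itself. Definiteness is assumed instead of positive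
  weights because the lemma is also applied to weights of both signs.\<close>

lemma wlap_solve:
  assumes K: "finite K" and w: "sym_on K w"
    and definite: "\<And>s x y. energy K w s \<le> 0 \<Longrightarrow> x \<in> K \<Longrightarrow> y \<in> K \<Longrightarrow> s x = s y"
    and c: "(\<Sum>x\<in>K. c x) = 0"
  obtains s where "\<forall>x\<in>K. wlap K w s x = c x" "nonzero_on K c \<longrightarrow> 0 < dot K c s"
proof -
  define b where "b x y = (if x = y then \<Sum>z\<in>K. w x z else 0) - w x y + 1" for x y
  have b: "mv K b s x = wlap K w s x + (\<Sum>y\<in>K. s y)" if "x \<in> K" for s x
  proof -
    have "mv K b s x = (\<Sum>y\<in>K. (if x = y then (\<Sum>z\<in>K. w x z) * s y else 0) - w x y * s y + s y)"
      unfolding mv_def b_def by (intro sum.cong) (auto simp: algebra_simps)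
    also have "\<dots> = (\<Sum>z\<in>K. w x z) * s x - (\<Sum>y\<in>K. w x y * s y) + (\<Sum>y\<in>K. s y)"
      using K that by (simp add: sum.distrib sum_subtractf)
    also have "(\<Sum>z\<in>K. w x z) * s x - (\<Sum>y\<in>K. w x y * s y) = wlap K w s x"
      by (simp add: wlap_def algebra_simps sum_subtractf sum_distrib_left)
    finally show ?thesis .
  qed
  have inj: "\<not> nonzero_on K s" if "\<And>x. x \<in> K \<Longrightarrow> mv K b s x = 0" for s
  proof -
    have "0 = dot K s (mv K b s)" using that by (simp add: dot_def)
    also have "\<dots> = dot K s (wlap K w s) + dot K s (\<lambda>_. \<Sum>y\<in>K. s y)"
      by (subst dot_add[symmetric]) (rule dot_cong, use b in auto)
    also have "dot K s (\<lambda>_. \<Sum>y\<in>K. s y) = (\<Sum>y\<in>K. s y)\<^sup>2"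
      by (simp add: dot_def sum_distrib_right[symmetric] power2_eq_square)
    finally have "energy K w s = - 2 * (\<Sum>y\<in>K. s y)\<^sup>2" using dot_wlap[OF w, of s] by simp
    then have en: "energy K w s \<le> 0" "energy K w s = - 2 * (\<Sum>y\<in>K. s y)\<^sup>2" by auto
    note const = definite[OF en(1)]
    have "energy K w s = 0"
      unfolding energy_def
    proof (intro sum.neutral ballI)
      fix x y assume "x \<in> K" "y \<in> K"
      from const[OF this] show "w x y * (s x - s y)\<^sup>2 = 0" by simp
    qed
    with en(2) have "(\<Sum>y\<in>K. s y) = 0" by simp
    moreover have "(\<Sum>y\<in>K. s y) = real (card K) * s x" if "x \<in> K" for x
      using const[OF _ that] by simp
    ultimately show ?thesis using K by (fastforce simp: nonzero_on_def)
  qed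
  obtain s where s: "\<forall>x\<in>K. mv K b s x = c x"
    using injective_imp_surjective[OF K inj, where c = c] by blast
  have "(\<Sum>x\<in>K. mv K b s x) = (\<Sum>x\<in>K. wlap K w s x) + real (card K) * (\<Sum>y\<in>K. s y)"
    using b by (simp add: sum.distrib)
  then have "real (card K) * (\<Sum>y\<in>K. s y) = 0" using s c sum_wlap[OF w] by simp
  then have "(\<Sum>y\<in>K. s y) = 0" using K by auto
  then have 1: "wlap K w s x = c x" if "x \<in> K" for x using b[OF that, of s] s that by simp
  \<comment> \<open>The product is half the energy of \<open>s\<close>, so it is positive unless
    \<open>s\<close> is constant, and then \<open>c\<close> would vanish.\<close>
  have "0 < dot K c s" if "nonzero_on K c"
  proof (rule ccontr)
    assume "\<not> 0 < dot K c s"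
    moreover have "dot K c s = dot K s (wlap K w s)"
      using 1 by (subst dot_commute) (auto intro: dot_cong)
    ultimately have en: "energy K w s \<le> 0" using dot_wlap[OF w] by simp
    have "wlap K w s x = 0" if "x \<in> K" for x
      unfolding wlap_def
    proof (intro sum.neutral ballI)
      fix y assume "y \<in> K"
      from definite[OF en that this] show "w x y * (s x - s y) = 0" by simp
    qed
    with 1 that show False by (auto simp: nonzero_on_def)
  qed
  with 1 show ?thesis using that by blast
qed

text \<open>The value at \<open>p\<close> balances ones at all other points of \<open>P\<close>, and
  \<open>q\<close> ensures that it is nonzero.\<close>

lemma balanced_vector:
  assumes "finite K" "p \<in> K" "q \<in> K" "p \<noteq> q" "P p" "P q"
  obtains c :: "'a \<Rightarrow> real" where "\<And>x. x \<in> K \<Longrightarrow> c x \<noteq> 0 \<longleftrightarrow> P x" "(\<Sum>x\<in>K. c x) = 0"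
proof -
  define N where "N = {x \<in> K - {p}. P x}"
  define c where "c x = (if x = p then - real (card N) else of_bool (P x))" for x
  have "q \<in> N" "finite N" using assms by (auto simp: N_def)
  then have "card N \<noteq> 0" by auto
  then have "c x \<noteq> 0 \<longleftrightarrow> P x" if "x \<in> K" for x using assms(5) by (auto simp: c_def)
  moreover have "(\<Sum>x\<in>K - {p}. c x) = real (card N)"
  proof -
    have "(\<Sum>x\<in>K - {p}. c x) = (\<Sum>x\<in>K - {p}. if P x then 1 else 0)"
      by (intro sum.cong) (auto simp: c_def)
    also have "\<dots> = real (card N)" using assms(1) by (simp add: N_def flip: sum.inter_filter)
    finally show ?thesis .
  qed
  then have "(\<Sum>x\<in>K. c x) = 0" using assms(1,2) by (simp add: sum.remove[of K p] c_def)
  ultimately show ?thesis using that by blast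
qed

text \<open>On three points \<open>c\<close> is, up to sign, the cross product of (1, 1, 1) and
  \<rho>, whose entries are nonzero because \<rho> is injective. A further point is brought in by
  adding a multiple of such a vector \<tau> on three points.\<close>

lemma doubly_balanced_vector:
  fixes \<rho> :: "'a \<Rightarrow> real"
  assumes "finite N" "3 \<le> card N" "inj_on \<rho> N"
  shows "\<exists>c :: 'a \<Rightarrow> real. (\<forall>x\<in>N. c x \<noteq> 0) \<and> (\<Sum>x\<in>N. c x) = 0 \<and> (\<Sum>x\<in>N. c x * \<rho> x) = 0"
  using assms
proof (induction N rule: finite_induct)
  case empty
  then show ?case by simp
next
  case (insert x N)
  have inj: "inj_on \<rho> N" using insert.prems(2) by auto
  show ?case
  proof (cases "3 \<le> card N")
    case False
    then have "card N = 2" using insert by simp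
    then obtain p q where N: "N = {p, q}" "p \<noteq> q" by (auto simp: card_2_iff)
    define c where "c y = (if y = x then \<rho> p - \<rho> q else if y = p then \<rho> q - \<rho> x else \<rho> x - \<rho> p)" for y
    have "x \<noteq> p" "x \<noteq> q" using insert N by auto
    then show ?thesis
      using N insert.prems(2) by (intro exI[of _ c]) (auto simp: c_def inj_on_def algebra_simps)
  next
    case True
    then obtain c where c: "\<And>y. y \<in> N \<Longrightarrow> c y \<noteq> 0" "(\<Sum>y\<in>N. c y) = 0" "(\<Sum>y\<in>N. c y * \<rho> y) = 0"
      using insert.IH inj by blast
    obtain p q where pq: "p \<in> N" "q \<in> N" "p \<noteq> q"
      using True by (metis One_nat_def Suc_le_eq card_le_Suc0_iff_eq insert.hyps(1) le_trans not_le numeral_3_eq_3 lessI less_imp_le)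
    have ne: "x \<noteq> p" "x \<noteq> q" using insert pq by auto
    define \<tau> where "\<tau> y = (if y = x then \<rho> p - \<rho> q else if y = p then \<rho> q - \<rho> x else if y = q then \<rho> x - \<rho> p else 0)" for y
    have \<tau>: "\<tau> x \<noteq> 0" "\<tau> p \<noteq> 0" "\<tau> q \<noteq> 0"
      using ne pq insert.prems(2) by (auto simp: \<tau>_def inj_on_def)
    \<comment> \<open>Finitely many multiples are excluded so that no entry at \<open>x\<close>,
      \<open>p\<close> or \<open>q\<close> becomes zero.\<close>
    obtain \<delta> where \<delta>: "\<delta> \<notin> {0, - c p / \<tau> p, - c q / \<tau> q}"
      using ex_new_if_finite[of "{0, - c p / \<tau> p, - c q / \<tau> q}"] infinite_UNIV_char_0 by auto
    define d where "d y = (if y = x then 0 else c y) + \<delta> * \<tau> y" for y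
    have "d y \<noteq> 0" if y: "y \<in> insert x N" for y
    proof -
      consider "y = x" | "y = p" | "y = q" | "y \<in> N" "y \<noteq> x" "y \<noteq> p" "y \<noteq> q" using y by blast
      then show ?thesis
      proof cases
        case 1 then show ?thesis using \<tau> \<delta> by (simp add: d_def)
      next
        case 2 then show ?thesis using \<tau> \<delta> ne by (auto simp: d_def field_simps)
      next
        case 3 then show ?thesis using \<tau> \<delta> ne by (auto simp: d_def field_simps)
      next
        case 4 then show ?thesis using c(1) by (simp add: d_def \<tau>_def)
      qed
    qed
    moreover have sum\<tau>: "(\<Sum>y\<in>insert x N. \<tau> y * f y) = \<tau> x * f x + \<tau> p * f p + \<tau> q * f q" for f :: "'a \<Rightarrow> real"
    proof -
      have "(\<Sum>y\<in>insert x N. \<tau> y * f y) = (\<Sum>y\<in>{x, p, q}. \<tau> y * f y)"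
        using insert.hyps pq by (intro sum.mono_neutral_right) (auto simp: \<tau>_def)
      then show ?thesis using ne pq by simp
    qed
    have sumc: "(\<Sum>y\<in>insert x N. d y * f y) = (\<Sum>y\<in>N. c y * f y) + \<delta> * (\<Sum>y\<in>insert x N. \<tau> y * f y)" for f :: "'a \<Rightarrow> real"
    proof -
      have "(\<Sum>y\<in>insert x N. d y * f y) = (\<Sum>y\<in>insert x N. (if y = x then 0 else c y) * f y) + \<delta> * (\<Sum>y\<in>insert x N. \<tau> y * f y)"
        by (simp only: d_def distrib_right sum.distrib sum_distrib_left mult.assoc)
      also have "(\<Sum>y\<in>insert x N. (if y = x then 0 else c y) * f y) = (\<Sum>y\<in>N. c y * f y)"
      proof -
        have "(\<Sum>y\<in>N. (if y = x then 0 else c y) * f y) = (\<Sum>y\<in>N. c y * f y)"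
          by (intro sum.cong) (use insert.hyps in auto)
        then show ?thesis using insert.hyps by simp
      qed
      finally show ?thesis .
    qed
    have "\<tau> x + \<tau> p + \<tau> q = 0" "\<tau> x * \<rho> x + \<tau> p * \<rho> p + \<tau> q * \<rho> q = 0"
      using ne pq by (auto simp: \<tau>_def algebra_simps)
    then have "(\<Sum>y\<in>insert x N. d y) = 0" "(\<Sum>y\<in>insert x N. d y * \<rho> y) = 0"
      using sumc[of "\<lambda>_. 1"] sum\<tau>[of "\<lambda>_. 1"] sumc[of \<rho>] sum\<tau>[of \<rho>] c(2,3) by auto
    ultimately show ?thesis by blast
  qed
qed

text \<open>Each step of a walk is bounded by the energy, and appending a step turns the constant
  \<open>C\<close> into 2 C + 2. The sum of the constants over all pairs is uniform. The inequality
  later lets a connected subgraph \<open>Q\<close> dominate small weights of the wrong sign.\<close>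

lemma poincare_inequality:
  assumes K: "finite K" and O: "\<And>x y. Q x y \<Longrightarrow> x \<in> K \<and> y \<in> K" "\<And>x y. x \<in> K \<Longrightarrow> y \<in> K \<Longrightarrow> Q\<^sup>*\<^sup>* x y"
  obtains C where "C \<ge> 0" "\<forall>x\<in>K. \<forall>y\<in>K. \<forall>s. (s x - s y)\<^sup>2 \<le> C * energy K (\<lambda>x y. of_bool (Q x y)) s"
proof -
  let ?D = "energy K (\<lambda>x y. of_bool (Q x y))"
  have D0: "0 \<le> ?D s" for s by (auto simp: energy_def intro!: sum_nonneg)
  have edge: "(s x - s y)\<^sup>2 \<le> ?D s" if "Q x y" for s x y
  proof -
    have "(s x - s y)\<^sup>2 = of_bool (Q x y) * (s x - s y)\<^sup>2" using that by simp
    also have "\<dots> \<le> (\<Sum>y\<in>K. of_bool (Q x y) * (s x - s y)\<^sup>2)"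
      using O(1)[OF that] K by (intro member_le_sum) auto
    also have "\<dots> \<le> ?D s"
      unfolding energy_def using O(1)[OF that] K by (intro member_le_sum) (auto intro: sum_nonneg)
    finally show ?thesis .
  qed
  have "\<exists>C\<ge>0. \<forall>s. (s x - s y)\<^sup>2 \<le> C * ?D s" if "Q\<^sup>*\<^sup>* x y" for x y
    using that
  proof induction
    case base
    then show ?case by (intro exI[of _ 0]) auto
  next
    case (step y z)
    then obtain C where C: "C \<ge> 0" "\<And>s. (s x - s y)\<^sup>2 \<le> C * ?D s" by blast
    have "(s x - s z)\<^sup>2 \<le> (2 * C + 2) * ?D s" for s
    proof -
      have "(s x - s z)\<^sup>2 \<le> 2 * (s x - s y)\<^sup>2 + 2 * (s y - s z)\<^sup>2"
        using sum_squares_bound[of "s x - s y" "s y - s z"] by (simp add: power2_eq_square algebra_simps)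
      also have "\<dots> \<le> 2 * (C * ?D s) + 2 * ?D s" using C(2)[of s] edge[OF step(2), of s] by simp
      finally show ?thesis by (simp add: algebra_simps)
    qed
    then show ?case using C(1) by (intro exI[of _ "2 * C + 2"]) auto
  qed
  then obtain c where c: "\<And>x y. x \<in> K \<Longrightarrow> y \<in> K \<Longrightarrow> c x y \<ge> 0"
    "\<And>x y s. x \<in> K \<Longrightarrow> y \<in> K \<Longrightarrow> (s x - s y)\<^sup>2 \<le> c x y * ?D s" using O(2) by metis
  let ?C = "\<Sum>x\<in>K. \<Sum>y\<in>K. c x y"
  have C0: "?C \<ge> 0" using c(1) by (intro sum_nonneg) auto
  have "(s x - s y)\<^sup>2 \<le> ?C * ?D s" if "x \<in> K" "y \<in> K" for x y s
  proof -
    have "c x y \<le> (\<Sum>y\<in>K. c x y)" using that K c(1) by (intro member_le_sum) auto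
    also have "\<dots> \<le> ?C" using that K c(1) by (intro member_le_sum sum_nonneg) (auto intro: sum_nonneg)
    finally have "c x y * ?D s \<le> ?C * ?D s" using D0 by (rule mult_right_mono)
    then show ?thesis using c(2)[OF that, of s] by simp
  qed
  with C0 show ?thesis using that by blast
qed

context sym_rel
begin

definition adj_on :: "'a set \<Rightarrow> 'a \<Rightarrow> 'a \<Rightarrow> bool" where
  "adj_on X x y \<longleftrightarrow> E x y \<and> x \<in> X \<and> y \<in> X"

definition conn :: "'a set \<Rightarrow> bool" where
  "conn X \<longleftrightarrow> (\<forall>x\<in>X. \<forall>y\<in>X. (adj_on X)\<^sup>*\<^sup>* x y)"

lemma mv_sep:
  assumes "finite V" "realizes E V a" "V = X \<union> Y" "sep X Y" "x \<in> X"
  shows "mv V a f x = mv X a f x"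
  by (rule mv_supp) (use assms realizes_sep[OF assms(2) _ _ assms(4)] in auto)

text \<open>On a connected graph the energy for unit weights vanishes on constants only, so
  \<open>wlap_solve\<close> applies to every right-hand side of sum zero.\<close>

lemma laplacian:
  assumes K: "finite K" "conn K"
  obtains a where "realizes E K a" "eigf K a 0 (\<lambda>_. 1)"
    "\<forall>c. (\<Sum>x\<in>K. c x) = 0 \<longrightarrow> (\<exists>g. \<forall>x\<in>K. mv K a g x = c x)"
proof -
  define w where "w x y = (of_bool (x \<noteq> y \<and> E x y) :: real)" for x y
  define a where "a x y = (if x = y then \<Sum>z\<in>K. w x z else 0) - w x y" for x y
  have w: "sym_on K w" using E_sym by (auto simp: sym_on_def w_def)
  have mv: "mv K a s x = wlap K w s x" if "x \<in> K" for s x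
  proof -
    have "mv K a s x = (\<Sum>y\<in>K. (if x = y then (\<Sum>z\<in>K. w x z) * s y else 0) - w x y * s y)"
      unfolding mv_def a_def by (intro sum.cong) (auto simp: algebra_simps)
    also have "\<dots> = (\<Sum>z\<in>K. w x z) * s x - (\<Sum>y\<in>K. w x y * s y)"
      using K that by (simp add: sum_subtractf)
    finally show ?thesis by (simp add: wlap_def algebra_simps sum_subtractf sum_distrib_left)
  qed
  have "realizes E K a"
    using w E_sym by (auto simp: realizes_def sym_on_def a_def w_def)
  moreover have "eigf K a 0 (\<lambda>_. 1)" by (simp add: eigf_def mv wlap_def)
  moreover have "\<exists>g. \<forall>x\<in>K. mv K a g x = c x" if "(\<Sum>x\<in>K. c x) = 0" for c
  proof -
    have "s x = s y" if en: "energy K w s \<le> 0" and xy: "x \<in> K" "y \<in> K" for s x y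
    proof -
      have nn: "0 \<le> w x y * (s x - s y)\<^sup>2" for x y by (simp add: w_def)
      have "0 \<le> energy K w s" unfolding energy_def by (intro sum_nonneg nn)
      with en have "energy K w s = 0" by simp
      then have 0: "w x y * (s x - s y)\<^sup>2 = 0" if "x \<in> K" "y \<in> K" for x y
        using that K nn by (auto simp: energy_def sum_nonneg_eq_0_iff sum_nonneg)
      have "s x = s y" if "(adj_on K)\<^sup>*\<^sup>* x y" for x y
        using that
      proof induction
        case (step y z)
        then show ?case using 0[of y z] by (cases "y = z") (auto simp: adj_on_def w_def)
      qed simp
      then show ?thesis using K(2) xy by (auto simp: conn_def)
    qed
    from wlap_solve[OF K(1) w this that] show ?thesis using mv by metis
  qed
  ultimately show ?thesis using that by blast
qed

text \<open>
  Two neighbours of \<open>u\<close> in the connected set \<open>K\<close> leave room for a vector with zero sum on the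
  neighbourhood of \<open>u\<close>, so the kernel of the Laplacian of \<open>K\<close> survives the addition of \<open>u\<close>; the
  diagonal entry at \<open>u\<close> then provides a second kernel vector.
\<close>

lemma double_zero_border:
  assumes W: "finite W" "W = K \<union> X" "u \<notin> W" "sep K X"
    and pq: "p \<in> K" "q \<in> K" "p \<noteq> q" "E u p" "E u q"
    and aK: "eigf K aK 0 (\<lambda>_. 1)" "\<forall>c. (\<Sum>x\<in>K. c x) = 0 \<longrightarrow> (\<exists>g. \<forall>x\<in>K. mv K aK g x = c x)"
    and aX: "solvable X aX 0"
    and a: "realizes E W a" "agree K a aK" "agree X a aX"
  obtains b where "realizes E (insert u W) b" "agree W b a" "eigdim_gt (insert u W) b 0 1"
proof -
  have fin: "finite K" "finite X" using W by auto
  have disj: "K \<inter> X = {}" using W(4) by (simp add: sep_def)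
  obtain c :: "'a \<Rightarrow> real" where c: "\<And>x. x \<in> K \<Longrightarrow> c x \<noteq> 0 \<longleftrightarrow> E u x" "(\<Sum>x\<in>K. c x) = 0"
    using balanced_vector[OF fin(1) pq] by blast
  \<comment> \<open>On \<open>K\<close> the balanced vector is orthogonal to the constants; on
    \<open>X\<close> any row will do, because \<open>aX\<close> can be solved at 0.\<close>
  define C where "C x = (if x \<in> K then c x else of_bool (E u x))" for x
  obtain g where g: "\<And>x. x \<in> K \<Longrightarrow> mv K aK g x = c x" using aK(2) c(2) by blast
  obtain h where h: "\<And>x. x \<in> X \<Longrightarrow> mv X aX h x = C x"
    using aX[unfolded solvable_def, rule_format, of C] by auto
  let ?g = "\<lambda>x. if x \<in> K then g x else h x" and ?z = "\<lambda>x. if x \<in> K then 1 else 0 :: real"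
  have K: "mv W a f x = mv K aK f x" if "x \<in> K" for f x
    using mv_sep[OF W(1) a(1) W(2,4) that] mv_agree[OF a(2) that] by simp
  have X: "mv W a f x = mv X aX f x" if "x \<in> X" for f x
    using mv_sep[OF W(1) a(1) _ sep_sym[OF W(4)] that] W(2) mv_agree[OF a(3) that] by (simp add: Un_commute)
  have cK: "mv K aK ?g x = mv K aK g x" "mv K aK ?z x = mv K aK (\<lambda>_. 1) x" for x
    by (auto intro: mv_cong)
  have cX: "mv X aX ?g x = mv X aX h x" "mv X aX ?z x = 0" for x
    using disj by (auto simp: mv_def intro!: sum.cong sum.neutral)
  have "mv W a ?g x - 0 * ?g x = C x" if "x \<in> W" for x
  proof (cases "x \<in> K")
    case True
    then show ?thesis by (simp add: K cK g C_def)
  next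
    case False
    then have "x \<in> X" using that W(2) by blast
    with False show ?thesis by (simp add: X cX h)
  qed
  moreover have "eigf W a 0 ?z"
    unfolding eigf_def
  proof
    fix x assume "x \<in> W"
    then consider "x \<in> K" | "x \<in> X" using W(2) by blast
    then show "mv W a ?z x = 0 * ?z x"
      using aK(1) by cases (simp_all add: eigf_def K X cK cX)
  qed
  moreover have "nonzero_on W ?z" using pq(1) W(2) by (auto simp: nonzero_on_def)
  moreover have "dot W C ?z = 0"
  proof -
    have "dot W C ?z = dot K C ?z" using W by (intro dot_supp) auto
    also have "\<dots> = (\<Sum>x\<in>K. c x)" by (simp add: dot_def C_def)
    finally show ?thesis using c(2) by simp
  qed
  ultimately have "eigdim_gt (insert u W) (border u C (0 + dot W C ?g) a) 0 1"
    by (intro eigdim_gt_border[OF W(1,3) _ refl]) auto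
  moreover have "realizes E (insert u W) (border u C (0 + dot W C ?g) a)"
    by (rule realizes_border[OF a(1) W(3)]) (use W(2) c(1) in \<open>auto simp: C_def\<close>)
  ultimately show ?thesis using that agree_border[OF W(3)] by blast
qed

text \<open>The vertex \<open>u\<close> closes a cycle through the connected set \<open>K\<close>.
  The remaining vertices \<open>X\<close> receive a matrix that can be solved at 0, so the kernel
  vectors found on \<open>K\<close> and \<open>u\<close> extend to them.\<close>

lemma doubly_singular_two_neighbours:
  assumes V: "finite V" "V = insert u (K \<union> X)" "u \<notin> K \<union> X" "sep K X" "conn K"
    and pq: "p \<in> K" "q \<in> K" "p \<noteq> q" "E u p" "E u q"
  shows "doubly_singular V"
proof -
  have fin: "finite K" "finite X" using V by auto
  obtain aK where aK: "realizes E K aK" "eigf K aK 0 (\<lambda>_. 1)"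
    "\<forall>c. (\<Sum>x\<in>K. c x) = 0 \<longrightarrow> (\<exists>g. \<forall>x\<in>K. mv K aK g x = c x)"
    using laplacian[OF fin(1) V(5)] .
  obtain aX where aX: "realizes E X aX" "solvable X aX 0"
  proof (cases "X = {}")
    case True
    then show ?thesis using that realizes_empty by (simp add: solvable_def)
  next
    case False
    then show ?thesis using eigenvalue_one_solvable_zero[OF fin(2)] that by metis
  qed
  obtain a where a: "realizes E (K \<union> X) a" "agree K a aK" "agree X a aX"
    by (rule realizes_glue[OF aK(1) aX(1)]) (use V(4) in \<open>auto simp: sep_def\<close>)
  obtain b where b: "realizes E (insert u (K \<union> X)) b" "eigdim_gt (insert u (K \<union> X)) b 0 1"
    using double_zero_border[OF _ refl V(3,4) pq aK(2,3) aX(2) a] fin by blast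
  show ?thesis by (rule doubly_singularI[OF V(1), of b 0]) (use b V(2) in auto)
qed

text \<open>The entry at \<open>u\<close> makes 0 a double eigenvalue as in
  \<open>double_zero_border\<close>. A nonzero eigenvalue \<mu> of the Laplacian of \<open>K\<close>
  is passed to \<open>X\<close> and \<open>Y\<close> by scaling; it occurs three times without
  \<open>u\<close> and twice with it.\<close>

lemma deficient_three_branches_two_neighbours:
  assumes V: "finite V" "V = insert u (K \<union> X \<union> Y)" "u \<notin> K \<union> X \<union> Y" "conn K"
    and sep: "sep K X" "sep K Y" "sep X Y" and ne: "X \<noteq> {}" "Y \<noteq> {}"
    and pq: "p \<in> K" "q \<in> K" "p \<noteq> q" "E u p" "E u q"
  shows "deficient V"
proof -
  have fin: "finite K" "finite X" "finite Y" using V by auto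
  obtain aK where aK: "realizes E K aK" "eigf K aK 0 (\<lambda>_. 1)"
    "\<forall>c. (\<Sum>x\<in>K. c x) = 0 \<longrightarrow> (\<exists>g. \<forall>x\<in>K. mv K aK g x = c x)"
    using laplacian[OF fin(1) V(4)] .
  \<comment> \<open>The neighbour \<open>r\<close> of \<open>p\<close> shows that the indicator of
    \<open>p\<close> is no eigenvector, so the Laplacian has two eigenvalues, one of them
    nonzero.\<close>
  obtain r where r: "r \<in> K" "r \<noteq> p" "E r p"
  proof -
    have "(adj_on K)\<^sup>*\<^sup>* q p" using V(4) pq by (auto simp: conn_def)
    then have "\<exists>r\<in>K. r \<noteq> p \<and> E r p" using pq(3)
    proof (induction rule: rtranclp_induct)
      case (step y z)
      then show ?case by (cases "y = z") (auto simp: adj_on_def)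
    qed simp
    then show ?thesis using that by blast
  qed
  obtain l m where lm: "l \<in> eigs K aK" "m \<in> eigs K aK" "l \<noteq> m"
  proof (rule two_eigenvalues[OF fin(1)])
    show "sym_on K aK" using aK(1) by (simp add: realizes_def)
    show "nonzero_on K (\<lambda>x. if x = p then 1 else 0)" using pq by (auto simp: nonzero_on_def)
    fix c
    have "mv K aK (\<lambda>x. if x = p then 1 else 0) r = aK r p"
      using fin pq(1) by (simp add: mv_def if_distrib[of "\<lambda>t. _ * t"] sum.delta cong: if_cong)
    then show "\<exists>x\<in>K. mv K aK (\<lambda>x. if x = p then 1 else 0) x \<noteq> c * (if x = p then 1 else 0)"
      using r pq aK(1) by (intro bexI[of _ r]) (auto simp: realizes_def)
  qed
  then obtain \<mu> where \<mu>: "\<mu> \<in> eigs K aK" "\<mu> \<noteq> 0" by metis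
  obtain b1 where b1: "realizes E X b1" "1 \<in> eigs X b1" "solvable X b1 0"
    using eigenvalue_one_solvable_zero[OF fin(2) ne(1)] .
  obtain b2 where b2: "realizes E Y b2" "1 \<in> eigs Y b2" "solvable Y b2 0"
    using eigenvalue_one_solvable_zero[OF fin(3) ne(2)] .
  let ?c1 = "affine \<mu> 0 b1" and ?c2 = "affine \<mu> 0 b2"
  have c1: "realizes E X ?c1" "\<mu> \<in> eigs X ?c1" "solvable X ?c1 0"
    using realizes_affine[OF b1(1) \<mu>(2)] eigs_affine[OF fin(2) b1(2), of \<mu> 0]
      solvable_affine[OF fin(2) b1(3) \<mu>(2), of 0] by auto
  have c2: "realizes E Y ?c2" "\<mu> \<in> eigs Y ?c2" "solvable Y ?c2 0"
    using realizes_affine[OF b2(1) \<mu>(2)] eigs_affine[OF fin(3) b2(2), of \<mu> 0]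
      solvable_affine[OF fin(3) b2(3) \<mu>(2), of 0] by auto
  obtain aX where aX: "realizes E (X \<union> Y) aX" "agree X aX ?c1" "agree Y aX ?c2"
    by (rule realizes_glue[OF c1(1) c2(1)]) (use sep in \<open>auto simp: sep_def\<close>)
  have sX: "solvable (X \<union> Y) aX 0"
    by (rule solvable_join[OF _ aX(1)]) (use fin sep aX c1 c2 in \<open>auto simp: solvable_agree\<close>)
  have sepK: "sep K (X \<union> Y)" using sep by (auto simp: sep_def)
  obtain a where a: "realizes E (K \<union> (X \<union> Y)) a" "agree K a aK" "agree (X \<union> Y) a aX"
    by (rule realizes_glue[OF aK(1) aX(1)]) (use sepK in \<open>auto simp: sep_def\<close>)
  have u: "u \<notin> K \<union> (X \<union> Y)" using V(3) by auto
  have finW: "finite (K \<union> (X \<union> Y))" using fin by auto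
  obtain b where b: "realizes E (insert u (K \<union> (X \<union> Y))) b" "agree (K \<union> (X \<union> Y)) b a"
    "eigdim_gt (insert u (K \<union> (X \<union> Y))) b 0 1"
    using double_zero_border[OF finW refl u sepK pq aK(2,3) sX a] .
  have V': "insert u (K \<union> (X \<union> Y)) = V" using V(2) by auto
  have ag: "agree K b aK" "agree X b ?c1" "agree Y b ?c2"
    using b(2) a(2,3) aX(2,3) by (auto simp: agree_def)
  have "eigdim_gt (K \<union> X \<union> Y) b \<mu> 2"
    by (rule eigdim_gt_2_join[OF V(1) b(1)[unfolded V']])
      (use V(2) sep \<mu> c1 c2 in \<open>auto simp: eigs_agree[OF ag(1)] eigs_agree[OF ag(2)] eigs_agree[OF ag(3)]\<close>)
  then have "eigdim_gt V b \<mu> 1"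
    unfolding V(2) using V fin by (intro eigdim_gt_insert) (auto simp: numeral_2_eq_2)
  with b \<mu>(2) show ?thesis unfolding V' by (intro deficientI_doubles[of V b 0 \<mu>]) auto
qed

text \<open>
  Conjugating the Laplacian of the weights \<open>w\<close> with the square roots \<open>z\<close> of suitable masses yields
  a matrix on \<open>K\<close> with the eigenpairs \<open>(0, z)\<close> and \<open>(1, z \<rho>)\<close>. The vectors \<open>s1\<close> and \<open>s2\<close> solve
  the equations of \<open>u\<close> at these two eigenvalues, and the final inequality allows to scale the row
  of \<open>u\<close> such that both demand the same diagonal entry.
\<close>

lemma deficient_two_states:
  assumes V: "finite V" "V = insert u (K \<union> X)" "u \<notin> K \<union> X" "sep K X" "K \<noteq> {}"
    and w: "sym_on K w" "\<And>x y. x \<in> K \<Longrightarrow> y \<in> K \<Longrightarrow> x \<noteq> y \<Longrightarrow> w x y \<noteq> 0 \<longleftrightarrow> E x y"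
    and \<rho>: "\<And>x. x \<in> K \<Longrightarrow> \<rho> x \<noteq> 0" "\<And>x. x \<in> K \<Longrightarrow> 0 < wlap K w \<rho> x / \<rho> x"
    and c: "\<And>x. x \<in> K \<Longrightarrow> c x \<noteq> 0 \<longleftrightarrow> E u x"
    and s1: "\<And>x. x \<in> K \<Longrightarrow> wlap K w s1 x = c x"
    and s2: "\<And>x. x \<in> K \<Longrightarrow> wlap K (\<lambda>x y. w x y * \<rho> x * \<rho> y) s2 x = \<rho> x * c x"
    and less: "(\<Sum>x\<in>K. \<rho> x * c x * s2 x) < (\<Sum>x\<in>K. c x * s1 x)"
  shows "deficient V"
proof -
  let ?W = "K \<union> X"
  have fin: "finite K" "finite X" "finite ?W" using V by auto
  have disj: "K \<inter> X = {}" using V(4) by (simp add: sep_def)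
  \<comment> \<open>Writing L for the Laplacian, the masses z^2 are those for which L \<rho> = z^2
    \<rho>.\<close>
  define z where "z x = sqrt (wlap K w \<rho> x / \<rho> x)" for x
  have z0: "z x > 0" if "x \<in> K" for x using \<rho>(2)[OF that] by (simp add: z_def)
  have zz: "z x * z x * \<rho> x = wlap K w \<rho> x" if "x \<in> K" for x
  proof -
    have "z x * z x = wlap K w \<rho> x / \<rho> x"
      using \<rho>(2)[OF that] unfolding z_def by (metis real_sqrt_mult_self abs_of_pos)
    then show ?thesis using \<rho>(1)[OF that] by simp
  qed
  \<comment> \<open>This is Z^-1 L Z^-1 with Z the diagonal matrix of \<open>z\<close>.\<close>
  define B where "B x y = ((if x = y then \<Sum>t\<in>K. w x t else 0) - w x y) / (z x * z y)" for x y
  have B: "realizes E K B"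
    using w z0 by (fastforce simp: realizes_def sym_on_def B_def mult.commute)
  have mvB: "mv K B (\<lambda>y. z y * s y) x = wlap K w s x / z x" if "x \<in> K" for s x
  proof -
    have "mv K B (\<lambda>y. z y * s y) x = (\<Sum>y\<in>K. (((if x = y then (\<Sum>t\<in>K. w x t) * s y else 0) - w x y * s y) / z x))"
      unfolding mv_def B_def using z0 by (intro sum.cong) (force simp: field_simps)+
    also have "\<dots> = ((\<Sum>t\<in>K. w x t) * s x - (\<Sum>y\<in>K. w x y * s y)) / z x"
      using fin that by (simp add: sum_subtractf flip: sum_divide_distrib)
    finally show ?thesis by (simp add: wlap_def algebra_simps sum_subtractf sum_distrib_left)
  qed
  \<comment> \<open>Product rule: L(\<rho> s) - (L \<rho>) s at \<open>x\<close> is the sum of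
    \<open>w x y * \<rho> y * (s x - s y)\<close>. Multiplied by \<open>\<rho> x\<close> it is the
    Laplacian with weights \<open>w x y * \<rho> x * \<rho> y\<close>, so the equation at eigenvalue
    1 is a Laplace equation again.\<close>
  have mvB1: "mv K B (\<lambda>y. z y * (\<rho> y * s2 y)) x - z x * (\<rho> x * s2 x) = c x / z x" if "x \<in> K" for x
  proof -
    have "mv K B (\<lambda>y. z y * (\<rho> y * s2 y)) x - z x * (\<rho> x * s2 x)
      = (wlap K w (\<lambda>y. \<rho> y * s2 y) x - z x * z x * \<rho> x * s2 x) / z x"
      using mvB[OF that, of "\<lambda>y. \<rho> y * s2 y"] z0[OF that] by (simp add: field_simps)
    also have "wlap K w (\<lambda>y. \<rho> y * s2 y) x - z x * z x * \<rho> x * s2 x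
      = (\<Sum>y\<in>K. w x y * \<rho> y * (s2 x - s2 y))"
      unfolding zz[OF that] wlap_def sum_distrib_right sum_subtractf[symmetric]
      by (intro sum.cong refl) (simp add: algebra_simps)
    also have "\<dots> = c x"
    proof -
      have "\<rho> x * (\<Sum>y\<in>K. w x y * \<rho> y * (s2 x - s2 y)) = \<rho> x * c x"
        using s2[OF that] by (simp add: wlap_def sum_distrib_left algebra_simps)
      then show ?thesis using \<rho>(1)[OF that] by simp
    qed
    finally show ?thesis .
  qed
  \<comment> \<open>With all eigenvalues strictly between 0 and 1, the part \<open>X\<close> adds a
    nonnegative amount to the product at 0 and a nonpositive one to the product at 1, so the strict
    inequality persists.\<close>
  obtain b where b: "realizes E X b"
    "\<And>f. nonzero_on X f \<Longrightarrow> 0 < dot X f (mv X b f) \<and> dot X f (mv X b f) < dot X f f"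
    using near_scalar[OF fin(2)] by metis
  have solv: "solvable X b l" if "l = 0 \<or> l = 1" for l
  proof (rule solvable_iff_injective[OF fin(2)])
    fix f assume nz: "nonzero_on X f"
    show "\<not> eigf X b l f"
    proof
      assume "eigf X b l f"
      then have "dot X f (mv X b f) = l * dot X f f"
        by (simp add: eigf_def dot_def sum_distrib_left mult.left_commute)
      with b(2)[OF nz] that show False by auto
    qed
  qed
  let ?e = "\<lambda>x. of_bool (E u x) :: real"
  obtain g0 where g0: "\<And>x. x \<in> X \<Longrightarrow> mv X b g0 x = ?e x"
    using solv[of 0, unfolded solvable_def, simplified, rule_format, of ?e] by auto
  obtain g1 where g1: "\<And>x. x \<in> X \<Longrightarrow> mv X b g1 x - g1 x = ?e x"
    using solv[of 1, unfolded solvable_def, simplified, rule_format, of ?e] by auto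
  have pos0: "0 \<le> dot X ?e g0"
  proof -
    have "dot X ?e g0 = dot X g0 (mv X b g0)" by (subst dot_commute) (auto intro: dot_cong simp: g0)
    then show ?thesis using b(2)[of g0] by (cases "nonzero_on X g0") (auto simp: nonzero_on_def dot_def)
  qed
  have pos1: "dot X ?e g1 \<le> 0"
  proof -
    have "dot X ?e g1 = dot X g1 (\<lambda>x. mv X b g1 x + - g1 x)"
      by (subst dot_commute) (auto intro!: dot_cong simp: g1[symmetric])
    also have "\<dots> = dot X g1 (mv X b g1) - dot X g1 g1" by (simp only: dot_add dot_minus)
    finally show ?thesis using b(2)[of g1] by (cases "nonzero_on X g1") (auto simp: nonzero_on_def dot_def)
  qed
  obtain a where a: "realizes E ?W a" "agree K a B" "agree X a b"
    by (rule realizes_glue[OF B b(1) disj])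
  have K: "mv ?W a f x = mv K B f x" if "x \<in> K" for f x
    using mv_sep[OF fin(3) a(1) refl V(4) that] mv_agree[OF a(2) that] by simp
  have X: "mv ?W a f x = mv X b f x" if "x \<in> X" for f x
    using mv_sep[OF fin(3) a(1) Un_commute sep_sym[OF V(4)] that] mv_agree[OF a(3) that] by simp
  define join where "join f g x = (if x \<in> K then f x else g x)" for f g :: "'a \<Rightarrow> real" and x
  have jK: "mv K B (join f g) x = mv K B f x" for f g x by (rule mv_cong) (auto simp: join_def)
  have jX: "mv X b (join f g) x = mv X b g x" for f g x
    by (rule mv_cong) (use disj in \<open>auto simp: join_def\<close>)
  have mvJ: "mv ?W a (join f g) x = (if x \<in> K then mv K B f x else mv X b g x)" if "x \<in> ?W" for f g x
    using that by (auto simp: K X jK jX)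
  have dotJ: "dot ?W (join f g) (join f' g') = dot K f f' + dot X g g'" for f g f' g'
  proof -
    have "dot X (join f g) (join f' g') = dot X g g'"
      by (rule dot_cong) (use disj in \<open>auto simp: join_def\<close>)
    moreover have "dot K (join f g) (join f' g') = dot K f f'"
      by (rule dot_cong) (auto simp: join_def)
    ultimately show ?thesis by (simp add: dot_union fin disj)
  qed
  define T0 where "T0 = (\<Sum>x\<in>K. c x * s1 x) + dot X ?e g0"
  define T1 where "T1 = (\<Sum>x\<in>K. \<rho> x * c x * s2 x) + dot X ?e g1"
  have T: "T1 < T0" using less pos0 pos1 by (simp add: T0_def T1_def)
  \<comment> \<open>Scaling the row by \<open>t\<close> multiplies both products by t^2 and makes
    their difference 1, which is the difference of the eigenvalues.\<close>
  define t where "t = 1 / sqrt (T0 - T1)"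
  have t: "t > 0" "t * t * (T0 - T1) = 1" using T by (auto simp: t_def)
  define C where "C = join (\<lambda>x. t * (c x / z x)) (\<lambda>x. t * ?e x)"
  define G0 where "G0 = join (\<lambda>x. t * (z x * s1 x)) (\<lambda>x. t * g0 x)"
  define G1 where "G1 = join (\<lambda>x. t * (z x * (\<rho> x * s2 x))) (\<lambda>x. t * g1 x)"
  define Z0 where "Z0 = join (\<lambda>x. z x * 1) (\<lambda>_. 0)"
  define Z1 where "Z1 = join (\<lambda>x. z x * \<rho> x) (\<lambda>_. 0)"
  have "dot ?W C G0 = t * t * T0"
  proof -
    have "dot K (\<lambda>x. t * (c x / z x)) (\<lambda>x. t * (z x * s1 x)) = t * t * (\<Sum>x\<in>K. c x * s1 x)"
      unfolding dot_def sum_distrib_left by (intro sum.cong) (use z0 in \<open>force simp: field_simps\<close>)+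
    then show ?thesis unfolding C_def G0_def dotJ by (simp add: dot_scale dot_scale_left T0_def algebra_simps)
  qed
  moreover have "dot ?W C G1 = t * t * T1"
  proof -
    have "dot K (\<lambda>x. t * (c x / z x)) (\<lambda>x. t * (z x * (\<rho> x * s2 x))) = t * t * (\<Sum>x\<in>K. \<rho> x * c x * s2 x)"
      unfolding dot_def sum_distrib_left by (intro sum.cong) (use z0 in \<open>force simp: field_simps\<close>)+
    then show ?thesis unfolding C_def G1_def dotJ by (simp add: dot_scale dot_scale_left T1_def algebra_simps)
  qed
  ultimately have d: "dot ?W C G0 = 1 + dot ?W C G1" using t(2) by (simp add: algebra_simps)
  let ?A = "border u C (dot ?W C G0) a"
  obtain k where k: "k \<in> K" using V(5) by blast
  have "eigdim_gt (insert u ?W) ?A 0 1"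
  proof (rule eigdim_gt_border[OF fin(3) V(3)])
    show "mv ?W a G0 x - 0 * G0 x = C x" if "x \<in> ?W" for x
      using that unfolding G0_def by (simp add: mvJ mv_scale mvB g0 s1) (auto simp: C_def join_def mvB s1 g0)
    show "eigf ?W a 0 Z0"
      unfolding eigf_def
    proof
      fix x assume x: "x \<in> ?W"
      have "mv X b (\<lambda>_. 0) x = 0" by (simp add: mv_def)
      then show "mv ?W a Z0 x = 0 * Z0 x"
        using mvB[of x "\<lambda>_. 1"] unfolding Z0_def mvJ[OF x] by (simp add: wlap_def)
    qed
    show "nonzero_on ?W Z0" using z0[OF k] k by (auto simp: nonzero_on_def Z0_def join_def intro!: bexI[of _ k])
    have "dot K (\<lambda>x. t * (c x / z x)) (\<lambda>x. z x * 1) = t * (\<Sum>x\<in>K. wlap K w s1 x)"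
      unfolding dot_def sum_distrib_left by (intro sum.cong) (use z0 s1 in \<open>force simp: field_simps\<close>)+
    then show "dot ?W C Z0 = 0"
      unfolding C_def Z0_def dotJ by (simp add: sum_wlap[OF w(1)] dot_zero)
  qed simp
  moreover have "eigdim_gt (insert u ?W) ?A 1 1"
  proof (rule eigdim_gt_border[OF fin(3) V(3)])
    show "mv ?W a G1 x - 1 * G1 x = C x" if "x \<in> ?W" for x
    proof (cases "x \<in> K")
      case True
      have "mv ?W a G1 x - 1 * G1 x = t * (mv K B (\<lambda>y. z y * (\<rho> y * s2 y)) x - z x * (\<rho> x * s2 x))"
        using True that by (simp add: G1_def mvJ mv_scale join_def algebra_simps)
      then show ?thesis using True by (simp add: mvB1 C_def join_def)
    next
      case False
      then have "mv ?W a G1 x - 1 * G1 x = t * (mv X b g1 x - g1 x)"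
        using that by (simp add: G1_def mvJ mv_scale join_def algebra_simps)
      then show ?thesis using False that by (simp add: g1 C_def join_def)
    qed
    show "eigf ?W a 1 Z1"
      unfolding eigf_def
    proof
      fix x assume x: "x \<in> ?W"
      show "mv ?W a Z1 x = 1 * Z1 x"
      proof (cases "x \<in> K")
        case True
        have "mv ?W a Z1 x = wlap K w \<rho> x / z x"
          using True x unfolding Z1_def by (simp only: mvJ mvB if_True)
        also have "\<dots> = z x * \<rho> x" using zz[OF True] z0[OF True] by (simp add: field_simps)
        finally show ?thesis using True by (simp add: Z1_def join_def)
      next
        case False
        moreover have "mv X b (\<lambda>_. 0) x = 0" by (simp add: mv_def)
        ultimately show ?thesis unfolding Z1_def mvJ[OF x] by (simp add: join_def)
      qed
    qed
    show "nonzero_on ?W Z1" using z0[OF k] \<rho>(1)[OF k] k by (auto simp: nonzero_on_def Z1_def join_def intro!: bexI[of _ k])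
    have "dot K (\<lambda>x. t * (c x / z x)) (\<lambda>x. z x * \<rho> x) = t * (\<Sum>x\<in>K. wlap K (\<lambda>x y. w x y * \<rho> x * \<rho> y) s2 x)"
      unfolding dot_def sum_distrib_left by (intro sum.cong) (use z0 s2 in \<open>force simp: field_simps\<close>)+
    moreover have "sym_on K (\<lambda>x y. w x y * \<rho> x * \<rho> y)" using w(1) by (auto simp: sym_on_def)
    ultimately show "dot ?W C Z1 = 0"
      unfolding C_def Z1_def dotJ by (simp add: sum_wlap dot_zero)
    show "dot ?W C G0 = 1 + dot ?W C G1" by (rule d)
  qed
  moreover have "realizes E (insert u ?W) ?A"
    by (rule realizes_border[OF a(1) V(3)]) (use c t z0 in \<open>force simp: C_def join_def\<close>)
  ultimately show ?thesis unfolding V(2) by (intro deficientI_doubles[of _ ?A 0 1]) auto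
qed


section \<open>Vertices with three neighbours in one branch\<close>

lemma adj_on_sym: "adj_on X x y \<Longrightarrow> adj_on X y x"
  using E_sym by (auto simp: adj_on_def)

text \<open>The colour is the parity of the distance from a root. A breadth-first tree joins
  consecutive levels only, so bichromatic edges already connect \<open>K\<close>.\<close>

lemma connected_colouring:
  assumes "conn K"
  obtains \<sigma> :: "'a \<Rightarrow> bool"
  where "\<forall>x\<in>K. \<forall>y\<in>K. (\<lambda>x y. adj_on K x y \<and> \<sigma> x \<noteq> \<sigma> y)\<^sup>*\<^sup>* x y"
proof (cases "K = {}")
  case True
  then show ?thesis using that by simp
next
  case False
  then obtain r where r: "r \<in> K" by blast
  define d where "d x = (LEAST n. (adj_on K ^^ n) r x)" for x
  define \<sigma> where "\<sigma> x = even (d x)" for x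
  let ?O = "\<lambda>x y. adj_on K x y \<and> \<sigma> x \<noteq> \<sigma> y"
  have d: "(adj_on K ^^ d x) r x" if "x \<in> K" for x
  proof -
    have "\<exists>n. (adj_on K ^^ n) r x"
      using assms r that by (auto simp: conn_def dest!: rtranclp_imp_relpowp)
    then show ?thesis unfolding d_def by (rule LeastI_ex)
  qed
  have d_le: "d x \<le> n" if "(adj_on K ^^ n) r x" for n x
    unfolding d_def using that by (rule Least_le)
  have "?O\<^sup>*\<^sup>* r x" if "x \<in> K" for x
    using that
  proof (induction "d x" arbitrary: x)
    case 0
    then show ?case using d[OF 0(2)] by simp
  next
    case (Suc n)
    have "(adj_on K ^^ Suc n) r x" using d[OF Suc.prems] Suc.hyps(2) by simp
    then obtain y where y: "(adj_on K ^^ n) r y" "adj_on K y x" by auto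
    have yK: "y \<in> K" using y(2) by (simp add: adj_on_def)
    have "d x \<le> Suc (d y)" using d[OF yK] y(2) by (intro d_le) auto
    with d_le[OF y(1)] Suc.hyps(2) have "d y = n" by simp
    then have "?O\<^sup>*\<^sup>* r y" "?O y x" using Suc.hyps yK y(2) by (auto simp: \<sigma>_def simp flip: Suc.hyps(2))
    then show ?case by (rule rtranclp.rtrancl_into_rtrancl)
  qed
  moreover have "symp ?O\<^sup>*\<^sup>*" by (rule symp_rtranclp) (auto simp: symp_def dest: adj_on_sym)
  ultimately have "?O\<^sup>*\<^sup>* x y" if "x \<in> K" "y \<in> K" for x y
    using that by (meson rtranclp_trans sympD)
  then show ?thesis using that by blast
qed

text \<open>Let \<rho> change its sign along bichromatic edges. The weights w \<rho> \<rho> of the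
  equation at eigenvalue 1 are negative there, which makes its product negative and yields the
  inequality. Monochromatic edges have the wrong sign and receive a weight \<epsilon> small enough
  to be dominated. Three neighbours leave room for a row orthogonal to both eigenvectors although
  \<rho> is injective.\<close>

lemma deficient_three_neighbours:
  assumes V: "finite V" "V = insert u (K \<union> X)" "u \<notin> K \<union> X" "sep K X" "conn K"
    and pqr: "p \<in> K" "q \<in> K" "r \<in> K" "p \<noteq> q" "p \<noteq> r" "q \<noteq> r" "E u p" "E u q" "E u r"
  shows "deficient V"
proof -
  have K: "finite K" using V by auto
  obtain \<sigma> :: "'a \<Rightarrow> bool"
    where \<sigma>: "\<forall>x\<in>K. \<forall>y\<in>K. (\<lambda>x y. adj_on K x y \<and> \<sigma> x \<noteq> \<sigma> y)\<^sup>*\<^sup>* x y"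
    using connected_colouring[OF V(5)] .
  define Q where "Q x y \<longleftrightarrow> adj_on K x y \<and> \<sigma> x \<noteq> \<sigma> y" for x y
  have QK: "x \<in> K \<and> y \<in> K" if "Q x y" for x y using that by (auto simp: Q_def adj_on_def)
  have Qrt: "Q\<^sup>*\<^sup>* x y" if "x \<in> K" "y \<in> K" for x y using \<sigma> that by (simp add: Q_def[abs_def])
  let ?D = "energy K (\<lambda>x y. of_bool (Q x y))"
  obtain C where C: "C \<ge> 0" and C': "\<forall>x\<in>K. \<forall>y\<in>K. \<forall>s. (s x - s y)\<^sup>2 \<le> C * ?D s"
    using poincare_inequality[OF K QK Qrt] .
  have C2: "(s x - s y)\<^sup>2 \<le> C * ?D s" if "x \<in> K" "y \<in> K" for s x y using C' that by blast
  have D0: "0 \<le> ?D s" for s by (auto simp: energy_def intro!: sum_nonneg)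
  have const: "s x = s y" if "?D s \<le> 0" "x \<in> K" "y \<in> K" for s x y
  proof -
    have "?D s = 0" using that(1) D0[of s] by simp
    then show ?thesis using C2[OF that(2,3), of s] by simp
  qed
  have nbr: "\<exists>y. Q x y" if "x \<in> K" for x
  proof -
    obtain y where "y \<in> K" "y \<noteq> x" using pqr by metis
    with Qrt[OF that this(1)] show ?thesis by (metis converse_rtranclpE)
  qed
  obtain h :: "'a \<Rightarrow> nat" where h: "inj_on h K"
    using finite_imp_inj_to_nat_seg[OF K] by blast
  \<comment> \<open>The sign is the colour; the absolute values are pairwise distinct and at least
    1.\<close>
  define \<rho> where "\<rho> x = (if \<sigma> x then 1 else - 1) * (1 + real (h x))" for x
  have \<rho>0: "\<rho> x \<noteq> 0" for x by (simp add: \<rho>_def add_eq_0_iff)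
  have \<rho>inj: "inj_on \<rho> K"
  proof (rule inj_onI)
    fix x y assume xy: "x \<in> K" "y \<in> K" "\<rho> x = \<rho> y"
    then have "\<bar>\<rho> x\<bar> = \<bar>\<rho> y\<bar>" by simp
    then have "h x = h y" by (auto simp: \<rho>_def abs_mult split: if_splits)
    with xy h show "x = y" by (auto dest: inj_onD)
  qed
  have \<rho>1: "1 \<le> \<bar>\<rho> x\<bar>" for x by (auto simp: \<rho>_def abs_mult)
  have opp: "1 \<le> - (\<rho> x * \<rho> y)" if "Q x y" for x y
  proof -
    have "1 * 1 \<le> (1 + real (h x)) * (1 + real (h y))" by (intro mult_mono) auto
    then show ?thesis using that by (auto simp: Q_def \<rho>_def algebra_simps)
  qed
  define M where "M = 1 + (\<Sum>x\<in>K. \<Sum>y\<in>K. \<bar>\<rho> x * \<rho> y\<bar>)"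
  have M: "\<rho> x * \<rho> y \<le> M" if "x \<in> K" "y \<in> K" for x y
  proof -
    have "\<bar>\<rho> x * \<rho> y\<bar> \<le> (\<Sum>y\<in>K. \<bar>\<rho> x * \<rho> y\<bar>)" using that K by (intro member_le_sum) auto
    also have "\<dots> \<le> (\<Sum>x\<in>K. \<Sum>y\<in>K. \<bar>\<rho> x * \<rho> y\<bar>)"
      using that K by (intro member_le_sum) (auto intro: sum_nonneg)
    finally show ?thesis by (simp add: M_def)
  qed
  have M0: "M \<ge> 0" by (auto simp: M_def intro!: add_nonneg_nonneg sum_nonneg)
  let ?n = "real (card K)"
  \<comment> \<open>The first term of the denominator keeps the energy of \<kappa> at no less than
    half that of \<open>Q\<close>; the second keeps the Laplacian of \<rho> of the same sign as
    \<rho>.\<close>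
  define \<epsilon> where "\<epsilon> = 1 / (2 * (M * ?n * ?n * C) + 2 * (M * ?n) + 1)"
  have bound: "0 < 1 / (2 * \<alpha> + 2 * \<beta> + 1)" "1 / (2 * \<alpha> + 2 * \<beta> + 1) * \<alpha> \<le> 1 / 2"
    "1 / (2 * \<alpha> + 2 * \<beta> + 1) * \<beta> \<le> 1 / 2" if "0 \<le> \<alpha>" "0 \<le> \<beta>" for \<alpha> \<beta> :: real
    using that by (simp_all add: field_simps)
  have "0 \<le> M * ?n * ?n * C" "0 \<le> M * ?n" using M0 C by auto
  from bound[OF this] have \<epsilon>: "\<epsilon> > 0" "\<epsilon> * (M * ?n * ?n * C) \<le> 1 / 2" "\<epsilon> * (M * ?n) \<le> 1 / 2"
    unfolding \<epsilon>_def .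
  define w where "w x y = (if x \<noteq> y \<and> E x y then if \<sigma> x \<noteq> \<sigma> y then 1 else \<epsilon> else 0)" for x y
  have w: "sym_on K w" using E_sym by (auto simp: sym_on_def w_def)
  have wQ: "w x y = 1" if "Q x y" for x y using that by (auto simp: w_def Q_def adj_on_def)
  have w\<epsilon>: "0 \<le> w x y \<and> w x y \<le> \<epsilon>" if "\<not> Q x y" "x \<in> K" "y \<in> K" for x y
    using that \<epsilon>(1) by (auto simp: w_def Q_def adj_on_def)
  have w0: "0 \<le> w x y" for x y using \<epsilon>(1) by (auto simp: w_def)
  have energy_w: "?D s \<le> energy K w s" for s
    unfolding energy_def
  proof (intro sum_mono mult_right_mono)
    show "of_bool (Q x y) \<le> w x y" for x y using wQ[of x y] w0[of x y] by (cases "Q x y") auto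
  qed auto
  define \<kappa> where "\<kappa> x y = - (w x y * \<rho> x * \<rho> y)" for x y
  have \<kappa>: "sym_on K \<kappa>" using w by (auto simp: sym_on_def \<kappa>_def)
  have energy_\<kappa>: "?D s / 2 \<le> energy K \<kappa> s" for s
  proof -
    \<comment> \<open>A weight of the wrong sign is at least -\<epsilon> M, and by the Poincare
      inequality it multiplies at most \<open>C\<close> times the energy of
      \<open>Q\<close>.\<close>
    have le: "of_bool (Q x y) * (s x - s y)\<^sup>2 - \<epsilon> * M * C * ?D s \<le> \<kappa> x y * (s x - s y)\<^sup>2"
      if xy: "x \<in> K" "y \<in> K" for x y
    proof (cases "Q x y")
      case True
      have "0 \<le> \<epsilon> * M * C * ?D s" using \<epsilon>(1) M0 C D0 by simp
      moreover have "1 * (s x - s y)\<^sup>2 \<le> \<kappa> x y * (s x - s y)\<^sup>2"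
        using opp[OF True] by (intro mult_right_mono) (auto simp: \<kappa>_def wQ[OF True])
      ultimately show ?thesis using True by simp
    next
      case False
      have "w x y * (\<rho> x * \<rho> y) \<le> w x y * M" using M[OF xy] w0 by (rule mult_left_mono)
      also have "\<dots> \<le> \<epsilon> * M" using w\<epsilon>[OF False xy] M0 by (intro mult_right_mono) auto
      finally have "- (\<epsilon> * M) \<le> \<kappa> x y" by (simp add: \<kappa>_def mult.assoc)
      then have "- (\<epsilon> * M) * (s x - s y)\<^sup>2 \<le> \<kappa> x y * (s x - s y)\<^sup>2" by (rule mult_right_mono) simp
      moreover have "\<epsilon> * M * (s x - s y)\<^sup>2 \<le> \<epsilon> * M * (C * ?D s)"
        using C2[OF xy] \<epsilon>(1) M0 by (intro mult_left_mono) auto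
      ultimately show ?thesis using False by (simp add: mult.assoc)
    qed
    have "?D s - ?n * ?n * (\<epsilon> * M * C * ?D s) = (\<Sum>x\<in>K. \<Sum>y\<in>K. of_bool (Q x y) * (s x - s y)\<^sup>2 - \<epsilon> * M * C * ?D s)"
      by (simp only: sum_subtractf sum_constant) (simp add: energy_def mult.assoc)
    also have "\<dots> \<le> energy K \<kappa> s" unfolding energy_def[of K \<kappa>] by (intro sum_mono le)
    finally have "?D s - ?n * ?n * (\<epsilon> * M * C * ?D s) \<le> energy K \<kappa> s" .
    moreover have "\<epsilon> * (M * ?n * ?n * C) * ?D s \<le> 1 / 2 * ?D s" using \<epsilon>(2) D0 by (rule mult_right_mono)
    then have "?n * ?n * (\<epsilon> * M * C * ?D s) \<le> 1 / 2 * ?D s" by (simp add: mult_ac)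
    ultimately show ?thesis by linarith
  qed
  \<comment> \<open>In the sum for \<open>\<rho> x\<close> times the Laplacian, a bichromatic edge
    at \<open>x\<close> contributes at least 1, and the losses are at most \<epsilon> M per vertex,
    1/2 in total.\<close>
  have pos: "0 < wlap K w \<rho> x / \<rho> x" if x: "x \<in> K" for x
  proof -
    have summand: "(if Q x y then 1 else 0) - \<epsilon> * M \<le> w x y * (\<rho> x - \<rho> y) * \<rho> x" if y: "y \<in> K" for y
    proof (cases "Q x y")
      case True
      have "0 \<le> \<epsilon> * M" using \<epsilon>(1) M0 by simp
      moreover have "w x y * (\<rho> x - \<rho> y) * \<rho> x = \<rho> x * \<rho> x - \<rho> x * \<rho> y"
        by (simp add: wQ[OF True] algebra_simps)
      ultimately show ?thesis using opp[OF True] True zero_le_square[of "\<rho> x"]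
        by (simp only: if_True)
    next
      case False
      have "- M \<le> (\<rho> x - \<rho> y) * \<rho> x"
      proof -
        have "(\<rho> x - \<rho> y) * \<rho> x = \<rho> x * \<rho> x - \<rho> x * \<rho> y" by (simp add: algebra_simps)
        then show ?thesis using M[OF x y] zero_le_square[of "\<rho> x"] by linarith
      qed
      then have "w x y * (- M) \<le> w x y * ((\<rho> x - \<rho> y) * \<rho> x)" using w0 by (rule mult_left_mono)
      moreover have "w x y * M \<le> \<epsilon> * M" using w\<epsilon>[OF False x y] M0 by (intro mult_right_mono) auto
      ultimately show ?thesis using False by (simp add: mult.assoc)
    qed
    obtain y where y: "Q x y" using nbr[OF x] by blast
    have "(1::real) \<le> (\<Sum>y\<in>K. if Q x y then 1 else 0)"
    proof -
      have "(if Q x y then 1 else 0 :: real) \<le> (\<Sum>y\<in>K. if Q x y then 1 else 0)"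
        using QK[OF y] K by (intro member_le_sum) auto
      then show ?thesis using y by simp
    qed
    then have "0 < (\<Sum>y\<in>K. if Q x y then 1 else 0) - ?n * (\<epsilon> * M)"
      using \<epsilon>(3) by (simp add: mult_ac)
    also have "\<dots> = (\<Sum>y\<in>K. (if Q x y then 1 else 0) - \<epsilon> * M)" by (simp add: sum_subtractf)
    also have "\<dots> \<le> (\<Sum>y\<in>K. w x y * (\<rho> x - \<rho> y) * \<rho> x)" by (intro sum_mono summand)
    also have "\<dots> = wlap K w \<rho> x * \<rho> x" by (simp add: wlap_def sum_distrib_right)
    finally show ?thesis by (simp add: zero_less_mult_iff zero_less_divide_iff)
  qed
  define N where "N = {x \<in> K. E u x}"
  have "card {p, q, r} \<le> card N" using pqr K by (intro card_mono) (auto simp: N_def)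
  then have N: "finite N" "3 \<le> card N" "inj_on \<rho> N"
    using pqr K \<rho>inj by (auto simp: N_def inj_on_def)
  from doubly_balanced_vector[OF this] obtain c' where c': "\<And>x. x \<in> N \<Longrightarrow> c' x \<noteq> 0"
    "(\<Sum>x\<in>N. c' x) = 0" "(\<Sum>x\<in>N. c' x * \<rho> x) = 0" by blast
  define c where "c x = (if E u x then c' x else 0)" for x
  have c: "c x \<noteq> 0 \<longleftrightarrow> E u x" if "x \<in> K" for x using c'(1) that by (auto simp: c_def N_def)
  have sumN: "(\<Sum>x\<in>K. f x * c x) = (\<Sum>x\<in>N. c' x * f x)" for f
  proof -
    have "(\<Sum>x\<in>K. f x * c x) = (\<Sum>x\<in>N. f x * c x)"
      using K by (intro sum.mono_neutral_right) (auto simp: N_def c_def)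
    then show ?thesis by (simp add: c_def N_def mult.commute)
  qed
  have c0: "(\<Sum>x\<in>K. c x) = 0" "(\<Sum>x\<in>K. \<rho> x * c x) = 0"
    using sumN[of "\<lambda>_. 1"] sumN[of \<rho>] c'(2,3) by auto
  have nz: "nonzero_on K c" "nonzero_on K (\<lambda>x. \<rho> x * c x)"
    using c[OF pqr(1)] pqr \<rho>0 by (auto simp: nonzero_on_def)
  have definite_w: "s x = s y" if "energy K w s \<le> 0" "x \<in> K" "y \<in> K" for s x y
    by (rule const[OF _ that(2,3)]) (use that(1) energy_w[of s] in simp)
  have definite_\<kappa>: "s x = s y" if "energy K \<kappa> s \<le> 0" "x \<in> K" "y \<in> K" for s x y
    by (rule const[OF _ that(2,3)]) (use that(1) energy_\<kappa>[of s] in simp)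
  obtain s1 where s1': "\<forall>x\<in>K. wlap K w s1 x = c x" "nonzero_on K c \<longrightarrow> 0 < dot K c s1"
    using wlap_solve[OF K w definite_w c0(1)] .
  then have s1: "\<And>x. x \<in> K \<Longrightarrow> wlap K w s1 x = c x" "0 < dot K c s1" using nz(1) by auto
  obtain s2 where s2': "\<forall>x\<in>K. wlap K \<kappa> s2 x = \<rho> x * c x" "nonzero_on K (\<lambda>x. \<rho> x * c x) \<longrightarrow> 0 < dot K (\<lambda>x. \<rho> x * c x) s2"
    using wlap_solve[OF K \<kappa> definite_\<kappa> c0(2)] .
  then have s2: "\<And>x. x \<in> K \<Longrightarrow> wlap K \<kappa> s2 x = \<rho> x * c x" "0 < dot K (\<lambda>x. \<rho> x * c x) s2" using nz(2) by auto
  show ?thesis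
  proof (rule deficient_two_states[OF V(1-4) _ w _ \<rho>0 pos c s1(1)])
    show "K \<noteq> {}" using pqr by auto
    show "w x y \<noteq> 0 \<longleftrightarrow> E x y" if "x \<in> K" "y \<in> K" "x \<noteq> y" for x y
      using that \<epsilon>(1) by (auto simp: w_def)
    \<comment> \<open>The weights w \<rho> \<rho> equal -\<kappa>, so the solution for \<kappa>
      changes its sign, and with it the product at eigenvalue 1.\<close>
    show "wlap K (\<lambda>x y. w x y * \<rho> x * \<rho> y) (\<lambda>x. - s2 x) x = \<rho> x * c x" if "x \<in> K" for x
      unfolding s2(1)[OF that, symmetric] wlap_def by (intro sum.cong) (auto simp: \<kappa>_def algebra_simps)
    have "(\<Sum>x\<in>K. \<rho> x * c x * - s2 x) = - dot K (\<lambda>x. \<rho> x * c x) s2"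
      by (simp add: dot_def sum_negf)
    then show "(\<Sum>x\<in>K. \<rho> x * c x * - s2 x) < (\<Sum>x\<in>K. c x * s1 x)"
      using s1(2) s2(2) by (simp add: dot_def)
  qed
qed

text \<open>
  The vertex \<open>u\<close> and the path \<open>p 0, \<dots>, p m\<close> form a cycle, and \<open>\<pi>\<close> maps each vertex of \<open>K\<close> to the
  position of the path vertex from which it hangs. Along the path, \<open>\<rho>\<close> takes the values
  \<open>i\<^sup>2 - m i\<close>, raised to 1 at both ends, so that positive values lie above and negative values below
  the average of their neighbours. Off the path, \<open>\<rho>\<close> alternates with the colouring \<open>\<sigma>\<close>.
\<close>

lemma deficient_cycle:
  fixes p :: "nat \<Rightarrow> 'a" and \<pi> :: "'a \<Rightarrow> nat" and \<sigma> :: "'a \<Rightarrow> real"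
  assumes V: "finite V" "V = insert u (K \<union> X)" "u \<notin> K \<union> X" "sep K X"
    and m: "2 \<le> m"
    and p: "\<And>i. i \<le> m \<Longrightarrow> p i \<in> K" "\<And>i. i \<le> m \<Longrightarrow> \<pi> (p i) = i" "\<And>i. i \<le> m \<Longrightarrow> \<sigma> (p i) = 1"
      "\<And>i. i < m \<Longrightarrow> E (p i) (p (Suc i))"
    and \<pi>: "\<And>x. x \<in> K \<Longrightarrow> \<pi> x \<le> m" and \<sigma>: "\<And>x. x \<in> K \<Longrightarrow> \<sigma> x = 1 \<or> \<sigma> x = - 1"
    and adj: "\<And>x y. x \<in> K \<Longrightarrow> y \<in> K \<Longrightarrow> x \<noteq> y \<Longrightarrow> E x y \<Longrightarrow>
      \<pi> x = \<pi> y \<and> \<sigma> x = - \<sigma> y \<or> (\<exists>i<m. x = p i \<and> y = p (Suc i) \<or> y = p i \<and> x = p (Suc i))"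
    and hang: "\<And>x. x \<in> K \<Longrightarrow> x \<noteq> p (\<pi> x) \<Longrightarrow> \<exists>y\<in>K. y \<noteq> x \<and> E x y"
    and u: "\<And>x. x \<in> K \<Longrightarrow> E u x \<longleftrightarrow> x = p 0 \<or> x = p m"
  shows "deficient V"
proof -
  have K: "finite K" using V by auto
  \<comment> \<open>The sequence i^2 - m i has second difference 2 and is at most -1 strictly
    between the ends.\<close>
  define r where "r i = (if i = 0 \<or> i = m then 1 else real i * real i - real m * real i)" for i
  define \<rho> where "\<rho> x = \<sigma> x * r (\<pi> x)" for x
  define w where "w x y = (of_bool (x \<noteq> y \<and> E x y) :: real)" for x y
  define c where "c x = (if x = p 0 then 1 else if x = p m then - 1 else 0 :: real)" for x
  have inj: "p i \<noteq> p j" if "i \<le> m" "j \<le> m" "i \<noteq> j" for i j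
    using p(2)[OF that(1)] p(2)[OF that(2)] that(3) by metis
  have r_le: "r i \<le> - 1" if "0 < i" "i < m" for i
  proof -
    have "1 \<le> i * (m - i)" using that by (simp add: Suc_le_eq)
    then have "1 \<le> real i * (real m - real i)" using that by (metis of_nat_1 of_nat_diff of_nat_le_iff of_nat_mult less_imp_le)
    then show ?thesis using that by (simp add: r_def algebra_simps)
  qed
  have r_ge: "real i * real i - real m * real i \<le> r i" for i by (simp add: r_def)
  have r_ends: "r 0 = 1" "r m = 1" by (auto simp: r_def)
  have r0: "r i \<noteq> 0" if "i \<le> m" for i
    using r_le[of i] r_ends that by (cases "i = 0 \<or> i = m") (auto simp: le_less)
  have \<rho>0: "\<rho> x \<noteq> 0" if "x \<in> K" for x using r0[OF \<pi>[OF that]] \<sigma>[OF that] by (auto simp: \<rho>_def)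
  have \<rho>p: "\<rho> (p i) = r i" if "i \<le> m" for i using p that by (simp add: \<rho>_def)
  have wsym: "sym_on K w" using E_sym by (auto simp: sym_on_def w_def)
  have wp: "w (p i) (p (Suc i)) = 1" "w (p (Suc i)) (p i) = 1" if "i < m" for i
    using p(4)[OF that] inj[of i "Suc i"] that E_sym by (auto simp: w_def)
  define nb where "nb i = {j. j \<le> m \<and> (j = Suc i \<or> i = Suc j)}" for i
  have nb: "finite (nb i)" for i by (rule finite_subset[of _ "{..m}"]) (auto simp: nb_def)
  have split: "(\<Sum>y\<in>K. w (p i) y * G y) = (\<Sum>j\<in>nb i. G (p j)) + (\<Sum>y\<in>K - p ` nb i. w (p i) y * G y)"
    if i: "i \<le> m" for i G
  proof -
    have "p ` nb i \<subseteq> K" using p(1) by (auto simp: nb_def)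
    then have "(\<Sum>y\<in>K. w (p i) y * G y) = (\<Sum>y\<in>p ` nb i. w (p i) y * G y) + (\<Sum>y\<in>K - p ` nb i. w (p i) y * G y)"
      using K by (simp add: sum.subset_diff add.commute)
    also have "(\<Sum>y\<in>p ` nb i. w (p i) y * G y) = (\<Sum>j\<in>nb i. w (p i) (p j) * G (p j))"
      using inj by (subst sum.reindex) (auto simp: inj_on_def nb_def)
    also have "\<dots> = (\<Sum>j\<in>nb i. G (p j))"
      by (rule sum.cong) (use wp i in \<open>auto simp: nb_def\<close>)
    finally show ?thesis .
  qed
  have off: "\<pi> x = \<pi> y \<and> \<sigma> x = - \<sigma> y"
    if xy: "x \<in> K" "y \<in> K" "w x y \<noteq> 0" "\<And>i. i \<le> m \<Longrightarrow> x = p i \<Longrightarrow> y \<notin> p ` nb i" for x y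
  proof (rule ccontr)
    assume "\<not> ?thesis"
    then obtain i where "i < m" "x = p i \<and> y = p (Suc i) \<or> y = p i \<and> x = p (Suc i)"
      using adj[OF xy(1,2)] xy(3) by (auto simp: w_def)
    then show False using xy(4)[of i] xy(4)[of "Suc i"] by (auto simp: nb_def)
  qed
  have not_path: "x \<noteq> p i" if "x \<in> K" "x \<noteq> p (\<pi> x)" "i \<le> m" for x i using that p(2) by metis
  \<comment> \<open>A function of \<pi> alone has no difference across the edges off the path, so
    its Laplacian is that of the bare path.\<close>
  have wlap_path: "wlap K (\<lambda>x y. w x y * f x y) s (p i) = (\<Sum>j\<in>nb i. f (p i) (p j) * (s (p i) - s (p j)))"
    if i: "i \<le> m" and s: "\<And>x y. \<pi> x = \<pi> y \<Longrightarrow> s x = s y" for f s i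
  proof -
    have "w (p i) y * (f (p i) y * (s (p i) - s y)) = 0" if "y \<in> K - p ` nb i" for y
    proof (cases "w (p i) y = 0")
      case False
      have "y \<notin> p ` nb k" if "k \<le> m" "p i = p k" for k
        using that inj[OF i that(1)] \<open>y \<in> K - p ` nb i\<close> by (cases "i = k") auto
      then have "\<pi> (p i) = \<pi> y" using off[OF p(1)[OF i] _ False] \<open>y \<in> K - p ` nb i\<close> by simp
      then have "s (p i) = s y" by (rule s)
      then show ?thesis by simp
    qed simp
    then have "(\<Sum>y\<in>K - p ` nb i. w (p i) y * (f (p i) y * (s (p i) - s y))) = 0"
      by (intro sum.neutral ballI)
    then show ?thesis using split[OF i, of "\<lambda>y. f (p i) y * (s (p i) - s y)"]
      by (simp add: wlap_def mult.assoc)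
  qed
  have wlap_off: "wlap K (\<lambda>x y. w x y * f x y) s x = 0"
    if x: "x \<in> K" "x \<noteq> p (\<pi> x)" and s: "\<And>x y. \<pi> x = \<pi> y \<Longrightarrow> s x = s y" for f s x
    unfolding wlap_def
  proof (intro sum.neutral ballI)
    fix y assume y: "y \<in> K"
    show "w x y * f x y * (s x - s y) = 0"
    proof (cases "w x y = 0")
      case False
      have "\<pi> x = \<pi> y" using off[OF x(1) y False] not_path[OF x] by blast
      then have "s x = s y" by (rule s)
      then show ?thesis by simp
    qed simp
  qed
  have nb_0: "nb 0 = {1}" and nb_m: "nb m = {m - 1}" using m by (auto simp: nb_def)
  have nb_int: "nb i = {i - 1, Suc i}" if "0 < i" "i < m" for i using that by (auto simp: nb_def)
  \<comment> \<open>The quotient is the sum of \<open>w x y * (1 - \<rho> y / \<rho> x)\<close>. An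
    edge off the path contributes 2, since \<rho> changes its sign there; the path edges depend on
    the shape of \<open>r\<close>.\<close>
  have pos: "0 < wlap K w \<rho> x / \<rho> x" if x: "x \<in> K" for x
  proof -
    have summand: "0 \<le> w x y * (1 - \<rho> y / \<rho> x) \<and> (w x y \<noteq> 0 \<longrightarrow> 0 < w x y * (1 - \<rho> y / \<rho> x))"
      if "y \<in> K" "\<And>i. i \<le> m \<Longrightarrow> x = p i \<Longrightarrow> y \<notin> p ` nb i" for y
    proof (cases "w x y = 0")
      case False
      have "\<rho> y = - \<rho> x" using off[OF x that(1) False that(2)] by (simp add: \<rho>_def)
      then show ?thesis using \<rho>0[OF x] by (simp add: w_def)
    qed simp
    have eq: "wlap K w \<rho> x / \<rho> x = (\<Sum>y\<in>K. w x y * (1 - \<rho> y / \<rho> x))"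
      unfolding wlap_def sum_divide_distrib by (intro sum.cong) (use \<rho>0[OF x] in \<open>auto simp: field_simps\<close>)
    show ?thesis
    proof (cases "x = p (\<pi> x)")
      case False
      then obtain y where y: "y \<in> K" "y \<noteq> x" "E x y" using hang[OF x] by blast
      have tm: "0 \<le> w x y * (1 - \<rho> y / \<rho> x) \<and> (w x y \<noteq> 0 \<longrightarrow> 0 < w x y * (1 - \<rho> y / \<rho> x))"
        if "y \<in> K" for y by (rule summand[OF that]) (use not_path[OF x False] in blast)
      have "0 < w x y * (1 - \<rho> y / \<rho> x)" using tm[OF y(1)] y by (auto simp: w_def)
      also have "\<dots> \<le> (\<Sum>y\<in>K. w x y * (1 - \<rho> y / \<rho> x))" using y(1) K tm by (intro member_le_sum) auto
      finally show ?thesis using eq by simp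
    next
      case True
      define i where "i = \<pi> x"
      have i: "x = p i" "i \<le> m" using True \<pi>[OF x] by (auto simp: i_def)
      have nbr: "\<rho> (p j) = r j" if "j \<in> nb i" for j using that by (intro \<rho>p) (auto simp: nb_def)
      have "0 < (\<Sum>j\<in>nb i. 1 - \<rho> (p j) / r i)"
      proof -
        consider "i = 0" | "i = m" | "0 < i" "i < m" using i(2) by linarith
        then show ?thesis
        proof cases
          case 1
          then show ?thesis using r_le[of 1] m by (simp add: nb_0 \<rho>p r_ends)
        next
          case 2
          then show ?thesis using r_le[of "m - 1"] m by (simp add: nb_m \<rho>p r_ends)
        next
          case 3
          \<comment> \<open>The second difference stays at least 2, because raising the ends can
            only increase it.\<close>
          have "r (i - 1) + r (Suc i) \<ge> 2 * r i + 2"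
            using r_ge[of "i - 1"] r_ge[of "Suc i"] 3 by (simp add: r_def of_nat_diff algebra_simps)
          moreover have neg: "r i < 0" using r_le[OF 3] by simp
          moreover have "(\<Sum>j\<in>nb i. 1 - \<rho> (p j) / r i) = (1 - r (i - 1) / r i) + (1 - r (Suc i) / r i)"
            using 3 by (simp add: nb_int \<rho>p)
          moreover have "(1 - r (i - 1) / r i) + (1 - r (Suc i) / r i)
            = (2 * r i - r (i - 1) - r (Suc i)) / r i"
            using neg by (simp add: diff_divide_distrib)
          moreover have "0 < (2 * r i - r (i - 1) - r (Suc i)) / r i"
            using calculation by (intro divide_neg_neg) auto
          ultimately show ?thesis by simp
        qed
      qed
      moreover have "0 \<le> (\<Sum>y\<in>K - p ` nb i. w x y * (1 - \<rho> y / \<rho> x))"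
      proof (rule sum_nonneg)
        fix y assume y: "y \<in> K - p ` nb i"
        have "y \<notin> p ` nb k" if "k \<le> m" "x = p k" for k
          using that inj[OF i(2) that(1)] y i(1) by (cases "i = k") auto
        then show "0 \<le> w x y * (1 - \<rho> y / \<rho> x)" using summand[of y] y by blast
      qed
      ultimately show ?thesis
        unfolding eq using split[OF i(2), of "\<lambda>y. 1 - \<rho> y / \<rho> x"] i by (simp add: \<rho>p)
    qed
  qed
  \<comment> \<open>A unit current enters at \<open>p 0\<close> and leaves at \<open>p m\<close>:
    \<open>s1\<close> is its potential for unit conductances, and \<open>s2\<close> for the
    conductances \<open>r j * r (Suc j)\<close>.\<close>
  define s1 where "s1 x = - real (\<pi> x)" for x
  define S where "S i = - (\<Sum>j<i. 1 / (r j * r (Suc j)))" for i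
  define s2 where "s2 x = S (\<pi> x)" for x
  have cp: "c (p i) = (if i = 0 then 1 else if i = m then - 1 else 0)" if "i \<le> m" for i
    using that m inj[of i 0] inj[of i m] by (auto simp: c_def)
  have c_off: "c x = 0" if "x \<in> K" "x \<noteq> p (\<pi> x)" for x
    using not_path[OF that, of 0] not_path[OF that, of m] by (auto simp: c_def)
  have step: "r i * r (Suc i) * (S i - S (Suc i)) = 1" if "i < m" for i
    using r0[of i] r0[of "Suc i"] that by (simp add: S_def)
  have sum_c: "(\<Sum>x\<in>K. c x * f x) = f (p 0) - f (p m)" for f
  proof -
    have "(\<Sum>x\<in>K. c x * f x) = (\<Sum>x\<in>{p 0, p m}. c x * f x)"
      using K p(1) by (intro sum.mono_neutral_right) (auto simp: c_def)
    then show ?thesis using inj[of 0 m] m by (simp add: c_def)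
  qed
  show ?thesis
  proof (rule deficient_two_states[OF V _ wsym, of \<rho> c s1 s2])
    show "K \<noteq> {}" using p(1)[of 0] by auto
    show "w x y \<noteq> 0 \<longleftrightarrow> E x y" if "x \<noteq> y" for x y using that by (simp add: w_def)
    show "\<rho> x \<noteq> 0" "0 < wlap K w \<rho> x / \<rho> x" if "x \<in> K" for x using \<rho>0 pos that by auto
    show "c x \<noteq> 0 \<longleftrightarrow> E u x" if "x \<in> K" for x using u[OF that] by (auto simp: c_def)
  next
    fix x assume x: "x \<in> K"
    have s: "s1 x = s1 y" "s2 x = s2 y" if "\<pi> x = \<pi> y" for x y using that by (auto simp: s1_def s2_def)
    show "wlap K w s1 x = c x"
    proof (cases "x = p (\<pi> x)")
      case False
      then show ?thesis using wlap_off[OF x False s(1), where f = "\<lambda>_ _. 1"] c_off[OF x] by simp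
    next
      case True
      define i where "i = \<pi> x"
      have i: "x = p i" "i \<le> m" using True \<pi>[OF x] by (auto simp: i_def)
      have "wlap K w s1 x = (\<Sum>j\<in>nb i. s1 (p i) - s1 (p j))"
        using wlap_path[OF i(2) s(1), where f = "\<lambda>_ _. 1"] unfolding i(1) by simp
      also have "\<dots> = (\<Sum>j\<in>nb i. real j - real i)"
        by (rule sum.cong) (use i(2) p(2) in \<open>auto simp: nb_def s1_def\<close>)
      also consider "i = 0" | "i = m" | "0 < i" "i < m" using i(2) by linarith
      then have "(\<Sum>j\<in>nb i. real j - real i) = c x"
      proof cases
        case 1 then show ?thesis using cp[OF i(2)] i by (simp add: nb_0)
      next
        case 2 then show ?thesis using cp[OF i(2)] i m by (simp add: nb_m of_nat_diff)
      next
        case 3 then show ?thesis using cp[OF i(2)] i by (simp add: nb_int of_nat_diff)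
      qed
      finally show ?thesis .
    qed
    show "wlap K (\<lambda>x y. w x y * \<rho> x * \<rho> y) s2 x = \<rho> x * c x"
    proof (cases "x = p (\<pi> x)")
      case False
      then show ?thesis using wlap_off[OF x False s(2), where f = "\<lambda>x y. \<rho> x * \<rho> y"] c_off[OF x]
        by (simp add: mult.assoc)
    next
      case True
      define i where "i = \<pi> x"
      have i: "x = p i" "i \<le> m" using True \<pi>[OF x] by (auto simp: i_def)
      have "wlap K (\<lambda>x y. w x y * \<rho> x * \<rho> y) s2 x = (\<Sum>j\<in>nb i. \<rho> (p i) * \<rho> (p j) * (s2 (p i) - s2 (p j)))"
        using wlap_path[OF i(2) s(2), where f = "\<lambda>x y. \<rho> x * \<rho> y"] unfolding i(1) by (simp add: mult.assoc)
      also have "\<dots> = (\<Sum>j\<in>nb i. r i * r j * (S i - S j))"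
        by (rule sum.cong) (use i p(2) in \<open>auto simp: \<rho>p nb_def s2_def\<close>)
      also consider "i = 0" | "i = m" | "0 < i" "i < m" using i(2) by linarith
      then have "(\<Sum>j\<in>nb i. r i * r j * (S i - S j)) = \<rho> x * c x"
      proof cases
        case 1 then show ?thesis using step[of 0] cp[OF i(2)] i m by (simp add: nb_0 \<rho>p r_ends)
      next
        case 2
        obtain k where k: "m = Suc k" using m by (cases m) auto
        have "nb (Suc k) = {k}" using nb_m by (simp add: k)
        then show ?thesis using 2 step[of k] cp[OF i(2)] i r_ends(2) by (simp add: \<rho>p k algebra_simps)
      next
        case 3
        then obtain k where k: "i = Suc k" by (cases i) auto
        show ?thesis using 3 step[of k] step[of i] cp[OF i(2)] i by (simp add: nb_int k algebra_simps)
      qed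
      finally show ?thesis .
    qed
  next
    \<comment> \<open>The products are the resistances between the ends: \<open>m\<close> at
      eigenvalue 0, and the sum of \<open>1 / (r j * r (Suc j))\<close> at eigenvalue 1. No summand
      exceeds 1, and the first is not positive because \<open>r\<close> changes its sign at the
      end.\<close>
    have le: "1 / (r j * r (Suc j)) \<le> 1" if "j < m" for j
    proof (cases "0 < j \<and> Suc j < m")
      case True
      have "1 * 1 \<le> (- r j) * (- r (Suc j))"
        using r_le[of j] r_le[of "Suc j"] True by (intro mult_mono) auto
      then show ?thesis by (simp add: divide_le_eq_1)
    next
      case False
      have "r j * r (Suc j) \<le> 0"
        using r_le[of j] r_le[of "Suc j"] False that m r_ends
        by (cases "j = 0"; cases "Suc j = m") (auto simp: mult_le_0_iff)
      then show ?thesis by (smt (verit) divide_nonneg_nonpos)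
    qed
    have "1 / (r 0 * r (Suc 0)) \<le> 0"
      using r_le[of 1] m by (simp add: r_ends divide_le_0_iff)
    then have "1 / (r 0 * r (Suc 0)) < 1" by linarith
    then have "\<exists>j\<in>{..<m}. 1 / (r j * r (Suc j)) < 1" using m by (intro bexI[of _ 0]) auto
    then have "(\<Sum>j<m. 1 / (r j * r (Suc j))) < (\<Sum>j<m. 1)"
      using le by (intro sum_strict_mono_ex1) auto
    then have "- S m < real m" by (simp add: S_def)
    moreover have "(\<Sum>x\<in>K. \<rho> x * c x * s2 x) = - S m"
    proof -
      have "(\<Sum>x\<in>K. \<rho> x * c x * s2 x) = (\<Sum>x\<in>K. c x * (\<rho> x * s2 x))" by (simp add: mult_ac)
      also have "\<dots> = \<rho> (p 0) * s2 (p 0) - \<rho> (p m) * s2 (p m)" by (rule sum_c)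
      also have "\<dots> = S 0 - S m" by (simp add: \<rho>p r_ends s2_def p(2))
      finally show ?thesis by (simp add: S_def)
    qed
    moreover have "(\<Sum>x\<in>K. c x * s1 x) = real m"
      using sum_c[of s1] by (simp add: s1_def p(2))
    ultimately show "(\<Sum>x\<in>K. \<rho> x * c x * s2 x) < (\<Sum>x\<in>K. c x * s1 x)" by simp
  qed
qed

end

section \<open>Trees\<close>

locale simple_rel = sym_rel +
  assumes E_irrefl: "\<not> E x x"
begin

definition pathlist :: "'a set \<Rightarrow> 'a list \<Rightarrow> bool" where
  "pathlist V xs \<longleftrightarrow> xs \<noteq> [] \<and> distinct xs \<and> set xs = V \<and>
     (\<forall>i<length xs. \<forall>j<length xs. E (xs ! i) (xs ! j) \<longleftrightarrow> j = Suc i \<or> i = Suc j)"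

definition component :: "'a set \<Rightarrow> 'a \<Rightarrow> 'a set" where
  "component X x = {y \<in> X. (adj_on X)\<^sup>*\<^sup>* x y}"

text \<open>A cycle is witnessed by a vertex \<open>u\<close> and two neighbours that stay connected
  without \<open>u\<close>. This is the shape that the constructions consume: a vertex with two
  neighbours in one branch.\<close>

definition acyclic_on :: "'a set \<Rightarrow> bool" where
  "acyclic_on V \<longleftrightarrow> (\<forall>u\<in>V. \<forall>a\<in>V. \<forall>b\<in>V. E u a \<longrightarrow> E u b \<longrightarrow> (adj_on (V - {u}))\<^sup>*\<^sup>* a b \<longrightarrow> a = b)"

definition max_degree_two :: "'a set \<Rightarrow> bool" where
  "max_degree_two V \<longleftrightarrow> (\<forall>u\<in>V. \<forall>x\<in>V. \<forall>y\<in>V. \<forall>z\<in>V. E u x \<longrightarrow> E u y \<longrightarrow> E u z \<longrightarrow> x = y \<or> x = z \<or> y = z)"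

lemma adj_on_mono: "X \<subseteq> Y \<Longrightarrow> (adj_on X)\<^sup>*\<^sup>* x y \<Longrightarrow> (adj_on Y)\<^sup>*\<^sup>* x y"
  by (rule rtranclp_mono[THEN predicate2D]) (auto simp: adj_on_def)

lemma adj_on_rtrancl_sym: "(adj_on X)\<^sup>*\<^sup>* x y \<Longrightarrow> (adj_on X)\<^sup>*\<^sup>* y x"
  by (metis adj_on_sym symp_def symp_rtranclp)

lemma component_self: "x \<in> X \<Longrightarrow> x \<in> component X x"
  by (simp add: component_def)

lemma component_subset: "component X x \<subseteq> X"
  by (auto simp: component_def)

lemma component_closed: "y \<in> component X x \<Longrightarrow> z \<in> X \<Longrightarrow> E y z \<Longrightarrow> z \<in> component X x"
  unfolding component_def by (auto simp: adj_on_def elim!: rtranclp.rtrancl_into_rtrancl)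

lemma component_sep: "sep (component X x) (X - component X x)"
  using component_closed by (fastforce simp: sep_def)

lemma connI:
  assumes "\<And>y. y \<in> X \<Longrightarrow> (adj_on X)\<^sup>*\<^sup>* r y"
  shows "conn X"
  unfolding conn_def using assms adj_on_rtrancl_sym by (meson rtranclp_trans)

lemma conn_component: "conn (component X x)"
proof (rule connI)
  fix y assume "y \<in> component X x"
  then have y: "y \<in> X" "(adj_on X)\<^sup>*\<^sup>* x y" by (auto simp: component_def)
  from y(2,1) show "(adj_on (component X x))\<^sup>*\<^sup>* x y"
  proof (induction rule: rtranclp_induct)
    case (step y z)
    then have "y \<in> X" "z \<in> X" "E y z" by (auto simp: adj_on_def)
    moreover have "y \<in> component X x" using step.hyps(1) \<open>y \<in> X\<close> by (simp add: component_def)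
    ultimately have "adj_on (component X x) y z" using component_closed by (auto simp: adj_on_def)
    with step.IH \<open>y \<in> X\<close> show ?case by (metis rtranclp.rtrancl_into_rtrancl)
  qed simp
qed

lemma components_sep:
  assumes "y \<notin> component X x"
  shows "sep (component X x) (component X y)"
proof (rule sep_mono[OF component_sep order_refl])
  show "component X y \<subseteq> X - component X x"
  proof
    fix z assume z: "z \<in> component X y"
    have "z \<notin> component X x"
    proof
      assume "z \<in> component X x"
      with z have "(adj_on X)\<^sup>*\<^sup>* x z" "(adj_on X)\<^sup>*\<^sup>* z y"
        by (simp_all add: component_def adj_on_rtrancl_sym)
      then have xy: "(adj_on X)\<^sup>*\<^sup>* x y" by (rule rtranclp_trans)
      have "y \<in> X"
      proof (cases "y = z")
        case True
        then show ?thesis using z by (simp add: component_def)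
      next
        case False
        moreover have "(adj_on X)\<^sup>*\<^sup>* y z" using z by (simp add: component_def)
        ultimately show ?thesis by (auto simp: adj_on_def elim: converse_rtranclpE)
      qed
      with xy assms show False by (simp add: component_def)
    qed
    with z show "z \<in> X - component X x" by (simp add: component_def)
  qed
qed

lemma conn_closed_subset:
  assumes "conn V" "A \<subseteq> V" "A \<noteq> {}" "\<And>x y. x \<in> A \<Longrightarrow> y \<in> V \<Longrightarrow> E x y \<Longrightarrow> y \<in> A"
  shows "A = V"
proof
  show "V \<subseteq> A"
  proof
    fix y assume y: "y \<in> V"
    obtain x where x: "x \<in> A" using assms(3) by blast
    have "(adj_on V)\<^sup>*\<^sup>* x y" using assms x y by (auto simp: conn_def)
    then show "y \<in> A"
    proof induction
      case base show ?case by (rule x)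
    next
      case (step y z)
      then show ?case using assms(4) by (auto simp: adj_on_def)
    qed
  qed
qed (rule assms)

lemma pathlist_nth: "pathlist V xs \<Longrightarrow> i < length xs \<Longrightarrow> j < length xs \<Longrightarrow> E (xs ! i) (xs ! j) \<longleftrightarrow> j = Suc i \<or> i = Suc j"
  by (simp add: pathlist_def)

lemma pathlist_rev:
  assumes "pathlist V xs"
  shows "pathlist V (rev xs)"
  unfolding pathlist_def
proof (intro conjI allI impI)
  fix i j assume "i < length (rev xs)" "j < length (rev xs)"
  then show "E (rev xs ! i) (rev xs ! j) \<longleftrightarrow> j = Suc i \<or> i = Suc j"
    using pathlist_nth[OF assms, of "length xs - Suc i" "length xs - Suc j"] by (auto simp: rev_nth)
qed (use assms in \<open>auto simp: pathlist_def\<close>)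

lemma pathlist_max_degree_two:
  assumes "pathlist V xs"
  shows "max_degree_two V"
  unfolding max_degree_two_def
proof (intro ballI impI)
  fix u x y z assume V: "u \<in> V" "x \<in> V" "y \<in> V" "z \<in> V" and E: "E u x" "E u y" "E u z"
  have "\<exists>i<length xs. v = xs ! i" if "v \<in> V" for v
    using that assms by (auto simp: pathlist_def in_set_conv_nth)
  then obtain i j k l where "i < length xs" "u = xs ! i" "j < length xs" "x = xs ! j"
    "k < length xs" "y = xs ! k" "l < length xs" "z = xs ! l" using V by metis
  moreover from this have "j = Suc i \<or> i = Suc j" "k = Suc i \<or> i = Suc k" "l = Suc i \<or> i = Suc l"
    using E pathlist_nth[OF assms] by auto
  then have "j = k \<or> j = l \<or> k = l" by linarith
  ultimately show "x = y \<or> x = z \<or> y = z" by blast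
qed

lemma chain_rtrancl:
  assumes "set xs \<subseteq> X" "\<And>i. Suc i < length xs \<Longrightarrow> E (xs ! i) (xs ! Suc i)" "i < length xs" "j < length xs"
  shows "(adj_on X)\<^sup>*\<^sup>* (xs ! i) (xs ! j)"
proof -
  have "(adj_on X)\<^sup>*\<^sup>* (xs ! 0) (xs ! k)" if "k < length xs" for k
    using that
  proof (induction k)
    case (Suc k)
    then have "adj_on X (xs ! k) (xs ! Suc k)" using assms(1,2) by (auto simp: adj_on_def subset_iff)
    with Suc show ?case by (auto intro: rtranclp.rtrancl_into_rtrancl)
  qed simp
  then show ?thesis using assms(3,4) adj_on_rtrancl_sym by (meson rtranclp_trans)
qed

lemma pathlist_conn:
  assumes "pathlist V xs"
  shows "conn V"
proof -
  have "(adj_on V)\<^sup>*\<^sup>* (xs ! i) (xs ! j)" if "i < length xs" "j < length xs" for i j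
    by (rule chain_rtrancl) (use assms that in \<open>auto simp: pathlist_def\<close>)
  moreover have "set xs = V" using assms by (simp add: pathlist_def)
  ultimately show ?thesis by (auto simp: conn_def in_set_conv_nth)
qed

text \<open>Take a longest path. Its inner vertices have both their neighbours on it and its ends
  cannot be continued, so it is closed under adjacency and covers \<open>V\<close>.\<close>

lemma path_of_max_degree_two:
  assumes V: "finite V" "V \<noteq> {}" "conn V" and deg: "max_degree_two V" and acyc: "acyclic_on V"
  obtains xs where "pathlist V xs"
proof -
  define P where "P xs \<longleftrightarrow> xs \<noteq> [] \<and> distinct xs \<and> set xs \<subseteq> V \<and> (\<forall>i. Suc i < length xs \<longrightarrow> E (xs ! i) (xs ! Suc i))" for xs
  obtain v where "v \<in> V" using V by blast
  then have "P [v]" by (simp add: P_def)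
  moreover have "\<forall>xs. P xs \<longrightarrow> length xs < Suc (card V)"
    unfolding P_def by (metis V(1) card_mono distinct_card le_imp_less_Suc)
  ultimately obtain xs where xs: "P xs" and max: "\<And>ys. P ys \<Longrightarrow> length ys \<le> length xs"
    using ex_has_greatest_nat[of P "[v]" length "Suc (card V)"] by blast
  have ne: "xs \<noteq> []" "distinct xs" "set xs \<subseteq> V" and step: "\<And>i. Suc i < length xs \<Longrightarrow> E (xs ! i) (xs ! Suc i)"
    using xs by (auto simp: P_def)
  have inV: "xs ! i \<in> V" if "i < length xs" for i using that ne(3) by (meson nth_mem subsetD)
  have inner: "y = xs ! (i - 1) \<or> y = xs ! Suc i"
    if i: "0 < i" "Suc i < length xs" and y: "y \<in> V" "E (xs ! i) y" for i y
  proof -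
    have "E (xs ! i) (xs ! (i - 1))" "E (xs ! i) (xs ! Suc i)"
      using step[of "i - 1"] step[of i] i E_sym by auto
    moreover have "xs ! (i - 1) \<noteq> xs ! Suc i" using ne(2) i by (simp add: nth_eq_iff_index_eq)
    moreover have "xs ! i \<in> V" "xs ! (i - 1) \<in> V" "xs ! Suc i \<in> V" using inV i by auto
    ultimately show ?thesis using deg y unfolding max_degree_two_def by blast
  qed
  have nbr: "y \<in> set xs" if i: "i < length xs" and y: "y \<in> V" "E (xs ! i) y" for i y
  proof (rule ccontr)
    assume no: "y \<notin> set xs"
    consider "0 < i" "Suc i < length xs" | "i = 0" | "Suc i = length xs" using i by linarith
    then show False
    proof cases
      case 1
      then show False using inner[OF 1 y] no i by auto
    next
      case 2
      have "P (y # xs)" unfolding P_def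
      proof (intro conjI allI impI)
        fix j assume "Suc j < length (y # xs)"
        then show "E ((y # xs) ! j) ((y # xs) ! Suc j)" using 2 y step[of "j - 1"] E_sym by (cases j) auto
      qed (use ne no y in auto)
      from max[OF this] show False by simp
    next
      case 3
      have "P (xs @ [y])" unfolding P_def
      proof (intro conjI allI impI)
        fix j assume "Suc j < length (xs @ [y])"
        then show "E ((xs @ [y]) ! j) ((xs @ [y]) ! Suc j)"
          using 3[symmetric] y step[of j] by (cases "j = i") (auto simp: nth_append)
      qed (use ne no y in auto)
      from max[OF this] show False by simp
    qed
  qed
  have "set xs = V"
    by (rule conn_closed_subset[OF V(3) ne(3)]) (use ne(1) nbr in \<open>auto simp: in_set_conv_nth\<close>)
  \<comment> \<open>By the degree bound a chord could only join the two ends, and this would close a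
    cycle through \<open>xs ! 0\<close>.\<close>
  have forward: "j = Suc i" if ij: "i < j" "j < length xs" and e: "E (xs ! i) (xs ! j)" for i j
  proof (rule ccontr)
    assume n: "j \<noteq> Suc i"
    have e': "E (xs ! j) (xs ! i)" using e E_sym by blast
    have eq: "xs ! k = xs ! l \<longleftrightarrow> k = l" if "k < length xs" "l < length xs" for k l
      using that ne(2) by (simp add: nth_eq_iff_index_eq)
    have i0: "i = 0"
    proof (rule ccontr)
      assume "i \<noteq> 0"
      then have "xs ! j = xs ! (i - 1) \<or> xs ! j = xs ! Suc i"
        using ij by (intro inner e inV) auto
      moreover have "xs ! j = xs ! (i - 1) \<longleftrightarrow> j = i - 1" "xs ! j = xs ! Suc i \<longleftrightarrow> j = Suc i"
        by (rule eq; use ij in linarith)+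
      ultimately show False using ij n by linarith
    qed
    have "Suc j = length xs"
    proof (rule ccontr)
      assume "Suc j \<noteq> length xs"
      then have len: "Suc j < length xs" using ij by linarith
      then have "xs ! i = xs ! (j - 1) \<or> xs ! i = xs ! Suc j"
        using ij by (intro inner e' inV) auto
      moreover have "xs ! i = xs ! (j - 1) \<longleftrightarrow> i = j - 1" "xs ! i = xs ! Suc j \<longleftrightarrow> i = Suc j"
        by (rule eq; use ij len in linarith)+
      ultimately show False using ij n by linarith
    qed
    let ?u = "xs ! 0"
    have "(adj_on (V - {?u}))\<^sup>*\<^sup>* (tl xs ! 0) (tl xs ! (j - 1))"
    proof (rule chain_rtrancl)
      show "set (tl xs) \<subseteq> V - {?u}" using ne by (cases xs) auto
    qed (use ij i0 n step in \<open>auto simp: nth_tl\<close>)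
    then have "(adj_on (V - {?u}))\<^sup>*\<^sup>* (xs ! 1) (xs ! j)" using ij i0 n by (simp add: nth_tl)
    moreover have "E ?u (xs ! 1)" "E ?u (xs ! j)" using step[of 0] e i0 ij n by auto
    moreover have "?u \<in> V" "xs ! 1 \<in> V" "xs ! j \<in> V" using inV[of 0] inV[of 1] inV[of j] ne(1) ij i0 n by auto
    ultimately have "xs ! 1 = xs ! j" using acyc unfolding acyclic_on_def by blast
    then show False using eq[of 1 j] ij i0 n by auto
  qed
  have "pathlist V xs"
    unfolding pathlist_def
  proof (intro conjI allI impI)
    fix i j assume ij: "i < length xs" "j < length xs"
    show "E (xs ! i) (xs ! j) \<longleftrightarrow> j = Suc i \<or> i = Suc j"
    proof
      assume e: "E (xs ! i) (xs ! j)"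
      then have "i \<noteq> j" using E_irrefl by metis
      then show "j = Suc i \<or> i = Suc j" using forward[of i j] forward[of j i] e E_sym ij by (metis nat_neq_iff)
    next
      assume "j = Suc i \<or> i = Suc j"
      then show "E (xs ! i) (xs ! j)" using step E_sym ij by auto
    qed
  qed (use ne \<open>set xs = V\<close> in auto)
  then show ?thesis by (rule that)
qed

text \<open>A graph that is no path is disconnected, or has a cycle, or has a vertex with three
  branches, and each case has its own construction of nullity two.\<close>

lemma doubly_singular_of_not_path:
  assumes V: "finite V" "V \<noteq> {}" and no: "\<nexists>xs. pathlist V xs"
  shows "doubly_singular V"
proof (cases "conn V")
  case False
  then obtain x y where xy: "x \<in> V" "y \<in> V" "\<not> (adj_on V)\<^sup>*\<^sup>* x y" by (auto simp: conn_def)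
  show ?thesis
  proof (rule doubly_singular_disconnected[OF V(1)])
    show "V = component V x \<union> (V - component V x)" using component_subset by auto
    show "component V x \<noteq> {}" using component_self xy(1) by auto
    have "y \<notin> component V x" using xy(3) by (simp add: component_def)
    then show "V - component V x \<noteq> {}" using xy(2) by auto
    show "sep (component V x) (V - component V x)" by (rule component_sep)
  qed
next
  case True
  show ?thesis
  proof (cases "acyclic_on V")
    case False
    then obtain u a b where u: "u \<in> V" "a \<in> V" "b \<in> V" "E u a" "E u b" "(adj_on (V - {u}))\<^sup>*\<^sup>* a b" "a \<noteq> b"
      by (auto simp: acyclic_on_def)
    let ?K = "component (V - {u}) a"
    have ab: "a \<in> V - {u}" "b \<in> V - {u}" using u E_irrefl by auto
    show ?thesis
    proof (rule doubly_singular_two_neighbours[OF V(1), of u ?K "V - {u} - ?K" a b])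
      show "V = insert u (?K \<union> (V - {u} - ?K))" using u(1) component_subset[of "V - {u}" a] by auto
      show "u \<notin> ?K \<union> (V - {u} - ?K)" using component_subset[of "V - {u}" a] by auto
      show "b \<in> ?K" using ab u(6) by (simp add: component_def)
    qed (use u ab component_self component_sep conn_component in auto)
  next
    case acyc: True
    obtain u x y z where u: "u \<in> V" "x \<in> V" "y \<in> V" "z \<in> V" "E u x" "E u y" "E u z" "x \<noteq> y" "x \<noteq> z" "y \<noteq> z"
      using path_of_max_degree_two[OF V True _ acyc] no unfolding max_degree_two_def by metis
    let ?X = "component (V - {u}) x" and ?Y = "component (V - {u}) y"
    have xyz: "x \<in> V - {u}" "y \<in> V - {u}" "z \<in> V - {u}" using u E_irrefl by auto
    have "y \<notin> ?X" "z \<notin> ?X" "z \<notin> ?Y"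
      using acyc u by (auto simp: component_def acyclic_on_def)
    show ?thesis
    proof (rule doubly_singular_three_branches[OF V(1), of u ?X ?Y "V - {u} - ?X - ?Y"])
      show "V = insert u (?X \<union> ?Y \<union> (V - {u} - ?X - ?Y))" using u(1) component_subset[of "V - {u}"] by blast
      show "u \<notin> ?X \<union> ?Y \<union> (V - {u} - ?X - ?Y)" using component_subset[of "V - {u}"] by blast
      show "?X \<noteq> {}" using component_self[OF xyz(1)] by blast
      show "?Y \<noteq> {}" using component_self[OF xyz(2)] by blast
      show "V - {u} - ?X - ?Y \<noteq> {}" using xyz \<open>z \<notin> ?X\<close> \<open>z \<notin> ?Y\<close> by blast
      show "sep ?X ?Y" by (rule components_sep) fact
      show "sep ?X (V - {u} - ?X - ?Y)" by (rule sep_mono[OF component_sep]) auto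
      show "sep ?Y (V - {u} - ?X - ?Y)" by (rule sep_mono[OF component_sep]) auto
    qed
  qed
qed

definition path_with_leaf :: "'a set \<Rightarrow> bool" where
  "path_with_leaf V \<longleftrightarrow> (\<exists>xs w i. pathlist (set xs) xs \<and> w \<notin> set xs \<and> V = insert w (set xs) \<and>
     0 < i \<and> i + 1 < length xs \<and> (\<forall>y\<in>set xs. E w y \<longleftrightarrow> y = xs ! i))"

lemma acyclic_on_subset: "acyclic_on V \<Longrightarrow> U \<subseteq> V \<Longrightarrow> acyclic_on U"
  unfolding acyclic_on_def using adj_on_mono[of "U - {_}" "V - {_}"] by (meson Diff_mono order_refl subsetD)

lemma adj_on_insert:
  assumes "conn K" "y \<in> K" "E u y" "K \<subseteq> V" "u \<in> V" "x \<in> K"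
  shows "(adj_on V)\<^sup>*\<^sup>* u x"
proof -
  have "(adj_on V)\<^sup>*\<^sup>* y x" by (rule adj_on_mono[OF assms(4)]) (use assms in \<open>auto simp: conn_def\<close>)
  moreover have "adj_on V u y" using assms by (auto simp: adj_on_def)
  ultimately show ?thesis by (rule converse_rtranclp_into_rtranclp[rotated])
qed

text \<open>
  In a tree with a vertex \<open>u\<close> that has the branches \<open>{w}\<close>, \<open>K2\<close> and \<open>K3\<close>, a further vertex \<open>v\<close> of
  degree three in \<open>K2\<close> is either adjacent to \<open>u\<close>, or it is separated from \<open>u\<close> by a neighbour of \<open>u\<close>.
\<close>

lemma deficient_second_branching:
  assumes V: "finite V" "V = insert u ({w} \<union> K2 \<union> K3)" "u \<notin> {w} \<union> K2 \<union> K3"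
    and sep: "sep {w} K2" "sep {w} K3" "sep K2 K3" and acyc: "acyclic_on V"
    and u: "E u w" "y2 \<in> K2" "y3 \<in> K3" "E u y3" "\<And>y. y \<in> K2 \<Longrightarrow> E u y \<longleftrightarrow> y = y2"
    and v: "v \<in> K2" "x \<in> V" "y \<in> V" "z \<in> V" "E v x" "E v y" "E v z" "x \<noteq> y" "x \<noteq> z" "y \<noteq> z"
  shows "deficient V"
proof -
  have disj: "w \<notin> K2" "w \<notin> K3" "K2 \<inter> K3 = {}" using sep by (auto simp: sep_def)
  have fin: "finite K2" "finite K3" using V by auto
  have nbrK2: "t \<in> K2 \<or> t = u" if "s \<in> K2" "t \<in> V" "E s t" for s t
    using that sep E_sym V(2) unfolding sep_def by blast
  show ?thesis
  proof (cases "v = y2")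
    case True
    have "E v u" using u(2,5) True E_sym by blast
    obtain t1 t2 where t: "t1 \<in> K2" "t2 \<in> K2" "E v t1" "E v t2" "t1 \<noteq> t2"
      using v nbrK2[OF v(1)] by metis
    have tv: "t1 \<noteq> v" "t2 \<noteq> v" "u \<noteq> v" using t E_irrefl v(1) V(3) by auto
    let ?B1 = "component (V - {v}) t1"
    have sub: "?B1 \<subseteq> K2 - {v}"
    proof
      fix s assume "s \<in> ?B1"
      then have "(adj_on (V - {v}))\<^sup>*\<^sup>* t1 s" by (simp add: component_def)
      then show "s \<in> K2 - {v}"
      proof induction
        case base then show ?case using t(1) tv by blast
      next
        case (step s s')
        then have "s' \<in> V" "s' \<noteq> v" "E s s'" by (auto simp: adj_on_def)
        moreover have "s' \<noteq> u" using step.IH u(5) True E_sym calculation(3) by blast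
        ultimately show ?case using nbrK2[of s s'] step.IH by blast
      qed
    qed
    \<comment> \<open>Without \<open>v\<close>, the set \<open>K2\<close> falls apart into the
      branch of \<open>t1\<close> and a rest that contains \<open>t2\<close>, as there is no
      cycle.\<close>
    let ?B2 = "K2 - {v} - ?B1"
    have KV: "K2 \<subseteq> V" using V(2) by auto
    have t12: "t1 \<in> ?B1" using component_self[of t1 "V - {v}"] t(1) tv KV by blast
    have t2: "t2 \<in> ?B2"
    proof -
      have "t2 \<notin> ?B1"
        using acyc t KV v(1) unfolding acyclic_on_def component_def by blast
      then show ?thesis using t(2) tv by blast
    qed
    have B: "?B1 \<union> ?B2 = K2 - {v}" using sub by blast
    show ?thesis
    proof (rule deficient_adjacent_branchings[OF V(1), of u "{w}" K3 v ?B1 ?B2])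
      show "V = insert u ({w} \<union> K3) \<union> insert v (?B1 \<union> ?B2)" unfolding B using V(2) v(1) by blast
      show "sep ?B1 ?B2" by (rule sep_mono[OF component_sep order_refl]) (use KV in blast)
      show "sep ({w} \<union> K3) (insert v (?B1 \<union> ?B2))"
        unfolding B sep_Un using sep sep_sym v(1) by (simp add: insert_absorb)
      show "sep (?B1 \<union> ?B2) (insert u ({w} \<union> K3))"
      proof -
        have "\<not> E t u" if "t \<in> K2 - {v}" for t using u(5)[of t] that True E_sym[of t u] by blast
        then show ?thesis
          unfolding B using sep_sym[OF sep(1)] sep(3) V(3) unfolding sep_def by blast
      qed
      show "v \<notin> ?B1 \<union> ?B2" unfolding B by blast
    qed (use sep V(3) u(3) v(1) t12 t2 tv in \<open>auto simp: sep_def\<close>)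
  next
    case False
    have nu: "\<not> E v u" using u(5)[OF v(1)] False E_sym by blast
    \<comment> \<open>The graph is split at \<open>y2\<close>. One side contains \<open>u\<close>
      with its neighbours \<open>w\<close>, \<open>y2\<close> and \<open>y3\<close>, the other
      contains \<open>v\<close> with three neighbours, so neither side is a path.\<close>
    let ?V1 = "insert y2 (insert u ({w} \<union> K3))"
    have "\<not> max_degree_two K2"
    proof -
      have "x \<in> K2" "y \<in> K2" "z \<in> K2" using nbrK2[OF v(1)] v nu by metis+
      then show ?thesis using v unfolding max_degree_two_def by blast
    qed
    then have 2: "doubly_singular K2" using pathlist_max_degree_two u(2) fin by (intro doubly_singular_of_not_path) auto
    have "\<not> max_degree_two ?V1"
    proof
      assume "max_degree_two ?V1"
      moreover have "E u y2" using u(2,5) by blast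
      ultimately have "y2 = w \<or> y2 = y3 \<or> w = y3"
        using u(1,3,4) unfolding max_degree_two_def by blast
      then show False using disj u(2,3) by blast
    qed
    then have 1: "doubly_singular ?V1" using pathlist_max_degree_two fin by (intro doubly_singular_of_not_path) auto
    show ?thesis
    proof (rule deficient_one_sum[OF V(1) _ _ _ 1 2])
      show "V = ?V1 \<union> K2" using V(2) u(2) by blast
      show "?V1 \<inter> K2 = {y2}" using u(2) V(3) disj by blast
      show "\<not> E s t" if "s \<in> ?V1 - {y2}" "t \<in> K2 - {y2}" for s t
        using that u(5)[of t] sep(1) sep_sym[OF sep(3)] unfolding sep_def by blast
    qed
  qed
qed

text \<open>A vertex \<open>u\<close> of degree three has just three branches, one of which is a
  single vertex \<open>w\<close>; otherwise \<open>V\<close> would be deficient. By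
  \<open>deficient_second_branching\<close> the rest has maximal degree two, so it is a path, and
  two neighbours of \<open>u\<close> on it put \<open>u\<close> into its interior.\<close>

lemma tree_classification:
  assumes V: "finite V" "V \<noteq> {}" "conn V" and acyc: "acyclic_on V" and deficient: "\<not> deficient V"
  shows "(\<exists>xs. pathlist V xs) \<or> path_with_leaf V"
proof (cases "max_degree_two V")
  case True
  then show ?thesis using path_of_max_degree_two[OF V True acyc] by metis
next
  case False
  then obtain u x y z where u: "u \<in> V" "x \<in> V" "y \<in> V" "z \<in> V" "E u x" "E u y" "E u z" "x \<noteq> y" "x \<noteq> z" "y \<noteq> z"
    unfolding max_degree_two_def by blast
  let ?C = "component (V - {u})"
  have C: "u \<notin> ?C t" "?C t \<subseteq> V" for t using component_subset[of "V - {u}" t] by auto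
  have self: "t \<in> ?C t" if "t \<in> V" "E u t" for t
    using component_self[of t "V - {u}"] that E_irrefl by blast
  have nbr: "t = s" if "t \<in> ?C s" "E u t" "E u s" "s \<in> V" for s t
    using acyc u(1) that C(2)[of s] unfolding acyclic_on_def component_def by blast
  have cover: "V = insert u (?C x \<union> ?C y \<union> ?C z)"
  proof (rule ccontr)
    let ?R = "V - {u} - (?C x \<union> ?C y \<union> ?C z)"
    assume "V \<noteq> insert u (?C x \<union> ?C y \<union> ?C z)"
    then have "?R \<noteq> {}" using u(1) C by blast
    have "deficient V"
    proof (rule deficient_four_branches[OF V(1), of u "?C x" "?C y" "?C z" ?R])
      show "V = insert u (?C x \<union> ?C y \<union> ?C z \<union> ?R)" using u(1) C(2) by blast
      show "u \<notin> ?C x \<union> ?C y \<union> ?C z \<union> ?R" using C(1) by blast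
      show "?C x \<noteq> {}" "?C y \<noteq> {}" "?C z \<noteq> {}" using self u by blast+
      show "?R \<noteq> {}" by fact
      show "sep (?C x) (?C y)" "sep (?C x) (?C z)" "sep (?C y) (?C z)"
        using nbr u by (blast intro: components_sep)+
      show "sep (?C x \<union> ?C y \<union> ?C z) ?R"
        unfolding sep_Un by (intro conjI sep_mono[OF component_sep order_refl]) auto
    qed
    with deficient show False ..
  qed
  have "card (?C x) < 2 \<or> card (?C y) < 2 \<or> card (?C z) < 2"
  proof (rule ccontr)
    assume "\<not> ?thesis"
    then have "deficient V"
      by (intro deficient_three_big_branches[OF V(1) cover]) (use C(1) nbr u in \<open>auto intro: components_sep\<close>)
    with deficient show False ..
  qed
  then obtain w y2 y3 where w: "card (?C w) < 2" "w \<in> V" "y2 \<in> V" "y3 \<in> V" "E u w" "E u y2" "E u y3"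
    "w \<noteq> y2" "w \<noteq> y3" "y2 \<noteq> y3" "V = insert u (?C w \<union> ?C y2 \<union> ?C y3)"
  proof (elim disjE)
    assume "card (?C x) < 2"
    then show thesis using that[of x y z] u cover by blast
  next
    assume "card (?C y) < 2"
    moreover have "V = insert u (?C y \<union> ?C x \<union> ?C z)" using cover by blast
    ultimately show thesis using that[of y x z] u by blast
  next
    assume "card (?C z) < 2"
    moreover have "V = insert u (?C z \<union> ?C x \<union> ?C y)" using cover by blast
    ultimately show thesis using that[of z x y] u by blast
  qed
  have Cw: "?C w = {w}"
  proof -
    have "finite (?C w)" using C(2) V(1) by (rule finite_subset)
    moreover have "w \<in> ?C w" using self w by blast
    ultimately have "card {w} \<le> card (?C w)" by (intro card_mono) auto
    with w(1) have "card (?C w) = 1" by simp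
    with \<open>w \<in> ?C w\<close> show ?thesis by (metis card_1_singletonE singletonD)
  qed
  have "y2 \<notin> ?C w" using nbr[of y2 w] w by blast
  moreover have "y3 \<notin> ?C w" using nbr[of y3 w] w by blast
  moreover have "y3 \<notin> ?C y2" using nbr[of y3 y2] w by blast
  ultimately have sep: "sep {w} (?C y2)" "sep {w} (?C y3)" "sep (?C y2) (?C y3)" "sep (?C y3) (?C y2)"
    unfolding Cw[symmetric] by (simp_all add: components_sep sep_sym)
  have cov: "V = insert u ({w} \<union> ?C y2 \<union> ?C y3)" using w(11) unfolding Cw .
  have cov': "V = insert u ({w} \<union> ?C y3 \<union> ?C y2)" using cov by blast
  have notin: "u \<notin> {w} \<union> ?C y2 \<union> ?C y3" using C(1) Cw by blast
  let ?U = "insert u (?C y2 \<union> ?C y3)"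
  have wU: "w \<notin> ?U" using sep notin by (auto simp: sep_def)
  have VU: "V = insert w ?U" using cov by blast
  have UV: "?U \<subseteq> V" using VU by blast
  have Cu: "E u t \<longleftrightarrow> t = y2" if "t \<in> ?C y2" for t using that nbr w by blast
  have Cu3: "E u t \<longleftrightarrow> t = y3" if "t \<in> ?C y3" for t using that nbr w by blast
  have "max_degree_two ?U"
    unfolding max_degree_two_def
  proof (intro ballI impI, rule ccontr)
    fix v a b c
    assume v: "v \<in> ?U" and abc: "a \<in> ?U" "b \<in> ?U" "c \<in> ?U" "E v a" "E v b" "E v c"
      and ne: "\<not> (a = b \<or> a = c \<or> b = c)"
    consider "v = u" | "v \<in> ?C y2" | "v \<in> ?C y3" using v by blast
    then show False
    proof cases
      case 1
      have "t = y2 \<or> t = y3" if "t \<in> ?U" "E u t" for t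
        using that Cu Cu3 E_irrefl by blast
      then show False using abc ne 1 by metis
    next
      case 2
      have "deficient V"
        by (rule deficient_second_branching[OF V(1) cov notin sep(1-3) acyc w(5) _ _ w(7) Cu 2, of a b c])
          (use self w abc ne UV in auto)
      with deficient show False ..
    next
      case 3
      have "deficient V"
        by (rule deficient_second_branching[OF V(1) cov' _ sep(2,1,4) acyc w(5) _ _ w(6) Cu3 3, of a b c])
          (use self w abc ne UV notin in auto)
      with deficient show False ..
    qed
  qed
  moreover have "conn ?U"
  proof (rule connI)
    fix t assume "t \<in> ?U"
    then show "(adj_on ?U)\<^sup>*\<^sup>* u t"
      using adj_on_insert[of "?C y2" y2 u ?U t] adj_on_insert[of "?C y3" y3 u ?U t] conn_component self w by blast
  qed
  moreover have "acyclic_on ?U" using acyc UV by (rule acyclic_on_subset)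
  moreover have "finite ?U" using UV V(1) by (rule finite_subset)
  ultimately obtain xs where xs: "pathlist ?U xs"
    using path_of_max_degree_two[of ?U] by blast
  then have set: "set xs = ?U" by (simp add: pathlist_def)
  then obtain i where i: "i < length xs" "u = xs ! i" by (metis in_set_conv_nth insertI1)
  obtain j k where jk: "j < length xs" "y2 = xs ! j" "k < length xs" "y3 = xs ! k"
  proof -
    have "y2 \<in> set xs" "y3 \<in> set xs" unfolding set using self w by blast+
    then show thesis using that by (metis in_set_conv_nth)
  qed
  have "j = Suc i \<or> i = Suc j" "k = Suc i \<or> i = Suc k" "j \<noteq> k"
    using pathlist_nth[OF xs] i jk w by auto
  then have int: "0 < i" "i + 1 < length xs" using jk i by linarith+
  have "E w t \<longleftrightarrow> t = u" if "t \<in> ?U" for t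
  proof -
    have "\<not> E w t" if "t \<in> ?C y2 \<union> ?C y3" for t using that sep(1,2) unfolding sep_def by blast
    then show ?thesis using that E_sym[OF w(5)] notin by blast
  qed
  then have "path_with_leaf V"
    unfolding path_with_leaf_def using xs set wU VU int i(2) by (intro exI[of _ xs] exI[of _ w] exI[of _ i]) auto
  then show ?thesis ..
qed

end

section \<open>Cycles\<close>

context simple_rel
begin

definition cycle_on :: "'a set \<Rightarrow> 'a list \<Rightarrow> bool" where
  "cycle_on V cs \<longleftrightarrow> distinct cs \<and> 3 \<le> length cs \<and> set cs \<subseteq> V \<and>
     (\<forall>i<length cs. E (cs ! i) (cs ! (Suc i mod length cs)))"

text \<open>The vertices that hang from the cycle \<open>C\<close> at \<open>v\<close>: deleting
  \<open>v\<close> cuts them off from the rest of \<open>C\<close>.\<close>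

definition off_cycle :: "'a set \<Rightarrow> 'a set \<Rightarrow> 'a \<Rightarrow> 'a set" where
  "off_cycle V C v = {y \<in> V - {v}. \<forall>z\<in>C - {v}. \<not> (adj_on (V - {v}))\<^sup>*\<^sup>* z y}"

definition chorded_path :: "'a set \<Rightarrow> bool" where
  "chorded_path V \<longleftrightarrow> (\<exists>xs i. distinct xs \<and> set xs = V \<and> i + 2 < length xs \<and>
     (\<forall>k<length xs. \<forall>l<length xs. E (xs ! k) (xs ! l) \<longleftrightarrow>
        l = Suc k \<or> k = Suc l \<or> k = i \<and> l = i + 2 \<or> k = i + 2 \<and> l = i))"

definition path_and_isolated :: "'a set \<Rightarrow> bool" where
  "path_and_isolated V \<longleftrightarrow> (\<exists>xs w. pathlist (set xs) xs \<and> w \<notin> set xs \<and> V = insert w (set xs) \<and>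
     (\<forall>y\<in>set xs. \<not> E w y))"

text \<open>If the walk returns to a vertex of the path, the path is cut back to that
  vertex.\<close>

lemma simple_path:
  assumes "(adj_on X)\<^sup>*\<^sup>* a b" "a \<in> X"
  shows "\<exists>zs. zs \<noteq> [] \<and> distinct zs \<and> set zs \<subseteq> X \<and> hd zs = a \<and> last zs = b \<and>
    (\<forall>i. Suc i < length zs \<longrightarrow> E (zs ! i) (zs ! Suc i))"
  using assms
proof (induction rule: rtranclp_induct)
  case base
  then show ?case by (intro exI[of _ "[a]"]) auto
next
  case (step y z)
  then obtain zs where zs: "zs \<noteq> []" "distinct zs" "set zs \<subseteq> X" "hd zs = a" "last zs = y"
    "\<And>i. Suc i < length zs \<Longrightarrow> E (zs ! i) (zs ! Suc i)" by blast
  have yz: "E y z" "z \<in> X" using step.hyps(2) by (auto simp: adj_on_def)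
  show ?case
  proof (cases "z \<in> set zs")
    case True
    then obtain i where i: "i < length zs" "zs ! i = z" by (metis in_set_conv_nth)
    have "last (take (Suc i) zs) = z" using i by (simp add: take_Suc_conv_app_nth)
    moreover have "set (take (Suc i) zs) \<subseteq> X" using zs(3) set_take_subset by fast
    moreover have "hd (take (Suc i) zs) = a" using zs(1,4) by (simp add: hd_take)
    ultimately show ?thesis using zs(1,2,6) by (intro exI[of _ "take (Suc i) zs"]) auto
  next
    case False
    have "E ((zs @ [z]) ! i) ((zs @ [z]) ! Suc i)" if "Suc i < length (zs @ [z])" for i
    proof (cases "Suc i = length zs")
      case True
      then have "zs ! i = y" using zs(1,5) by (metis diff_Suc_1 last_conv_nth)
      then show ?thesis using True[symmetric] yz(1) by (simp add: nth_append)
    next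
      case no: False
      then show ?thesis using that zs(6)[of i] by (simp add: nth_append)
    qed
    then show ?thesis using zs False yz(2) by (intro exI[of _ "zs @ [z]"]) auto
  qed
qed

lemma exists_cycle:
  assumes "\<not> acyclic_on V"
  obtains cs where "cycle_on V cs"
proof -
  obtain u a b where u: "u \<in> V" "a \<in> V" "b \<in> V" "E u a" "E u b" "(adj_on (V - {u}))\<^sup>*\<^sup>* a b" "a \<noteq> b"
    using assms by (auto simp: acyclic_on_def)
  have "a \<in> V - {u}" using u E_irrefl by auto
  from simple_path[OF u(6) this] obtain zs where zs: "zs \<noteq> []" "distinct zs" "set zs \<subseteq> V - {u}" "hd zs = a"
    "last zs = b" "\<And>i. Suc i < length zs \<Longrightarrow> E (zs ! i) (zs ! Suc i)" by blast
  have len: "2 \<le> length zs"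
  proof (rule ccontr)
    assume "\<not> 2 \<le> length zs"
    then have "hd zs = last zs" using zs(1) by (cases zs; cases "tl zs") auto
    then show False using zs(4,5) u(7) by simp
  qed
  have "cycle_on V (u # zs)"
    unfolding cycle_on_def
  proof (intro conjI allI impI)
    fix i assume i: "i < length (u # zs)"
    show "E ((u # zs) ! i) ((u # zs) ! (Suc i mod length (u # zs)))"
    proof (cases "i = length zs")
      case True
      then have "(u # zs) ! i = b" using zs(1,5) by (cases i) (auto simp: last_conv_nth)
      then show ?thesis using True u(5) E_sym by simp
    next
      case False
      then have "Suc i mod length (u # zs) = Suc i" using i by simp
      then show ?thesis using i False u(4) zs(1,4) zs(6)[of "i - 1"] by (cases i) (auto simp: hd_conv_nth)
    qed
  qed (use zs u len in auto)
  then show ?thesis by (rule that)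
qed

text \<open>The set \<open>K\<close> is the branch at \<open>v\<close> that contains the rest of the
  cycle. Deficiency would follow from a third neighbour of \<open>v\<close> in \<open>K\<close>,
  from a hanging part that forms no path with \<open>v\<close>, and from \<open>v\<close> lying
  inside that path. The predecessor of \<open>j\<close> is reached by adding
  \<open>length cs - 1\<close>, which stays within the natural numbers.\<close>

lemma cycle_vertex:
  assumes V: "finite V" and deficient: "\<not> deficient V" and cs: "cycle_on V cs" and j: "j < length cs" and v: "v = cs ! j"
  obtains K ys where "conn K" "set cs - {v} \<subseteq> K" "V = insert v (K \<union> off_cycle V (set cs) v)"
    "v \<notin> K \<union> off_cycle V (set cs) v" "sep K (off_cycle V (set cs) v)"
    "\<forall>x\<in>K. E v x \<longleftrightarrow> x = cs ! (Suc j mod length cs) \<or> x = cs ! ((j + (length cs - 1)) mod length cs)"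
    "pathlist (insert v (off_cycle V (set cs) v)) ys" "ys ! 0 = v"
proof -
  let ?n = "length cs"
  have n: "3 \<le> ?n" "distinct cs" "set cs \<subseteq> V" and edge: "\<And>i. i < ?n \<Longrightarrow> E (cs ! i) (cs ! (Suc i mod ?n))"
    using cs by (auto simp: cycle_on_def)
  have lt: "k mod ?n < ?n" for k using n(1) by (intro mod_less_divisor) linarith
  \<comment> \<open>The cycle without \<open>v\<close>, traversed from the successor of
    \<open>v\<close>.\<close>
  define zs where "zs = map (\<lambda>i. cs ! ((j + Suc i) mod ?n)) [0..<?n - 1]"
  have lz: "length zs = ?n - 1" by (simp add: zs_def)
  have nz: "zs ! i = cs ! ((j + Suc i) mod ?n)" if "i < ?n - 1" for i using that by (simp add: zs_def)
  have mod_ne: "(j + Suc i) mod ?n \<noteq> j" if "i < ?n - 1" for i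
  proof (cases "j + Suc i < ?n")
    case False
    then have "(j + Suc i) mod ?n = j + Suc i - ?n" using j that by (subst mod_if) (simp add: le_mod_geq)
    then show ?thesis using that False by linarith
  qed simp
  have set_zs: "set zs = set cs - {v}"
  proof
    show "set zs \<subseteq> set cs - {v}"
    proof
      fix x assume "x \<in> set zs"
      then obtain i where i: "i < ?n - 1" "x = zs ! i" using lz by (metis in_set_conv_nth)
      then have "x = cs ! ((j + Suc i) mod ?n)" using nz by simp
      moreover have "(j + Suc i) mod ?n < ?n" using j by (intro mod_less_divisor) linarith
      ultimately have "x = cs ! ((j + Suc i) mod ?n)" "(j + Suc i) mod ?n < ?n" by blast+
      then show "x \<in> set cs - {v}" using mod_ne[OF i(1)] n(2) j v by (auto simp: nth_eq_iff_index_eq)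
    qed
    show "set cs - {v} \<subseteq> set zs"
    proof
      fix x assume "x \<in> set cs - {v}"
      then obtain k where k: "k < ?n" "x = cs ! k" "k \<noteq> j" using v by (auto simp: in_set_conv_nth)
      define i where "i = (if j < k then k - j - 1 else k + ?n - j - 1)"
      have "i < ?n - 1 \<and> (j + Suc i) mod ?n = k"
      proof (cases "j < k")
        case True
        then have "j + Suc i = k" "i < ?n - 1" using k(1) by (auto simp: i_def)
        then show ?thesis using k(1) by simp
      next
        case False
        then have "j + Suc i = k + ?n" "i < ?n - 1" using k j by (auto simp: i_def)
        then show ?thesis using k(1) by simp
      qed
      then have "x = zs ! i" "i < length zs" using nz k lz by auto
      then show "x \<in> set zs" by simp
    qed
  qed
  have zE: "E (zs ! i) (zs ! Suc i)" if "Suc i < length zs" for i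
  proof -
    have "E (cs ! ((j + Suc i) mod ?n)) (cs ! (Suc ((j + Suc i) mod ?n) mod ?n))"
      by (rule edge[OF lt])
    then show ?thesis using that lz nz[of i] nz[of "Suc i"] by (simp add: mod_simps)
  qed
  have zV: "set zs \<subseteq> V - {v}" using set_zs n(3) by auto
  have reach: "(adj_on (V - {v}))\<^sup>*\<^sup>* x y" if "x \<in> set zs" "y \<in> set zs" for x y
    using that chain_rtrancl[OF zV zE] by (auto simp: in_set_conv_nth)
  let ?a = "cs ! (Suc j mod ?n)" and ?b = "cs ! ((j + (?n - 1)) mod ?n)"
  have ab: "?a = zs ! 0" "?b = zs ! (?n - 2)" using n nz[of 0] nz[of "?n - 2"] by (auto simp: numeral_2_eq_2 Suc_diff_Suc)
  have ab_in: "?a \<in> set zs" "?b \<in> set zs" unfolding ab using lz n by auto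
  have dz: "distinct zs"
    using set_zs n(1,2) lz j v by (intro card_distinct) (simp add: card_Diff_singleton distinct_card)
  have "?a \<noteq> ?b" unfolding ab using dz lz n by (simp add: nth_eq_iff_index_eq)
  have "v \<in> V" using v j n(3) by auto
  have Ea: "E v ?a" using edge[OF j] v by simp
  have Eb: "E v ?b"
  proof -
    have "E ?b (cs ! (Suc ((j + (?n - 1)) mod ?n) mod ?n))" by (rule edge[OF lt])
    moreover have "Suc (j + (?n - 1)) = j + ?n" using n by linarith
    then have "Suc ((j + (?n - 1)) mod ?n) mod ?n = j"
      using j by (metis mod_Suc_eq mod_add_self2 mod_less)
    ultimately show ?thesis using E_sym v by auto
  qed
  define K where "K = component (V - {v}) ?a"
  define Y where "Y = off_cycle V (set cs) v"
  have zK: "set zs \<subseteq> K" using reach[OF ab_in(1)] zV by (auto simp: K_def component_def)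
  \<comment> \<open>The rest of the cycle is connected without \<open>v\<close>, so being cut off
    from one of its vertices is being cut off from all.\<close>
  have Y: "Y = V - {v} - K"
  proof
    show "Y \<subseteq> V - {v} - K" using ab_in(1) set_zs by (auto simp: Y_def off_cycle_def K_def component_def)
    show "V - {v} - K \<subseteq> Y"
    proof
      fix y assume y: "y \<in> V - {v} - K"
      have "\<not> (adj_on (V - {v}))\<^sup>*\<^sup>* z y" if "z \<in> set cs - {v}" for z
      proof
        assume "(adj_on (V - {v}))\<^sup>*\<^sup>* z y"
        with reach[OF ab_in(1), of z] that set_zs have "(adj_on (V - {v}))\<^sup>*\<^sup>* ?a y" by (metis rtranclp_trans)
        with y show False unfolding K_def component_def by blast
      qed
      with y show "y \<in> Y" by (simp add: Y_def off_cycle_def)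
    qed
  qed
  have KV: "K \<subseteq> V - {v}" by (auto simp: K_def component_def)
  have VKY: "V = insert v (K \<union> Y)" "v \<notin> K \<union> Y" unfolding Y using KV \<open>v \<in> V\<close> by blast+
  have sepKY: "sep K Y" unfolding Y K_def by (rule component_sep)
  have conn: "conn K" unfolding K_def by (rule conn_component)
  have ab_K: "?a \<in> K" "?b \<in> K" using ab_in zK by blast+
  have nbrs: "\<forall>x\<in>K. E v x \<longleftrightarrow> x = ?a \<or> x = ?b"
  proof (intro ballI iffI)
    fix x assume x: "x \<in> K" "E v x"
    show "x = ?a \<or> x = ?b"
    proof (rule ccontr)
      assume "\<not> ?thesis"
      then have "deficient V"
        using deficient_three_neighbours[OF V VKY sepKY conn ab_K x(1) \<open>?a \<noteq> ?b\<close> _ _ Ea Eb x(2)] by blast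
      with deficient show False ..
    qed
  qed (use Ea Eb in auto)
  have finKY: "finite K" "finite Y" using VKY V by (metis finite_Un finite_insert)+
  have "doubly_singular (insert v K)"
  proof (rule doubly_singular_two_neighbours[of _ v K "{}" ?a ?b])
    show "sep K {}" by (simp add: sep_def)
  qed (use finKY VKY conn ab_K \<open>?a \<noteq> ?b\<close> Ea Eb in auto)
  \<comment> \<open>Otherwise the two sides that share \<open>v\<close> both carry matrices of
    nullity two.\<close>
  have "\<exists>ys. pathlist (insert v Y) ys"
  proof (rule ccontr)
    assume "\<not> ?thesis"
    then have "doubly_singular (insert v Y)" using finKY by (intro doubly_singular_of_not_path) auto
    have "deficient V"
    proof (rule deficient_one_sum[OF V _ _ _ \<open>doubly_singular (insert v K)\<close> \<open>doubly_singular (insert v Y)\<close>])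
      show "V = insert v K \<union> insert v Y" using VKY by blast
      show "insert v K \<inter> insert v Y = {v}" using VKY(2) sepKY by (auto simp: sep_def)
      show "\<not> E x y" if "x \<in> insert v K - {v}" "y \<in> insert v Y - {v}" for x y
        using that sepKY by (auto simp: sep_def)
    qed
    with deficient show False ..
  qed
  then obtain ys where ys: "pathlist (insert v Y) ys" by blast
  then have set_ys: "set ys = insert v Y" "distinct ys" by (auto simp: pathlist_def)
  then obtain k where k: "k < length ys" "v = ys ! k" by (metis in_set_conv_nth insertI1)
  \<comment> \<open>Otherwise the hanging path splits into two branches at \<open>v\<close> in
    addition to \<open>K\<close>.\<close>
  have ends: "k = 0 \<or> Suc k = length ys"
  proof (rule ccontr)
    assume no: "\<not> ?thesis"
    let ?X1 = "set (take k ys)" and ?X2 = "set (drop (Suc k) ys)"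
    have split: "ys = take k ys @ v # drop (Suc k) ys" using k by (simp add: id_take_nth_drop)
    have dist: "distinct (take k ys @ v # drop (Suc k) ys)" using set_ys(2) split by metis
    have "insert v Y = ?X1 \<union> insert v ?X2" using set_ys(1) arg_cong[OF split, of set] by simp
    then have Y12: "Y = ?X1 \<union> ?X2" using dist VKY(2) by auto
    have "sep ?X1 ?X2"
      unfolding sep_def
    proof (intro conjI ballI)
      show "?X1 \<inter> ?X2 = {}" using dist by auto
      fix x y assume "x \<in> ?X1" "y \<in> ?X2"
      then obtain i l where "i < length (take k ys)" "x = take k ys ! i"
        "l < length (drop (Suc k) ys)" "y = drop (Suc k) ys ! l"
        by (metis in_set_conv_nth)
      then have "i < k" "x = ys ! i" "Suc k + l < length ys" "y = ys ! (Suc k + l)"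
        by auto
      then show "\<not> E x y" using pathlist_nth[OF ys, of i "Suc k + l"] k by auto
    qed
    have "deficient V"
    proof (rule deficient_three_branches_two_neighbours[OF V _ _ conn _ _ \<open>sep ?X1 ?X2\<close> _ _ ab_K \<open>?a \<noteq> ?b\<close> Ea Eb])
      show "V = insert v (K \<union> ?X1 \<union> ?X2)" "v \<notin> K \<union> ?X1 \<union> ?X2" using VKY Y12 by auto
      show "sep K ?X1" "sep K ?X2" using sepKY Y12 by (auto simp: sep_def)
      show "?X1 \<noteq> {}" "?X2 \<noteq> {}" using no k by auto
    qed
    with deficient show False ..
  qed
  obtain ys' where "pathlist (insert v Y) ys'" "ys' ! 0 = v"
  proof (cases "k = 0")
    case True
    then show ?thesis using that ys k by blast
  next
    case False
    then have "k = length ys - 1" "0 < length ys" using ends k by auto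
    then have "rev ys ! 0 = v" using k by (simp add: rev_nth)
    then show ?thesis using that pathlist_rev[OF ys] by blast
  qed
  then show ?thesis
    using that[OF conn _ _ _ _ nbrs] VKY sepKY zK set_zs unfolding Y_def by blast
qed

text \<open>An edge at a cycle vertex leads to the cycle or into the part hanging there, and a
  hanging part has its cycle vertex as the only exit. So these sets are closed under adjacency, and
  connectedness makes them cover \<open>V\<close>.\<close>

lemma cycle_structure:
  assumes V: "finite V" "conn V" and deficient: "\<not> deficient V" and cs: "cycle_on V cs"
  defines "Y \<equiv> off_cycle V (set cs)"
  shows "\<And>v. v \<in> set cs \<Longrightarrow> Y v \<inter> set cs = {}"
    and "V = set cs \<union> (\<Union>v\<in>set cs. Y v)"
    and "\<And>v v'. v \<in> set cs \<Longrightarrow> v' \<in> set cs \<Longrightarrow> v \<noteq> v' \<Longrightarrow> Y v \<inter> Y v' = {}"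
    and "\<And>v x y. v \<in> set cs \<Longrightarrow> x \<in> Y v \<Longrightarrow> y \<in> V \<Longrightarrow> E x y \<Longrightarrow> y = v \<or> y \<in> Y v"
proof -
  have csV: "set cs \<subseteq> V" and len: "3 \<le> length cs" using cs by (auto simp: cycle_on_def)
  have vx: "\<exists>K ys. set cs - {v} \<subseteq> K \<and> V = insert v (K \<union> Y v) \<and> v \<notin> K \<union> Y v \<and> sep K (Y v) \<and>
    (\<forall>x\<in>K. E v x \<longrightarrow> x \<in> set cs) \<and> pathlist (insert v (Y v)) ys" if v: "v \<in> set cs" for v
  proof -
    obtain j where j: "j < length cs" "v = cs ! j" using v by (metis in_set_conv_nth)
    obtain K ys where K: "conn K" "set cs - {v} \<subseteq> K" "V = insert v (K \<union> Y v)" "v \<notin> K \<union> Y v" "sep K (Y v)"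
      "\<forall>x\<in>K. E v x \<longleftrightarrow> x = cs ! (Suc j mod length cs) \<or> x = cs ! ((j + (length cs - 1)) mod length cs)"
      "pathlist (insert v (Y v)) ys" "ys ! 0 = v"
      using cycle_vertex[OF V(1) deficient cs j, folded Y_def] .
    have lt: "k mod length cs < length cs" for k using j(1) by (intro mod_less_divisor) linarith
    have "cs ! (Suc j mod length cs) \<in> set cs" "cs ! ((j + (length cs - 1)) mod length cs) \<in> set cs"
      by (rule nth_mem[OF lt])+
    then have "\<forall>x\<in>K. E v x \<longrightarrow> x \<in> set cs" using K(6) by metis
    with K(2-5,7) show ?thesis by (intro exI[of _ K] exI[of _ ys] conjI)
  qed
  show F1: "Y v \<inter> set cs = {}" if v: "v \<in> set cs" for v
  proof -
    obtain K where "set cs - {v} \<subseteq> K" "v \<notin> K \<union> Y v" "sep K (Y v)" using vx[OF v] by blast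
    then show ?thesis unfolding sep_def by blast
  qed
  show F4: "y = v \<or> y \<in> Y v" if v: "v \<in> set cs" "x \<in> Y v" "y \<in> V" "E x y" for v x y
  proof -
    obtain K where K: "V = insert v (K \<union> Y v)" "sep K (Y v)" using vx[OF v(1)] by blast
    have "y \<notin> K" using sep_sym[OF K(2)] v(2,4) unfolding sep_def by blast
    then show ?thesis using K(1) v(3) by blast
  qed
  show "V = set cs \<union> (\<Union>v\<in>set cs. Y v)"
  proof (rule conn_closed_subset[OF V(2), symmetric])
    show "set cs \<union> (\<Union>v\<in>set cs. Y v) \<subseteq> V" using csV by (auto simp: Y_def off_cycle_def)
    show "set cs \<union> (\<Union>v\<in>set cs. Y v) \<noteq> {}" using len by auto
    fix x y assume x: "x \<in> set cs \<union> (\<Union>v\<in>set cs. Y v)" and y: "y \<in> V" "E x y"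
    show "y \<in> set cs \<union> (\<Union>v\<in>set cs. Y v)"
    proof (cases "x \<in> set cs")
      case True
      then obtain K where "V = insert x (K \<union> Y x)" "\<forall>z\<in>K. E x z \<longrightarrow> z \<in> set cs" using vx by blast
      then show ?thesis using y True by blast
    next
      case False
      then obtain v where "v \<in> set cs" "x \<in> Y v" using x by blast
      then show ?thesis using F4[of v x y] y by blast
    qed
  qed
  \<comment> \<open>A common vertex would be joined to \<open>v\<close> by a path inside
    \<open>insert v (Y v)\<close>, which avoids \<open>v'\<close>, and so it would not be cut off by
    \<open>v'\<close>.\<close>
  show "Y v \<inter> Y v' = {}" if v: "v \<in> set cs" "v' \<in> set cs" "v \<noteq> v'" for v v'
  proof (rule ccontr)
    assume "Y v \<inter> Y v' \<noteq> {}"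
    then obtain x where x: "x \<in> Y v" "x \<in> Y v'" by blast
    obtain ys where "pathlist (insert v (Y v)) ys" using vx[OF v(1)] by blast
    then have "(adj_on (insert v (Y v)))\<^sup>*\<^sup>* v x" using pathlist_conn x(1) by (auto simp: conn_def)
    moreover have "insert v (Y v) \<subseteq> V - {v'}"
      using F1[OF v(1)] v csV by (auto simp: Y_def off_cycle_def)
    ultimately have "(adj_on (V - {v'}))\<^sup>*\<^sup>* v x" using adj_on_mono by blast
    then show False using x(2) v by (auto simp: Y_def off_cycle_def)
  qed
qed

text \<open>The vertex \<open>cs ! 0\<close> plays the role of \<open>u\<close> in
  \<open>deficient_cycle\<close>, and the others form the path, whose last index is
  \<open>length cs - 2\<close>. This index must be at least 2, which leaves out the
  triangles.\<close>

lemma deficient_long_cycle: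
  assumes V: "finite V" "conn V" and cs: "cycle_on V cs" and len: "4 \<le> length cs"
  shows "deficient V"
proof (rule ccontr)
  assume deficient: "\<not> deficient V"
  let ?n = "length cs"
  define Y where "Y = off_cycle V (set cs)"
  note struct = cycle_structure[OF V deficient cs, folded Y_def]
  have dist: "distinct cs" "set cs \<subseteq> V" and edge: "\<And>i. i < ?n \<Longrightarrow> E (cs ! i) (cs ! (Suc i mod ?n))"
    using cs by (auto simp: cycle_on_def)
  have idx: "cs ! i = cs ! j \<longleftrightarrow> i = j" if "i < ?n" "j < ?n" for i j
    using that dist by (simp add: nth_eq_iff_index_eq)
  have "\<forall>v\<in>set cs. \<exists>ys. pathlist (insert v (Y v)) ys \<and> ys ! 0 = v"
  proof
    fix v assume "v \<in> set cs"
    then obtain j where j: "j < ?n" "v = cs ! j" by (metis in_set_conv_nth)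
    show "\<exists>ys. pathlist (insert v (Y v)) ys \<and> ys ! 0 = v"
      by (rule cycle_vertex[OF V(1) deficient cs j, folded Y_def]) blast
  qed
  then obtain ys where ys: "\<And>v. v \<in> set cs \<Longrightarrow> pathlist (insert v (Y v)) (ys v)" "\<And>v. v \<in> set cs \<Longrightarrow> ys v ! 0 = v"
    by metis
  \<comment> \<open>The cycle vertex from which \<open>x\<close> hangs, and \<open>x\<close> itself
    on the cycle.\<close>
  define root where "root x = (THE v. v \<in> set cs \<and> x \<in> insert v (Y v))" for x
  have root: "root x = v" if "v \<in> set cs" "x \<in> insert v (Y v)" for x v
    unfolding root_def
  proof (rule the_equality)
    show "v \<in> set cs \<and> x \<in> insert v (Y v)" using that by blast
    show "v' = v" if v': "v' \<in> set cs \<and> x \<in> insert v' (Y v')" for v'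
      using v' that struct(1)[of v] struct(1)[of v'] struct(3)[of v v'] \<open>v \<in> set cs\<close> \<open>x \<in> insert v (Y v)\<close> by blast
  qed
  have root_in: "root x \<in> set cs" "x \<in> insert (root x) (Y (root x))" if x: "x \<in> V" for x
  proof -
    obtain v where "v \<in> set cs" "x \<in> insert v (Y v)" using x struct(2) by blast
    then show "root x \<in> set cs" "x \<in> insert (root x) (Y (root x))" using root by auto
  qed
  \<comment> \<open>Positions are shifted by one because the path starts at
    \<open>cs ! 1\<close>.\<close>
  define \<pi> where "\<pi> x = (THE i. Suc i < ?n \<and> cs ! Suc i = root x)" for x
  have \<pi>: "\<pi> x = i" if "Suc i < ?n" "root x = cs ! Suc i" for x i
    unfolding \<pi>_def by (rule the_equality) (use that idx in auto)
  \<comment> \<open>The sign alternates along each hanging path, starting with 1 on the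
    cycle.\<close>
  define \<sigma> where "\<sigma> x = (- 1 :: real) ^ (THE k. k < length (ys (root x)) \<and> ys (root x) ! k = x)" for x
  have \<sigma>: "\<sigma> x = (- 1) ^ k" if "v \<in> set cs" "k < length (ys v)" "x = ys v ! k" for x v k
  proof -
    have p: "distinct (ys v)" "set (ys v) = insert v (Y v)" using ys(1)[OF that(1)] by (auto simp: pathlist_def)
    then have "root x = v" using root that by (metis nth_mem)
    moreover have "(THE k. k < length (ys v) \<and> ys v ! k = x) = k"
      by (rule the_equality) (use that p in \<open>auto simp: nth_eq_iff_index_eq\<close>)
    ultimately show ?thesis by (simp add: \<sigma>_def)
  qed
  have position: "\<exists>k<length (ys (root x)). x = ys (root x) ! k" if "x \<in> V" for x
  proof -
    have "x \<in> set (ys (root x))"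
      using ys(1)[OF root_in(1)[OF that]] root_in(2)[OF that] by (simp only: pathlist_def)
    then show ?thesis by (metis in_set_conv_nth)
  qed
  let ?u = "cs ! 0" and ?m = "?n - 2"
  have u: "?u \<in> set cs" using len by (intro nth_mem) auto
  have n0: "0 < ?n" using len by linarith
  obtain K zs where "conn K" and K: "set cs - {?u} \<subseteq> K" "V = insert ?u (K \<union> Y ?u)" "?u \<notin> K \<union> Y ?u" "sep K (Y ?u)"
    "\<forall>x\<in>K. E ?u x \<longleftrightarrow> x = cs ! (Suc 0 mod ?n) \<or> x = cs ! ((0 + (?n - 1)) mod ?n)"
    and "pathlist (insert ?u (Y ?u)) zs" "zs ! 0 = ?u"
    using cycle_vertex[OF V(1) deficient cs n0 refl, folded Y_def] .
  have KV: "K \<subseteq> V" using K(2) by blast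
  have rootK: "\<exists>i. Suc i < ?n \<and> root x = cs ! Suc i" if "x \<in> K" for x
  proof -
    have "x \<in> V" using that KV by blast
    obtain j where j: "j < ?n" "root x = cs ! j" using root_in(1)[OF \<open>x \<in> V\<close>] by (metis in_set_conv_nth)
    have "j \<noteq> 0"
    proof
      assume "j = 0"
      then have "x \<in> insert ?u (Y ?u)" using root_in(2)[OF \<open>x \<in> V\<close>] j by simp
      then show False using that K(3,4) unfolding sep_def by blast
    qed
    then show ?thesis using j by (cases j) auto
  qed
  have inK: "x \<in> K" if "v \<in> set cs - {?u}" "x \<in> insert v (Y v)" for x v
  proof -
    have "x \<in> V" using that dist(2) by (auto simp: Y_def off_cycle_def)
    moreover have "x \<notin> insert ?u (Y ?u)" using root[OF u] root[of v x] that by blast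
    ultimately show ?thesis using K(2) by blast
  qed
  have same: "\<sigma> x = - \<sigma> y" if xy: "x \<in> V" "y \<in> V" "E x y" "root x = root y" for x y
  proof -
    obtain k l where kl: "k < length (ys (root x))" "x = ys (root x) ! k" "l < length (ys (root x))" "y = ys (root x) ! l"
      using position[OF xy(1)] position[OF xy(2)] xy(4) by metis
    then have "l = Suc k \<or> k = Suc l"
      using xy(3) pathlist_nth[OF ys(1)[OF root_in(1)[OF xy(1)]]] by metis
    then show ?thesis using \<sigma>[OF root_in(1)[OF xy(1)] kl(1,2)] \<sigma>[OF root_in(1)[OF xy(1)] kl(3,4)] by auto
  qed
  have "deficient V"
  proof (rule deficient_cycle[OF V(1) K(2,3,4), of ?m "\<lambda>i. cs ! Suc i" \<pi> \<sigma>])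
    show "2 \<le> ?m" using len by linarith
    have csK: "cs ! Suc i \<in> K \<and> root (cs ! Suc i) = cs ! Suc i" if "i \<le> ?m" for i
    proof -
      have "Suc i < ?n" using that len by linarith
      then have "cs ! Suc i \<in> set cs - {?u}" using idx[of "Suc i" 0] n0 by auto
      then show ?thesis using K(1) root[of "cs ! Suc i" "cs ! Suc i"] by blast
    qed
    show "cs ! Suc i \<in> K" if "i \<le> ?m" for i using csK[OF that] by blast
    show "\<pi> (cs ! Suc i) = i" if "i \<le> ?m" for i
      using csK[OF that] that len by (intro \<pi>) auto
    show "\<sigma> (cs ! Suc i) = 1" if "i \<le> ?m" for i
    proof -
      have v: "cs ! Suc i \<in> set cs" using that len by (intro nth_mem) linarith
      then have "ys (cs ! Suc i) \<noteq> []" using ys(1) by (auto simp: pathlist_def)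
      then show ?thesis using \<sigma>[OF v, of 0] ys(2)[OF v] by simp
    qed
    show "E (cs ! Suc i) (cs ! Suc (Suc i))" if "i < ?m" for i
      using edge[of "Suc i"] that len by simp
    show "\<pi> x \<le> ?m" if x: "x \<in> K" for x
    proof -
      obtain i where "Suc i < ?n" "root x = cs ! Suc i" using rootK[OF x] by blast
      then show ?thesis using \<pi> by simp
    qed
    show "\<sigma> x = 1 \<or> \<sigma> x = - 1" if "x \<in> K" for x
      unfolding \<sigma>_def by (metis neg_one_even_power neg_one_odd_power)
    show "\<pi> x = \<pi> y \<and> \<sigma> x = - \<sigma> y \<or>
      (\<exists>i<?m. x = cs ! Suc i \<and> y = cs ! Suc (Suc i) \<or> y = cs ! Suc i \<and> x = cs ! Suc (Suc i))"
      if xy: "x \<in> K" "y \<in> K" "x \<noteq> y" "E x y" for x y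
    proof (cases "root x = root y")
      case True
      then have "\<pi> x = \<pi> y" by (simp add: \<pi>_def)
      then show ?thesis using same[OF _ _ xy(4) True] xy KV by blast
    next
      case False
      \<comment> \<open>An edge between different hanging parts joins their cycle vertices, and
        these are consecutive on the cycle by \<open>cycle_vertex\<close>.\<close>
      have xyV: "x \<in> V" "y \<in> V" using xy KV by auto
      have "x = root x" using struct(4)[OF root_in(1)[OF xyV(1)] _ xyV(2) xy(4)] root_in(2)[OF xyV(1)]
          root[OF root_in(1)[OF xyV(1)], of y] False by (metis insert_iff)
      moreover have "y = root y" using struct(4)[OF root_in(1)[OF xyV(2)] _ xyV(1) E_sym[OF xy(4)]] root_in(2)[OF xyV(2)]
          root[OF root_in(1)[OF xyV(2)], of x] False by (metis insert_iff)
      ultimately obtain i j where ij: "Suc i < ?n" "x = cs ! Suc i" "Suc j < ?n" "y = cs ! Suc j"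
        using rootK[OF xy(1)] rootK[OF xy(2)] by metis
      obtain L where L: "set cs - {x} \<subseteq> L"
        "\<forall>t\<in>L. E x t \<longleftrightarrow> t = cs ! (Suc (Suc i) mod ?n) \<or> t = cs ! ((Suc i + (?n - 1)) mod ?n)"
        by (rule cycle_vertex[OF V(1) deficient cs ij(1,2)]) (rule that)
      have "y \<in> L" using L(1) ij xy(3) by (metis Diff_iff nth_mem singletonD subsetD)
      then have "y = cs ! (Suc (Suc i) mod ?n) \<or> y = cs ! ((Suc i + (?n - 1)) mod ?n)" using L(2) xy(4) by blast
      moreover have "Suc i + (?n - 1) = i + ?n" using ij(1) by linarith
      then have "(Suc i + (?n - 1)) mod ?n = i" using ij(1) by (metis Suc_lessD mod_add_self2 mod_less)
      ultimately have "Suc j = Suc (Suc i) mod ?n \<or> Suc j = i"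
        using ij idx by (metis Suc_lessD mod_less_divisor n0)
      then have "Suc j = Suc (Suc i) \<or> Suc j = i" using ij(1) by (auto simp: mod_Suc split: if_splits)
      then show ?thesis
      proof
        assume "Suc j = Suc (Suc i)"
        then have "i < ?m" "y = cs ! Suc (Suc i)" using ij by auto
        then show ?thesis using ij(2) by blast
      next
        assume "Suc j = i"
        then have "j < ?m" "x = cs ! Suc (Suc j)" using ij by auto
        then show ?thesis using ij(4) by blast
      qed
    qed
    show "\<exists>y\<in>K. y \<noteq> x \<and> E x y" if x: "x \<in> K" "x \<noteq> cs ! Suc (\<pi> x)" for x
    proof -
      obtain i where i: "Suc i < ?n" "root x = cs ! Suc i" using rootK[OF x(1)] by blast
      then have xr: "x \<noteq> root x" using x(2) \<pi> by metis
      have xV: "x \<in> V" using x(1) KV by blast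
      let ?v = "root x"
      note v = root_in(1)[OF xV]
      obtain k where k: "k < length (ys ?v)" "x = ys ?v ! k" using position[OF xV] by blast
      have "k \<noteq> 0" using k xr ys(2)[OF v] by metis
      then have e: "E x (ys ?v ! (k - 1))"
        using pathlist_nth[OF ys(1)[OF v], of k "k - 1"] k by auto
      have "ys ?v ! (k - 1) \<in> insert ?v (Y ?v)"
        using ys(1)[OF v] k by (auto simp: pathlist_def simp del: insert_iff)
      moreover have "?v \<in> set cs - {?u}" using v i idx[of "Suc i" 0] n0 by auto
      ultimately have "ys ?v ! (k - 1) \<in> K" using inK by blast
      moreover have "ys ?v ! (k - 1) \<noteq> x" using e E_irrefl by metis
      ultimately show ?thesis using e by blast
    qed
    show "E ?u x \<longleftrightarrow> x = cs ! Suc 0 \<or> x = cs ! Suc ?m" if "x \<in> K" for x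
    proof -
      have "Suc ?m = ?n - 1" "Suc 0 mod ?n = Suc 0" "(0 + (?n - 1)) mod ?n = ?n - 1" using len by auto
      then show ?thesis using K(5) that by simp
    qed
  qed
  with deficient show False ..
qed

text \<open>The path runs through \<open>A\<close> towards \<open>a\<close>, then to
  \<open>v\<close>, then from \<open>b\<close> through \<open>B\<close>; the edge between
  \<open>a\<close> and \<open>b\<close> is the chord across \<open>v\<close>.\<close>

lemma chorded_path_of_triangle:
  assumes A: "pathlist A as" "as ! 0 = a" and B: "pathlist B bs" "bs ! 0 = b"
    and V: "V = insert v (A \<union> B)" "v \<notin> A \<union> B" "A \<inter> B = {}"
    and cross: "\<And>p q. p \<in> A \<Longrightarrow> q \<in> B \<Longrightarrow> E p q \<longleftrightarrow> p = a \<and> q = b"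
      "\<And>p. p \<in> A \<Longrightarrow> E p v \<longleftrightarrow> p = a" "\<And>p. p \<in> B \<Longrightarrow> E v p \<longleftrightarrow> p = b"
  shows "chorded_path V"
proof -
  have as: "as \<noteq> []" "distinct as" "set as = A" using A by (auto simp: pathlist_def)
  have bs: "bs \<noteq> []" "distinct bs" "set bs = B" using B by (auto simp: pathlist_def)
  define xs where "xs = rev as @ v # bs"
  define i where "i = length as - 1"
  let ?n = "length as"
  have i: "?n = Suc i" using as(1) by (cases as) (auto simp: i_def)
  have len: "length xs = Suc i + Suc (length bs)" by (simp add: xs_def i)
  have n1: "xs ! k = as ! (i - k)" if "k \<le> i" for k using that i by (simp add: xs_def nth_append rev_nth)
  have n2: "xs ! Suc i = v" by (simp add: xs_def nth_append i)
  have n3: "xs ! (Suc (Suc i) + k) = bs ! k" for k by (simp add: xs_def nth_append i)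
  have inA: "as ! k \<in> A" if "k < ?n" for k using that as by auto
  have inB: "bs ! k \<in> B" if "k < length bs" for k using that bs by auto
  have a: "as ! k = a \<longleftrightarrow> k = 0" if "k < ?n" for k using that as A(2) by (metis length_greater_0_conv nth_eq_iff_index_eq)
  have b: "bs ! k = b \<longleftrightarrow> k = 0" if "k < length bs" for k using that bs B(2) by (metis length_greater_0_conv nth_eq_iff_index_eq)
  have main: "E (xs ! k) (xs ! l) \<longleftrightarrow> l = Suc k \<or> k = i \<and> l = i + 2" if kl: "k < l" "l < length xs" for k l
  proof -
    consider "l \<le> i" | "k \<le> i" "l = Suc i" | t where "k \<le> i" "l = Suc (Suc i) + t"
      | t where "k = Suc i" "l = Suc (Suc i) + t" | s t where "k = Suc (Suc i) + s" "l = Suc (Suc i) + t"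
      using kl by (metis Suc_leI le_add_diff_inverse le_eq_less_or_eq less_le_trans not_less not_less_eq_eq)
    then show ?thesis
    proof cases
      case 1
      then show ?thesis using kl n1 pathlist_nth[OF A(1), of "i - k" "i - l"] i by auto
    next
      case 2
      then show ?thesis using n1[of k] n2 cross(2)[OF inA[of "i - k"]] a[of "i - k"] i by auto
    next
      case 3
      then have "t < length bs" using kl len by simp
      then show ?thesis using 3 n1[of k] n3[of t] cross(1)[OF inA[of "i - k"] inB[of t]] a[of "i - k"] b[of t] i by auto
    next
      case 4
      then have "t < length bs" using kl len by simp
      then show ?thesis using 4 n2 n3[of t] cross(3)[OF inB[of t]] b[of t] by auto
    next
      case 5
      then have "t < length bs" "s < length bs" using kl len by simp_all
      then show ?thesis using 5 kl n3[of s] n3[of t] pathlist_nth[OF B(1), of s t] by auto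
    qed
  qed
  show ?thesis
    unfolding chorded_path_def
  proof (intro exI[of _ xs] exI[of _ i] conjI allI impI)
    show "distinct xs" "set xs = V" using as bs V by (auto simp: xs_def)
    show "i + 2 < length xs" using bs(1) by (simp add: len)
    fix k l assume kl: "k < length xs" "l < length xs"
    consider "k < l" | "k = l" | "l < k" by linarith
    then show "E (xs ! k) (xs ! l) \<longleftrightarrow> l = Suc k \<or> k = Suc l \<or> k = i \<and> l = i + 2 \<or> k = i + 2 \<and> l = i"
    proof cases
      case 1
      then show ?thesis using main[OF 1 kl(2)] by auto
    next
      case 2
      then show ?thesis using E_irrefl by auto
    next
      case 3
      have "E (xs ! k) (xs ! l) \<longleftrightarrow> E (xs ! l) (xs ! k)" using E_sym by blast
      then show ?thesis using main[OF 3 kl(1)] 3 by auto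
    qed
  qed
qed

text \<open>If vertices hang from all three corners, \<open>deficient_triangle_big_parts\<close>
  applies. Otherwise a bare corner is the middle of a chorded path that continues into the other two
  hanging paths.\<close>

lemma triangle_classification:
  assumes V: "finite V" "conn V" and deficient: "\<not> deficient V" and cs: "cycle_on V cs" and len: "length cs = 3"
  shows "chorded_path V"
proof -
  define Y where "Y = off_cycle V (set cs)"
  note struct = cycle_structure[OF V deficient cs, folded Y_def]
  obtain x y z where xyz: "cs = [x, y, z]"
    using len that unfolding numeral_3_eq_3 by (auto simp: length_Suc_conv)
  have ne: "x \<noteq> y" "x \<noteq> z" "y \<noteq> z" using cs by (auto simp: cycle_on_def xyz)
  have edge: "E (cs ! i) (cs ! (Suc i mod 3))" if "i < 3" for i using cs that len by (auto simp: cycle_on_def)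
  have E: "E x y" "E y z" "E z x" using edge[of 0] edge[of 1] edge[of 2] by (simp_all add: xyz numeral_2_eq_2)
  have tri: "E p q" if "p \<in> set cs" "q \<in> set cs" "p \<noteq> q" for p q
    using that E E_sym by (auto simp: xyz)
  have path: "\<exists>ys. pathlist (insert v (Y v)) ys \<and> ys ! 0 = v" if "v \<in> set cs" for v
  proof -
    obtain j where j: "j < length cs" "v = cs ! j" using \<open>v \<in> set cs\<close> by (metis in_set_conv_nth)
    show ?thesis
      by (rule cycle_vertex[OF V(1) deficient cs j, folded Y_def]) blast
  qed
  have disj: "insert v (Y v) \<inter> insert w (Y w) = {}" if "v \<in> set cs" "w \<in> set cs" "v \<noteq> w" for v w
    using struct(1)[OF that(1)] struct(1)[OF that(2)] struct(3)[OF that] that by blast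
  have inV: "insert v (Y v) \<subseteq> V" if "v \<in> set cs" for v using struct(2) that by blast
  have cross: "E p q \<longleftrightarrow> p = v \<and> q = w"
    if vw: "v \<in> set cs" "w \<in> set cs" "v \<noteq> w" and pq: "p \<in> insert v (Y v)" "q \<in> insert w (Y w)" for v w p q
  proof
    assume e: "E p q"
    have "p \<in> V" "q \<in> V" using pq inV vw by blast+
    then show "p = v \<and> q = w"
      using struct(4)[OF vw(1), of p q] struct(4)[OF vw(2), of q p] e E_sym[OF e] pq disj[OF vw] by blast
  next
    assume "p = v \<and> q = w"
    then show "E p q" using tri vw by blast
  qed
  have cover: "V = insert x (Y x) \<union> insert y (Y y) \<union> insert z (Y z)" using struct(2) by (simp add: xyz) blast
  have big: "2 \<le> card (insert v (Y v))" if "v \<in> set cs" "Y v \<noteq> {}" for v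
  proof -
    have "finite (Y v)" using inV[OF that(1)] V(1) by (meson finite_insert finite_subset)
    moreover have "v \<notin> Y v" using struct(1)[OF that(1)] that(1) by blast
    ultimately have "card (insert v (Y v)) = Suc (card (Y v))" "card (Y v) \<noteq> 0" using that(2) by auto
    then show ?thesis by linarith
  qed
  have "Y x = {} \<or> Y y = {} \<or> Y z = {}"
  proof (rule ccontr)
    assume no: "\<not> ?thesis"
    have d: "insert x (Y x) \<inter> insert y (Y y) = {}" "insert x (Y x) \<inter> insert z (Y z) = {}" "insert y (Y y) \<inter> insert z (Y z) = {}"
      using disj[of x y] disj[of x z] disj[of y z] ne by (simp_all add: xyz)
    have "deficient V"
    proof (rule deficient_triangle_big_parts[OF V(1) cover d(1), of x y z])
      show "(insert x (Y x) \<union> insert y (Y y)) \<inter> insert z (Y z) = {}" using d(2,3) by blast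
      show "2 \<le> card (insert x (Y x))" "2 \<le> card (insert y (Y y))" "2 \<le> card (insert z (Y z))"
        using big no by (simp_all add: xyz)
      show "E p q \<longleftrightarrow> p = x \<and> q = y" if "p \<in> insert x (Y x)" "q \<in> insert y (Y y)" for p q
        by (rule cross) (use that ne xyz in auto)
      show "E p q \<longleftrightarrow> p = x \<and> q = z" if "p \<in> insert x (Y x)" "q \<in> insert z (Y z)" for p q
        by (rule cross) (use that ne xyz in auto)
      show "E p q \<longleftrightarrow> p = y \<and> q = z" if "p \<in> insert y (Y y)" "q \<in> insert z (Y z)" for p q
        by (rule cross) (use that ne xyz in auto)
    qed auto
    with deficient show False ..
  qed
  moreover have "chorded_path V"
    if vab: "v \<in> set cs" "a \<in> set cs" "b \<in> set cs" "v \<noteq> a" "v \<noteq> b" "a \<noteq> b" and Y0: "Y v = {}"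
      and c: "V = insert v (Y v) \<union> insert a (Y a) \<union> insert b (Y b)" for v a b
  proof -
    obtain as where as: "pathlist (insert a (Y a)) as" "as ! 0 = a" using path[OF vab(2)] by blast
    obtain bs where bs: "pathlist (insert b (Y b)) bs" "bs ! 0 = b" using path[OF vab(3)] by blast
    show ?thesis
    proof (rule chorded_path_of_triangle[OF as bs, of V v])
      show "V = insert v (insert a (Y a) \<union> insert b (Y b))" using c Y0 by blast
      show "v \<notin> insert a (Y a) \<union> insert b (Y b)" using disj[of v a] disj[of v b] vab by blast
      show "insert a (Y a) \<inter> insert b (Y b) = {}" using disj vab by blast
      show "E p q \<longleftrightarrow> p = a \<and> q = b" if "p \<in> insert a (Y a)" "q \<in> insert b (Y b)" for p q
        by (rule cross) (use that vab in auto)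
      show "E p v \<longleftrightarrow> p = a" if "p \<in> insert a (Y a)" for p
        using cross[of a v p v] that vab by blast
      show "E v p \<longleftrightarrow> p = b" if "p \<in> insert b (Y b)" for p
        using cross[of v b v p] that vab by blast
    qed
  qed
  ultimately show ?thesis
  proof (elim disjE)
    assume H: "\<And>v a b. v \<in> set cs \<Longrightarrow> a \<in> set cs \<Longrightarrow> b \<in> set cs \<Longrightarrow> v \<noteq> a \<Longrightarrow> v \<noteq> b \<Longrightarrow> a \<noteq> b \<Longrightarrow> Y v = {} \<Longrightarrow>
      V = insert v (Y v) \<union> insert a (Y a) \<union> insert b (Y b) \<Longrightarrow> chorded_path V"
    {
      assume "Y x = {}"
      then show ?thesis using H[of x y z] ne cover by (simp add: xyz)
    next
      assume "Y y = {}"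
      moreover have "V = insert y (Y y) \<union> insert x (Y x) \<union> insert z (Y z)" using cover by blast
      ultimately show ?thesis using H[of y x z] ne by (simp add: xyz)
    next
      assume "Y z = {}"
      moreover have "V = insert z (Y z) \<union> insert x (Y x) \<union> insert y (Y y)" using cover by blast
      ultimately show ?thesis using H[of z x y] ne by (simp add: xyz)
    }
  qed
qed

text \<open>A disconnected graph cannot have two sides with two vertices each, and beside a single
  vertex the rest must be a path. A connected graph is acyclic or contains a cycle, which must be a
  triangle.\<close>

lemma classification:
  assumes V: "finite V" "V \<noteq> {}" and deficient: "\<not> deficient V"
  shows "(\<exists>xs. pathlist V xs) \<or> path_and_isolated V \<or> path_with_leaf V \<or> chorded_path V"
proof (cases "conn V")
  case False
  then obtain x y where xy: "x \<in> V" "y \<in> V" "\<not> (adj_on V)\<^sup>*\<^sup>* x y" by (auto simp: conn_def)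
  have iso: "path_and_isolated V"
    if XY: "V = X \<union> Z" "Z \<noteq> {}" "sep X Z" "card X < 2" "X \<noteq> {}" for X Z
  proof -
    have fin: "finite X" "finite Z" using V XY(1) by auto
    then have "card X = 1" using XY(4,5) by (metis One_nat_def card_gt_0_iff less_2_cases not_less0)
    then obtain w where w: "X = {w}" by (metis card_1_singletonE)
    have "\<not> doubly_singular Z" using deficient_isolated_vertex[of V w Z] V deficient XY w by auto
    then obtain xs where xs: "pathlist Z xs" using doubly_singular_of_not_path fin XY(2) by blast
    then have "set xs = Z" by (simp add: pathlist_def)
    then show ?thesis
      using xs XY w unfolding path_and_isolated_def sep_def by (intro exI[of _ xs] exI[of _ w]) auto
  qed
  let ?X = "component V x" and ?Z = "V - component V x"
  have XZ: "V = ?X \<union> ?Z" "V = ?Z \<union> ?X" using component_subset by auto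
  have ne: "?X \<noteq> {}" "?Z \<noteq> {}"
    using component_self[OF xy(1)] xy by (auto simp: component_def)
  note sep = component_sep[of V x]
  have "card ?X < 2 \<or> card ?Z < 2"
    using deficient_disconnected[OF V(1) XZ(1) _ _ sep] deficient by (meson not_le)
  then have "path_and_isolated V"
    using iso[OF XZ(1) ne(2) sep _ ne(1)] iso[OF XZ(2) ne(1) sep_sym[OF sep] _ ne(2)] by blast
  then show ?thesis by blast
next
  case conn: True
  show ?thesis
  proof (cases "acyclic_on V")
    case True
    then show ?thesis using tree_classification[OF V conn _ deficient] by blast
  next
    case False
    then obtain cs where cs: "cycle_on V cs" using exists_cycle by blast
    have "length cs = 3"
      using deficient_long_cycle[OF V(1) conn cs] deficient cs by (fastforce simp: cycle_on_def)
    then show ?thesis using triangle_classification[OF V(1) conn deficient cs] by blast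
  qed
qed

end

section \<open>The classification\<close>

context simple_rel
begin

text \<open>Levels are the positions on \<open>us\<close>, and \<open>w\<close> is put on level
  \<open>i + 1\<close>, within distance one of its possible neighbours on levels \<open>i\<close>
  and \<open>i + 1\<close>. It opens no second way up, since it has no neighbour on level
  \<open>i + 2\<close>.\<close>

lemma card_eigs_path_and_vertex:
  assumes a: "realizes E V a" and V: "V = insert w (set us)" "w \<notin> set us" and us: "pathlist (set us) us"
    and adj: "\<And>k. k < length us \<Longrightarrow> E w (us ! k) \<Longrightarrow> k = i \<or> k = Suc i"
  shows "length us \<le> card (eigs V a)"
proof -
  have d: "distinct us" "us \<noteq> []" using us by (auto simp: pathlist_def)
  define pos where "pos = the_inv_into {..<length us} ((!) us)"
  have inj: "inj_on ((!) us) {..<length us}" using d(1) by (auto simp: inj_on_def nth_eq_iff_index_eq)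
  have pos: "pos (us ! k) = k" if "k < length us" for k
    unfolding pos_def using inj that by (intro the_inv_into_f_f) auto
  define \<delta> where "\<delta> x = (if x = w then Suc i else pos x)" for x
  have \<delta>: "\<delta> (us ! k) = k" if "k < length us" for k
    using pos[OF that] nth_mem[OF that] V(2) by (auto simp: \<delta>_def)
  have \<delta>w: "\<delta> w = Suc i" by (simp add: \<delta>_def)
  have cases: "x = w \<or> (\<exists>k<length us. x = us ! k)" if "x \<in> V" for x
    using that V(1) by (auto simp: in_set_conv_nth)
  have "length us - 1 + 1 \<le> card (eigs V a)"
  proof (rule card_eigs_unique_shortest_path[OF _ a, where u = "(!) us" and \<delta> = \<delta>])
    show "finite V" using V by simp
    show "us ! j \<in> V" "\<delta> (us ! j) = j" if "j \<le> length us - 1" for j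
    proof -
      have "j < length us" using that d(2) by (cases us) auto
      then show "us ! j \<in> V" "\<delta> (us ! j) = j" using V(1) \<delta> by auto
    qed
    show "E (us ! Suc j) (us ! j)" if "j < length us - 1" for j
      using that pathlist_nth[OF us, of "Suc j" j] by auto
    show "\<delta> x \<le> \<delta> y + 1" if xy: "x \<in> V" "y \<in> V" "x \<noteq> y" "E x y" for x y
    proof -
      consider "x = w" | "y = w" | k l where "k < length us" "x = us ! k" "l < length us" "y = us ! l"
        using cases[OF xy(1)] cases[OF xy(2)] by blast
      then show ?thesis
      proof cases
        case 1
        then obtain k where k: "k < length us" "y = us ! k" using cases[OF xy(2)] xy(3) by blast
        then show ?thesis using adj[OF k(1)] xy(4) 1 \<delta> \<delta>w by auto
      next
        case 2
        then obtain k where k: "k < length us" "x = us ! k" using cases[OF xy(1)] xy(3) by blast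
        then show ?thesis using adj[OF k(1)] E_sym[OF xy(4)] 2 \<delta> \<delta>w by auto
      next
        case 3
        then show ?thesis using xy(4) pathlist_nth[OF us 3(1,3)] \<delta> by auto
      qed
    qed
    show "y = us ! j" if j: "j < length us - 1" and y: "y \<in> V" "E (us ! Suc j) y" "\<delta> y = j" for j y
      using cases[OF y(1)]
    proof
      assume w: "y = w"
      then have "Suc j = i \<or> Suc j = Suc i" using adj[of "Suc j"] E_sym[OF y(2)] j by auto
      then show ?thesis using y(3) \<delta>w w by auto
    next
      assume "\<exists>k<length us. y = us ! k"
      then show ?thesis using y(3) \<delta> by auto
    qed
  qed
  then show ?thesis using d(2) by (cases us) auto
qed

text \<open>The vertex \<open>w\<close> of \<open>card_eigs_path_and_vertex\<close> is the first
  vertex of a path, the isolated vertex, the leaf, or the vertex bridged by the chord.\<close>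

lemma card_eigs_families:
  assumes a: "realizes E V a"
    and "(\<exists>xs. pathlist V xs) \<or> path_and_isolated V \<or> path_with_leaf V \<or> chorded_path V"
  shows "card V - 1 \<le> card (eigs V a)"
  using assms(2)
proof (elim disjE)
  assume "\<exists>xs. pathlist V xs"
  then obtain xs where xs: "pathlist V xs" by blast
  show ?thesis
  proof (cases "length xs < 2")
    case True
    then have "card V < 2" using xs by (metis distinct_card pathlist_def)
    then show ?thesis by simp
  next
    case False
    then obtain w us where wu: "xs = w # us" "us \<noteq> []" by (cases xs; cases "tl xs") auto
    have d: "w \<notin> set us" "V = insert w (set us)" "distinct us" using xs wu by (auto simp: pathlist_def)
    have nth: "E (xs ! k) (xs ! l) \<longleftrightarrow> l = Suc k \<or> k = Suc l" if "k < length xs" "l < length xs" for k l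
      using pathlist_nth[OF xs that] .
    have "E (us ! k) (us ! l) \<longleftrightarrow> l = Suc k \<or> k = Suc l" if "k < length us" "l < length us" for k l
      using nth[of "Suc k" "Suc l"] that wu(1) by simp
    then have p: "pathlist (set us) us" using d wu(2) by (auto simp: pathlist_def)
    have "length us \<le> card (eigs V a)"
      using nth[of 0 "Suc _"] wu(1) by (intro card_eigs_path_and_vertex[OF a d(2,1) p, of 0]) auto
    then show ?thesis using d by (simp add: distinct_card)
  qed
next
  assume "path_and_isolated V"
  then obtain xs w where x: "pathlist (set xs) xs" "w \<notin> set xs" "V = insert w (set xs)" "\<forall>y\<in>set xs. \<not> E w y"
    unfolding path_and_isolated_def by blast
  have "length xs \<le> card (eigs V a)"
    using x by (intro card_eigs_path_and_vertex[OF a x(3,2,1), of 0]) auto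
  then show ?thesis using x by (simp add: distinct_card pathlist_def)
next
  assume "path_with_leaf V"
  then obtain xs w i where x: "pathlist (set xs) xs" "w \<notin> set xs" "V = insert w (set xs)" "i + 1 < length xs"
    "\<forall>y\<in>set xs. E w y \<longleftrightarrow> y = xs ! i" unfolding path_with_leaf_def by blast
  have d: "distinct xs" using x(1) by (simp add: pathlist_def)
  have "length xs \<le> card (eigs V a)"
    using x(4,5) d by (intro card_eigs_path_and_vertex[OF a x(3,2,1), of i]) (auto simp: nth_eq_iff_index_eq)
  then show ?thesis using x d by (simp add: distinct_card)
next
  assume "chorded_path V"
  then obtain xs i where x: "distinct xs" "set xs = V" "i + 2 < length xs"
    and E: "\<And>k l. k < length xs \<Longrightarrow> l < length xs \<Longrightarrow> E (xs ! k) (xs ! l) \<longleftrightarrow>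
      l = Suc k \<or> k = Suc l \<or> k = i \<and> l = i + 2 \<or> k = i + 2 \<and> l = i"
    unfolding chorded_path_def by blast
  \<comment> \<open>The path \<open>us\<close> takes the chord and leaves out position
    \<open>i + 1\<close>.\<close>
  define f where "f k = (if k \<le> i then k else Suc k)" for k
  define us where "us = map (\<lambda>k. xs ! f k) [0..<length xs - 1]"
  let ?w = "xs ! Suc i"
  have len: "length us = length xs - 1" by (simp add: us_def)
  have f: "f k < length xs" "f k \<noteq> Suc i" if "k < length us" for k using that len by (auto simp: f_def)
  have nth: "us ! k = xs ! f k" if "k < length us" for k using that by (simp add: us_def)
  have finj: "f k = f l \<longleftrightarrow> k = l" for k l by (auto simp: f_def)
  have dist: "distinct us"
    using f finj x(1) len by (auto simp: us_def distinct_map inj_on_def nth_eq_iff_index_eq)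
  have set: "set us = V - {?w}"
  proof
    show "set us \<subseteq> V - {?w}"
    proof
      fix y assume "y \<in> set us"
      then obtain k where k: "k < length us" "y = us ! k" by (metis in_set_conv_nth)
      then show "y \<in> V - {?w}" using nth f[of k] x by (auto simp: nth_eq_iff_index_eq)
    qed
    show "V - {?w} \<subseteq> set us"
    proof
      fix y assume "y \<in> V - {?w}"
      then obtain l where l: "l < length xs" "y = xs ! l" "l \<noteq> Suc i" using x(2) by (metis Diff_iff in_set_conv_nth singletonI)
      define k where "k = (if l \<le> i then l else l - 1)"
      have "k < length us" "f k = l" using l x(3) len by (auto simp: k_def f_def)
      then show "y \<in> set us" using nth l(2) by (metis nth_mem)
    qed
  qed
  have w: "?w \<in> V" using x by auto
  have "E (us ! k) (us ! l) \<longleftrightarrow> l = Suc k \<or> k = Suc l" if "k < length us" "l < length us" for k l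
    unfolding nth[OF that(1)] nth[OF that(2)] E[OF f(1)[OF that(1)] f(1)[OF that(2)]]
    by (auto simp: f_def)
  then have p: "pathlist (set us) us" using dist len x(3) by (auto simp: pathlist_def)
  have "length us \<le> card (eigs V a)"
  proof (rule card_eigs_path_and_vertex[OF a _ _ p, of ?w i])
    show "V = insert ?w (set us)" "?w \<notin> set us" using set w by auto
    show "k = i \<or> k = Suc i" if "k < length us" "E ?w (us ! k)" for k
      using that E[OF _ f(1)[OF that(1)], of "Suc i"] x(3) by (auto simp: nth f_def split: if_splits)
  qed
  moreover have "card V = length xs" using x by (metis distinct_card)
  ultimately show ?thesis using len by simp
qed

end

section \<open>Translation between matrices, digraphs and the functional setting\<close>

lemma spectrum_eq_eigs:
  fixes A :: "real mat"
  assumes A: "A \<in> carrier_mat n n"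
  shows "spectrum A = eigs {0..<n} (\<lambda>i j. A $$ (i, j))"
proof (rule Set.set_eqI)
  fix l
  let ?a = "\<lambda>i j. A $$ (i, j)"
  have mult: "(A *\<^sub>v v) $ i = mv {0..<n} ?a (\<lambda>j. v $ j) i" if "v \<in> carrier_vec n" "i < n" for v i
    using that A by (simp add: mv_def scalar_prod_def)
  show "l \<in> spectrum A \<longleftrightarrow> l \<in> eigs {0..<n} ?a"
  proof
    assume "l \<in> spectrum A"
    then obtain v where v: "v \<in> carrier_vec n" "v \<noteq> 0\<^sub>v n" "A *\<^sub>v v = l \<cdot>\<^sub>v v"
      using A by (auto simp: spectrum_def eigenvalue_def eigenvector_def)
    have "eigf {0..<n} ?a l (\<lambda>j. v $ j)"
      using v mult by (auto simp: eigf_def simp flip: mult)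
    moreover have "nonzero_on {0..<n} (\<lambda>j. v $ j)"
      using v(1,2) by (auto simp: nonzero_on_def intro!: eq_vecI)
    ultimately show "l \<in> eigs {0..<n} ?a" by (auto simp: eigs_def)
  next
    assume "l \<in> eigs {0..<n} ?a"
    then obtain f where f: "eigf {0..<n} ?a l f" "nonzero_on {0..<n} f" by (auto simp: eigs_def)
    let ?v = "vec n f"
    have "mv {0..<n} ?a (\<lambda>j. ?v $ j) i = mv {0..<n} ?a f i" for i by (rule mv_cong) auto
    then have "(A *\<^sub>v ?v) $ i = l * f i" if "i < n" for i
      using f(1) mult[of ?v i] that by (simp add: eigf_def)
    then have "A *\<^sub>v ?v = l \<cdot>\<^sub>v ?v"
      using A by (intro eq_vecI) (auto simp del: index_mult_mat_vec)
    moreover have "?v \<noteq> 0\<^sub>v n"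
    proof
      assume z: "?v = 0\<^sub>v n"
      have "f i = 0" if "i < n" for i using arg_cong[OF z, of "\<lambda>v. v $ i"] that by simp
      then show False using f(2) by (auto simp: nonzero_on_def)
    qed
    ultimately show "l \<in> spectrum A"
      using A by (auto simp: spectrum_def eigenvalue_def eigenvector_def intro!: exI[of _ ?v])
  qed
qed

lemma set_vwalk_arcs: "(x, y) \<in> set (vwalk_arcs xs) \<longleftrightarrow> (\<exists>i. Suc i < length xs \<and> x = xs ! i \<and> y = xs ! Suc i)"
proof (induction xs rule: vwalk_arcs.induct)
  case (3 u v us)
  show ?case
  proof
    assume "(x, y) \<in> set (vwalk_arcs (u # v # us))"
    then have "x = u \<and> y = v \<or> (x, y) \<in> set (vwalk_arcs (v # us))" by simp
    then show "\<exists>i. Suc i < length (u # v # us) \<and> x = (u # v # us) ! i \<and> y = (u # v # us) ! Suc i"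
    proof
      assume "x = u \<and> y = v"
      then show ?thesis by (intro exI[of _ 0]) simp
    next
      assume "(x, y) \<in> set (vwalk_arcs (v # us))"
      then obtain i where "Suc i < length (v # us)" "x = (v # us) ! i" "y = (v # us) ! Suc i" using 3 by blast
      then show ?thesis by (intro exI[of _ "Suc i"]) simp
    qed
  next
    assume "\<exists>i. Suc i < length (u # v # us) \<and> x = (u # v # us) ! i \<and> y = (u # v # us) ! Suc i"
    then obtain i where i: "Suc i < length (u # v # us)" "x = (u # v # us) ! i" "y = (u # v # us) ! Suc i" by blast
    show "(x, y) \<in> set (vwalk_arcs (u # v # us))"
    proof (cases i)
      case 0
      then show ?thesis using i by simp
    next
      case (Suc j)
      then have "(x, y) \<in> set (vwalk_arcs (v # us))" using i 3 by auto
      then show ?thesis by simp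
    qed
  qed
qed auto

lemma parcs_path_graph:
  "(x, y) \<in> parcs (path_graph xs) \<longleftrightarrow>
    (\<exists>k<length xs. \<exists>l<length xs. x = xs ! k \<and> y = xs ! l \<and> (l = Suc k \<or> k = Suc l))"
proof -
  have "(x, y) \<in> parcs (path_graph xs) \<longleftrightarrow> (x, y) \<in> set (vwalk_arcs xs) \<or> (y, x) \<in> set (vwalk_arcs xs)"
    by (auto simp: path_graph_def symcl_def image_iff)
  then show ?thesis unfolding set_vwalk_arcs by (auto dest: Suc_lessD)
qed

lemma parcs_path_graph_nth:
  assumes "distinct xs" "k < length xs" "l < length xs"
  shows "(xs ! k, xs ! l) \<in> parcs (path_graph xs) \<longleftrightarrow> l = Suc k \<or> k = Suc l"
  unfolding parcs_path_graph using assms by (auto simp: nth_eq_iff_index_eq)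

lemma parcs_path_graph_subset: "(x, y) \<in> parcs (path_graph xs) \<Longrightarrow> x \<in> set xs \<and> y \<in> set xs"
  unfolding parcs_path_graph by auto

locale graph_on = pair_graph G + simple_rel "\<lambda>x y. (x, y) \<in> parcs G" for G :: "'a pair_pre_digraph"
begin

lemma arc_verts: "(x, y) \<in> parcs G \<Longrightarrow> x \<in> pverts G \<and> y \<in> pverts G"
  by (auto dest: in_arcsD1 in_arcsD2)

lemma pathlist_iff:
  assumes "set xs \<subseteq> pverts G" "distinct xs" "xs \<noteq> []"
  shows "pathlist (set xs) xs \<longleftrightarrow>
    (\<forall>x\<in>set xs. \<forall>y\<in>set xs. (x, y) \<in> parcs G \<longleftrightarrow> (x, y) \<in> parcs (path_graph xs))"
  using assms by (auto simp: pathlist_def all_set_conv_all_nth parcs_path_graph_nth)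

lemma graph_eqI:
  fixes H :: "'a pair_pre_digraph"
  assumes "pverts H = pverts G" "\<And>x y. (x, y) \<in> parcs H \<Longrightarrow> x \<in> pverts G \<and> y \<in> pverts G"
    "\<And>x y. x \<in> pverts G \<Longrightarrow> y \<in> pverts G \<Longrightarrow> (x, y) \<in> parcs G \<longleftrightarrow> (x, y) \<in> parcs H"
  shows "G = H"
proof -
  have "(x, y) \<in> parcs G \<longleftrightarrow> (x, y) \<in> parcs H" for x y using assms(2,3) arc_verts by blast
  then have "parcs G = parcs H" by auto
  with assms(1) show ?thesis by (cases G; cases H) simp
qed

lemma is_path_iff: "is_path G \<longleftrightarrow> (\<exists>xs. pathlist (pverts G) xs)"
proof
  assume "is_path G"
  then obtain xs where xs: "xs \<noteq> []" "distinct xs" "G = path_graph xs" unfolding is_path_def by blast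
  then have V: "pverts G = set xs" by (simp add: path_graph_def)
  then have "pathlist (set xs) xs" using xs by (subst pathlist_iff) auto
  then show "\<exists>xs. pathlist (pverts G) xs" using V by auto
next
  assume "\<exists>xs. pathlist (pverts G) xs"
  then obtain xs where xs: "pathlist (pverts G) xs" by blast
  then have p: "xs \<noteq> []" "distinct xs" "set xs = pverts G" by (auto simp: pathlist_def)
  have "G = path_graph xs"
    by (rule graph_eqI) (use p xs pathlist_iff[of xs] parcs_path_graph_subset[of _ _ xs] in \<open>auto simp: path_graph_def\<close>)
  with p show "is_path G" unfolding is_path_def by blast
qed

lemma is_path_with_isolated_vertex_iff: "is_path_with_isolated_vertex G \<longleftrightarrow> path_and_isolated (pverts G)"
proof
  assume "is_path_with_isolated_vertex G"
  then obtain xs w where xs: "xs \<noteq> []" "distinct xs" "w \<notin> set xs" and G: "G = add_vertex w (path_graph xs)"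
    unfolding is_path_with_isolated_vertex_def by blast
  have V: "pverts G = insert w (set xs)" and arcs: "parcs G = parcs (path_graph xs)"
    unfolding G by (simp_all add: add_vertex_def path_graph_def)
  have "pathlist (set xs) xs" using xs V by (subst pathlist_iff) (auto simp: arcs)
  moreover have "\<forall>y\<in>set xs. (w, y) \<notin> parcs G" using parcs_path_graph_subset[of w _ xs] xs(3) by (auto simp: arcs)
  ultimately show "path_and_isolated (pverts G)" unfolding path_and_isolated_def using xs(3) V by blast
next
  assume "path_and_isolated (pverts G)"
  then obtain xs w where xs: "pathlist (set xs) xs" "w \<notin> set xs" "pverts G = insert w (set xs)"
    "\<forall>y\<in>set xs. (w, y) \<notin> parcs G" unfolding path_and_isolated_def by blast
  have p: "xs \<noteq> []" "distinct xs" using xs(1) by (auto simp: pathlist_def)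
  have on_path: "\<forall>x\<in>set xs. \<forall>y\<in>set xs. (x, y) \<in> parcs G \<longleftrightarrow> (x, y) \<in> parcs (path_graph xs)"
    using pathlist_iff[of xs] xs p by auto
  have "G = add_vertex w (path_graph xs)"
  proof (rule graph_eqI)
    show "pverts (add_vertex w (path_graph xs)) = pverts G" using xs(3) by (simp add: add_vertex_def path_graph_def)
    show "x \<in> pverts G \<and> y \<in> pverts G" if "(x, y) \<in> parcs (add_vertex w (path_graph xs))" for x y
      using that parcs_path_graph_subset[of x y xs] xs(3) by (simp add: add_vertex_def)
    show "(x, y) \<in> parcs G \<longleftrightarrow> (x, y) \<in> parcs (add_vertex w (path_graph xs))"
      if "x \<in> pverts G" "y \<in> pverts G" for x y
      using that on_path xs(2-4) parcs_path_graph_subset[of x y xs] E_sym[of x y] E_irrefl[of w]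
      by (auto simp: add_vertex_def)
  qed
  with p xs(2) show "is_path_with_isolated_vertex G" unfolding is_path_with_isolated_vertex_def by blast
qed

lemma is_path_with_interior_leaf_iff: "is_path_with_interior_leaf G \<longleftrightarrow> path_with_leaf (pverts G)"
proof
  assume "is_path_with_interior_leaf G"
  then obtain xs w i where xs: "distinct xs" "w \<notin> set xs" "0 < i" "i + 1 < length xs"
    and G: "G = add_edge w (xs ! i) (add_vertex w (path_graph xs))"
    unfolding is_path_with_interior_leaf_def by blast
  have V: "pverts G = insert w (set xs)" and arcs: "parcs G = parcs (path_graph xs) \<union> {(w, xs ! i), (xs ! i, w)}"
    unfolding G by (simp_all add: add_edge_def add_vertex_def path_graph_def)
  have "xs \<noteq> []" using xs(4) by auto
  then have "pathlist (set xs) xs" using xs V by (subst pathlist_iff) (auto simp: arcs)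
  moreover have "\<forall>y\<in>set xs. (w, y) \<in> parcs G \<longleftrightarrow> y = xs ! i"
    using parcs_path_graph_subset[of w _ xs] xs(2) by (auto simp: arcs)
  ultimately show "path_with_leaf (pverts G)" unfolding path_with_leaf_def using xs(2-4) V by blast
next
  assume "path_with_leaf (pverts G)"
  then obtain xs w i where xs: "pathlist (set xs) xs" "w \<notin> set xs" "pverts G = insert w (set xs)"
    "0 < i" "i + 1 < length xs" "\<forall>y\<in>set xs. (w, y) \<in> parcs G \<longleftrightarrow> y = xs ! i"
    unfolding path_with_leaf_def by blast
  have p: "xs \<noteq> []" "distinct xs" using xs(1) by (auto simp: pathlist_def)
  have on_path: "\<forall>x\<in>set xs. \<forall>y\<in>set xs. (x, y) \<in> parcs G \<longleftrightarrow> (x, y) \<in> parcs (path_graph xs)"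
    using pathlist_iff[of xs] xs p by auto
  let ?H = "add_edge w (xs ! i) (add_vertex w (path_graph xs))"
  have arcs: "(x, y) \<in> parcs ?H \<longleftrightarrow> (x, y) \<in> parcs (path_graph xs) \<or> x = w \<and> y = xs ! i \<or> x = xs ! i \<and> y = w" for x y
    by (auto simp: add_edge_def add_vertex_def)
  have i: "xs ! i \<in> set xs" using xs(5) by auto
  have "G = ?H"
  proof (rule graph_eqI)
    show "pverts ?H = pverts G" using xs(3) by (simp add: add_edge_def add_vertex_def path_graph_def)
    show "x \<in> pverts G \<and> y \<in> pverts G" if "(x, y) \<in> parcs ?H" for x y
      using that parcs_path_graph_subset[of x y xs] xs(3) i unfolding arcs by auto
    fix x y assume xy: "x \<in> pverts G" "y \<in> pverts G"
    consider "x \<in> set xs" "y \<in> set xs" | "x = w" "y = w" | "x = w" "y \<in> set xs" | "x \<in> set xs" "y = w"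
      using xy xs(3) by blast
    then show "(x, y) \<in> parcs G \<longleftrightarrow> (x, y) \<in> parcs ?H"
    proof cases
      case 1
      then show ?thesis using on_path xs(2) unfolding arcs by auto
    next
      case 2
      then show ?thesis using E_irrefl[of w] xs(2) i parcs_path_graph_subset[of w w xs] unfolding arcs by auto
    next
      case 3
      then show ?thesis using xs(2,6) i parcs_path_graph_subset[of w y xs] unfolding arcs by auto
    next
      case 4
      then have "(x, y) \<in> parcs G \<longleftrightarrow> (w, x) \<in> parcs G" using E_sym by blast
      then show ?thesis using 4 xs(2,6) i parcs_path_graph_subset[of x w xs] unfolding arcs by auto
    qed
  qed
  with p xs(2,4,5) show "is_path_with_interior_leaf G" unfolding is_path_with_interior_leaf_def by blast
qed

lemma is_path_with_distance_two_edge_iff: "is_path_with_distance_two_edge G \<longleftrightarrow> chorded_path (pverts G)"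
proof
  assume "is_path_with_distance_two_edge G"
  then obtain xs i where xs: "distinct xs" "i + 2 < length xs"
    and G: "G = add_edge (xs ! i) (xs ! (i + 2)) (path_graph xs)"
    unfolding is_path_with_distance_two_edge_def by blast
  have V: "pverts G = set xs"
    and arcs: "\<And>x y. (x, y) \<in> parcs G \<longleftrightarrow> (x, y) \<in> parcs (path_graph xs) \<or>
      x = xs ! i \<and> y = xs ! (i + 2) \<or> x = xs ! (i + 2) \<and> y = xs ! i"
    unfolding G by (auto simp: add_edge_def path_graph_def)
  have "(xs ! k, xs ! l) \<in> parcs G \<longleftrightarrow> l = Suc k \<or> k = Suc l \<or> k = i \<and> l = i + 2 \<or> k = i + 2 \<and> l = i"
    if "k < length xs" "l < length xs" for k l
    unfolding arcs parcs_path_graph_nth[OF xs(1) that] using that xs by (simp add: nth_eq_iff_index_eq)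
  then show "chorded_path (pverts G)" unfolding chorded_path_def using xs V by blast
next
  assume "chorded_path (pverts G)"
  then obtain xs i where xs: "distinct xs" "set xs = pverts G" "i + 2 < length xs"
    and E: "\<And>k l. k < length xs \<Longrightarrow> l < length xs \<Longrightarrow> (xs ! k, xs ! l) \<in> parcs G \<longleftrightarrow>
      l = Suc k \<or> k = Suc l \<or> k = i \<and> l = i + 2 \<or> k = i + 2 \<and> l = i"
    unfolding chorded_path_def by blast
  let ?H = "add_edge (xs ! i) (xs ! (i + 2)) (path_graph xs)"
  have arcs: "(x, y) \<in> parcs ?H \<longleftrightarrow> (x, y) \<in> parcs (path_graph xs) \<or>
      x = xs ! i \<and> y = xs ! (i + 2) \<or> x = xs ! (i + 2) \<and> y = xs ! i" for x y
    by (auto simp: add_edge_def)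
  have i: "xs ! i \<in> set xs" "xs ! (i + 2) \<in> set xs" using xs(3) by auto
  have "G = ?H"
  proof (rule graph_eqI)
    show "pverts ?H = pverts G" using xs(2) by (simp add: add_edge_def path_graph_def)
    show "x \<in> pverts G \<and> y \<in> pverts G" if "(x, y) \<in> parcs ?H" for x y
      using that parcs_path_graph_subset[of x y xs] xs(2) i unfolding arcs by auto
    fix x y assume "x \<in> pverts G" "y \<in> pverts G"
    then obtain k l where kl: "k < length xs" "x = xs ! k" "l < length xs" "y = xs ! l"
      unfolding xs(2)[symmetric] by (metis in_set_conv_nth)
    show "(x, y) \<in> parcs G \<longleftrightarrow> (x, y) \<in> parcs ?H"
      unfolding arcs kl(2,4) E[OF kl(1,3)] parcs_path_graph_nth[OF xs(1) kl(1,3)]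
      using kl xs by (simp add: nth_eq_iff_index_eq)
  qed
  with xs show "is_path_with_distance_two_edge G" unfolding is_path_with_distance_two_edge_def by blast
qed

end

theorem theorem4p14:
  fixes G :: "nat pair_pre_digraph" and n :: nat
  assumes "pair_graph G" and "pverts G = {0..<n}" and "n \<ge> 1"
  shows "q_graph G \<ge> card (pverts G) - 1 \<longleftrightarrow>
    is_path G \<or>
    is_path_with_isolated_vertex G \<or>
    is_path_with_interior_leaf G \<or>
    is_path_with_distance_two_edge G"
proof -
  interpret pair_graph G by fact
  interpret graph_on G
    by unfold_locales (auto dest: arcs_symmetric no_loops)
  let ?E = "\<lambda>x y. (x, y) \<in> parcs G"
  let ?V = "pverts G"
  have V: "finite ?V" "?V \<noteq> {}" "card ?V = n" using assms(2,3) by auto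
  let ?fam = "(\<exists>xs. pathlist ?V xs) \<or> path_and_isolated ?V \<or> path_with_leaf ?V \<or> chorded_path ?V"
  have "card ?V - 1 \<le> q_graph G" if fam: ?fam
  proof -
    \<comment> \<open>The lower bound holds for every realisation, so also for a matrix that attains
      the minimum.\<close>
    obtain A where A: "A \<in> sym_matrices G" "q_mat A = q_graph G"
      using q_graph_attained[OF assms(1)] by blast
    let ?a = "\<lambda>i j. A $$ (i, j)"
    have car: "A \<in> carrier_mat n n" and tr: "transpose_mat A = A"
      and pat: "\<And>i j. i < n \<Longrightarrow> j < n \<Longrightarrow> i \<noteq> j \<Longrightarrow> A $$ (i, j) \<noteq> 0 \<longleftrightarrow> ?E i j"
      using A(1) V(3) by (auto simp: sym_matrices_def)
    have sym: "A $$ (i, j) = A $$ (j, i)" if "i < n" "j < n" for i j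
      using arg_cong[OF tr, of "\<lambda>B. B $$ (i, j)"] car that by simp
    have "realizes ?E ?V ?a"
      using pat sym assms(2) by (auto simp: realizes_def sym_on_def)
    from card_eigs_families[OF this fam] have "card ?V - 1 \<le> card (eigs ?V ?a)" .
    also have "\<dots> = q_mat A" unfolding q_mat_def spectrum_eq_eigs[OF car] assms(2) ..
    finally show ?thesis using A(2) by simp
  qed
  moreover have ?fam if q: "card ?V - 1 \<le> q_graph G"
  proof (rule classification[OF V(1,2)])
    show "\<not> deficient ?V"
    proof
      assume "deficient ?V"
      then obtain a where a: "realizes ?E ?V a"
        and m: "(\<exists>l. eigdim_gt ?V a l 2) \<or> (\<exists>l m. l \<noteq> m \<and> eigdim_gt ?V a l 1 \<and> eigdim_gt ?V a m 1)"
        unfolding deficient_def by blast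
      have s: "sym_on ?V a" using a by (simp add: realizes_def)
      \<comment> \<open>A deficient realisation has at most \<open>card ?V - 2\<close> eigenvalues,
        below the assumed bound.\<close>
      have few: "card (eigs ?V a) + 2 \<le> card ?V"
        using m card_eigs_triple[OF V(1) s] card_eigs_two_doubles[OF V(1) s] by blast
      define A where "A = mat n n (\<lambda>(i, j). a i j)"
      have car: "A \<in> carrier_mat n n" by (simp add: A_def)
      have "transpose_mat A = A"
        using s assms(2) by (intro eq_matI) (auto simp: A_def sym_on_def)
      then have "A \<in> sym_matrices G"
        using a assms(2) V(3) by (auto simp: sym_matrices_def realizes_def A_def)
      then have "q_graph G \<le> q_mat A" by (rule q_graph_le)
      also have "\<dots> = card (eigs ?V (\<lambda>i j. A $$ (i, j)))"
        unfolding q_mat_def spectrum_eq_eigs[OF car] assms(2) ..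
      also have "\<dots> = card (eigs ?V a)"
        using assms(2) by (subst eigs_cong[of ?V _ a]) (auto simp: A_def)
      finally show False using few q by linarith
    qed
  qed
  ultimately show ?thesis
    unfolding is_path_iff is_path_with_isolated_vertex_iff is_path_with_interior_leaf_iff
      is_path_with_distance_two_edge_iff by blast
qed

end
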